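(* Let $D\subset\mathbb C$ be the unit disc with coordinate $z$, equipped with the Poincaré metric $\omega_P$ of curvature $-1$. Let $\mu_0$ be a measurable function on $D$ and $\mu=\mu_0\frac{\partial}{\partial z}\otimes d\bar z$. Assume that the $L_\infty$-norm of $\mu$ satisfies $\|\mu\|_\infty<1$. Then, given any holomorphic one-form $h_0$ on $D$, the equation $$\bar\partial h=-\partial\,(\mu h)$$ has a solution $$h=(I+T\mu)^{-1}h_0 .$$
   Context: $\|\mu\|_\infty=\sup_D|\mu_0|$ (this is the same for the Poincaré and the Euclidean metric). $\mu h$ denotes the contraction $\mu\lrcorner h$: for a $(1,0)$-form $h=a\,dz$, $\mu h=\mu_0a\,d\bar z$. $T=\bar\partial^*G\partial$, where $\bar\partial^*$ is the Hilbert space adjoint of $\bar\partial$ and $G$ the Green operator of $\square_{\bar\partial}=\bar\partial\bar\partial^*+\bar\partial^*\bar\partial$ in the $L^2$-Hodge theory of $(D,\omega_P)$ (i.e. $\square_{\bar\partial}G=G\square_{\bar\partial}=I-H$, $HG=GH=0$, with $H$ the orthogonal projection to $L^2$ harmonic forms). $T$ is an operator of norm at most $1$ on the Hilbert space of $L^2$-forms, $T\mu$ is contraction with $\mu$ followed by $T$, and $I+T\mu$ is invertible on the Hilbert space of $L^2$-forms when $\|\mu\|_\infty<1$.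
   Formalization: The holomorphic one-form h_0 is assumed to be square integrable, since (I+Tμ)^{-1} is defined only on the Hilbert space of L^2-forms and the formula h=(I+Tμ)^{-1}h_0 has no meaning for other h_0 (e.g. dz/(1-z)^2). *)

theory Defs
  imports "HOL-Analysis.Analysis" "HOL-Probability.Essential_Supremum"
begin

definition unit_disc :: "complex set" where
  "unit_disc = ball 0 1"

abbreviation disc_measure :: "complex measure" where
  "disc_measure \<equiv> lebesgue_on unit_disc"

(* The Poincare metric of curvature -1 is ds^2 = density |dz|^2; its volume form is density dx dy. *)
definition poincare_density :: "complex \<Rightarrow> real" where
  "poincare_density z = 4 / (1 - (cmod z)\<^sup>2)\<^sup>2"

(* A form f + a dz + b dzbar + w dz/\dzbar on the disc is represented by the function
   z |-> (f z, a z, b z, w z). Forms of Lebesgue measurable coefficients are identified when they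
   agree a.e.; this is not built into the type, so operators are graphs (relations) that do not
   distinguish a.e. equal forms. *)
type_synonym form = "complex \<Rightarrow> complex \<times> complex \<times> complex \<times> complex"

definition c00 :: "form \<Rightarrow> complex \<Rightarrow> complex" where "c00 \<alpha> z = fst (\<alpha> z)"
definition c10 :: "form \<Rightarrow> complex \<Rightarrow> complex" where "c10 \<alpha> z = fst (snd (\<alpha> z))"
definition c01 :: "form \<Rightarrow> complex \<Rightarrow> complex" where "c01 \<alpha> z = fst (snd (snd (\<alpha> z)))"
definition c11 :: "form \<Rightarrow> complex \<Rightarrow> complex" where "c11 \<alpha> z = snd (snd (snd (\<alpha> z)))"

definition form10 :: "(complex \<Rightarrow> complex) \<Rightarrow> form" where
  "form10 a = (\<lambda>z. (0, a z, 0, 0))"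

definition ae_eq :: "form \<Rightarrow> form \<Rightarrow> bool" where
  "ae_eq \<alpha> \<beta> \<longleftrightarrow> (AE z in disc_measure. \<alpha> z = \<beta> z)"


subsection \<open>The Hilbert space of L2 forms\<close>

(* |dz|^2 = |dzbar|^2 = 2 / density and |dz/\dzbar|^2 = (2 / density)^2 for the Poincare metric. *)
definition herm :: "form \<Rightarrow> form \<Rightarrow> complex \<Rightarrow> complex" where
  "herm \<alpha> \<beta> z =
     c00 \<alpha> z * cnj (c00 \<beta> z)
     + of_real (2 / poincare_density z) * (c10 \<alpha> z * cnj (c10 \<beta> z) + c01 \<alpha> z * cnj (c01 \<beta> z))
     + of_real ((2 / poincare_density z)\<^sup>2) * (c11 \<alpha> z * cnj (c11 \<beta> z))"

definition L2_forms :: "form set" where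
  "L2_forms = {\<alpha>. \<alpha> \<in> borel_measurable disc_measure \<and>
                    integrable disc_measure (\<lambda>z. of_real (poincare_density z) * herm \<alpha> \<alpha> z)}"

definition ip :: "form \<Rightarrow> form \<Rightarrow> complex" where
  "ip \<alpha> \<beta> = (LINT z|disc_measure. of_real (poincare_density z) * herm \<alpha> \<beta> z)"

definition L2_norm :: "form \<Rightarrow> real" where
  "L2_norm \<alpha> = sqrt (Re (ip \<alpha> \<alpha>))"


subsection \<open>Distributional derivatives\<close>

definition d_z :: "(complex \<Rightarrow> complex) \<Rightarrow> complex \<Rightarrow> complex" where
  "d_z \<phi> z = (frechet_derivative \<phi> (at z) 1 - \<i> * frechet_derivative \<phi> (at z) \<i>) / 2"

definition d_zbar :: "(complex \<Rightarrow> complex) \<Rightarrow> complex \<Rightarrow> complex" where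
  "d_zbar \<phi> z = (frechet_derivative \<phi> (at z) 1 + \<i> * frechet_derivative \<phi> (at z) \<i>) / 2"

(* Compactly supported C^1 functions on the disc. As only first order derivatives of locally
   integrable functions occur, testing against these is the same as testing against compactly
   supported smooth functions. *)
definition test_functions :: "(complex \<Rightarrow> complex) set" where
  "test_functions = {\<phi>. (\<forall>z. \<phi> differentiable (at z)) \<and>
     continuous_on UNIV (d_z \<phi>) \<and> continuous_on UNIV (d_zbar \<phi>) \<and>
     (\<exists>K. compact K \<and> K \<subseteq> unit_disc \<and> (\<forall>z. z \<notin> K \<longrightarrow> \<phi> z = 0))}"

definition pairing :: "(complex \<Rightarrow> complex) \<Rightarrow> (complex \<Rightarrow> complex) \<Rightarrow> complex" where
  "pairing u \<phi> = (LINT z|disc_measure. u z * \<phi> z)"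

(* Forms with distribution coefficients, as functions of the test function. *)
type_synonym dist_form = "(complex \<Rightarrow> complex) \<Rightarrow> complex \<times> complex \<times> complex \<times> complex"

definition dist_of :: "form \<Rightarrow> dist_form" where
  "dist_of \<alpha> \<phi> =
     (pairing (c00 \<alpha>) \<phi>, pairing (c10 \<alpha>) \<phi>, pairing (c01 \<alpha>) \<phi>, pairing (c11 \<alpha>) \<phi>)"

(* del (f + b dzbar) = f_z dz + b_z dz/\dzbar *)
definition del_dist :: "form \<Rightarrow> dist_form" where
  "del_dist \<alpha> \<phi> = (0, - pairing (c00 \<alpha>) (d_z \<phi>), 0, - pairing (c01 \<alpha>) (d_z \<phi>))"

(* delbar (f + a dz) = f_zbar dzbar - a_zbar dz/\dzbar: hence the two minus signs in the last
   component, one from dzbar/\dz = - dz/\dzbar and one from the distributional derivative. *)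
definition delbar_dist :: "form \<Rightarrow> dist_form" where
  "delbar_dist \<alpha> \<phi> =
     (0, 0, - pairing (c00 \<alpha>) (d_zbar \<phi>), - (- pairing (c10 \<alpha>) (d_zbar \<phi>)))"


subsection \<open>Operators on the Hilbert space of L2 forms\<close>

(* An operator is its graph: (x, y) is in A when A x = y. Hence (A O B) is "first A, then B". *)
type_synonym form_op = "(form \<times> form) set"

definition del_op :: form_op where
  "del_op = {(\<alpha>, \<beta>). \<alpha> \<in> L2_forms \<and> \<beta> \<in> L2_forms \<and>
                   (\<forall>\<phi>\<in>test_functions. dist_of \<beta> \<phi> = del_dist \<alpha> \<phi>)}"

definition delbar_op :: form_op where
  "delbar_op = {(\<alpha>, \<beta>). \<alpha> \<in> L2_forms \<and> \<beta> \<in> L2_forms \<and>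
                      (\<forall>\<phi>\<in>test_functions. dist_of \<beta> \<phi> = delbar_dist \<alpha> \<phi>)}"

definition adj :: "form_op \<Rightarrow> form_op" where
  "adj A = {(\<beta>, \<alpha>). \<beta> \<in> L2_forms \<and> \<alpha> \<in> L2_forms \<and> (\<forall>(\<xi>, \<eta>)\<in>A. ip \<eta> \<beta> = ip \<xi> \<alpha>)}"

definition op_add :: "form_op \<Rightarrow> form_op \<Rightarrow> form_op" where
  "op_add A B = {(\<alpha>, \<lambda>z. \<beta> z + \<gamma> z) |\<alpha> \<beta> \<gamma>. (\<alpha>, \<beta>) \<in> A \<and> (\<alpha>, \<gamma>) \<in> B}"

definition op_closure :: "form_op \<Rightarrow> form_op" where
  "op_closure A = {(\<alpha>, \<beta>). \<alpha> \<in> L2_forms \<and> \<beta> \<in> L2_forms \<and>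
     (\<exists>x y. (\<forall>n::nat. (x n, y n) \<in> A) \<and>
            (\<lambda>n. L2_norm (\<lambda>z. x n z - \<alpha> z)) \<longlonglongrightarrow> 0 \<and>
            (\<lambda>n. L2_norm (\<lambda>z. y n z - \<beta> z)) \<longlonglongrightarrow> 0)}"

definition box_op :: form_op where
  "box_op = op_add (adj delbar_op O delbar_op) (delbar_op O adj delbar_op)"

definition harmonic :: "form set" where
  "harmonic = {\<eta>. (\<eta>, \<lambda>z. 0) \<in> box_op}"

definition harmonic_proj :: form_op where
  "harmonic_proj = {(\<gamma>, \<eta>). \<gamma> \<in> L2_forms \<and> \<eta> \<in> harmonic \<and>
                             (\<forall>\<theta>\<in>harmonic. ip (\<lambda>z. \<gamma> z - \<eta> z) \<theta> = 0)}"

(* The graph of G is given by box G = I - H and H G = 0. These two equations determine G, because a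
   form in the kernel of box with vanishing harmonic projection is zero; G box = I - H on the domain
   of box and G H = 0 follow from them, since box is symmetric. *)
definition green :: form_op where
  "green = {(\<gamma>, \<omega>). (\<omega>, \<lambda>z. 0) \<in> harmonic_proj \<and>
     (\<exists>\<eta>. (\<gamma>, \<eta>) \<in> harmonic_proj \<and> (\<omega>, \<lambda>z. \<gamma> z - \<eta> z) \<in> box_op)}"

(* delbar^* G del, literally applied, is defined only on the forms whose image under del is in L2;
   T is its extension by continuity to the space of all L2 forms. *)
definition T_op :: form_op where
  "T_op = op_closure (del_op O green O adj delbar_op)"

(* Contraction with mu0 d/dz (x) dzbar: dz is sent to mu0 dzbar, and 1, dzbar and dz/\dzbar are sent
   to 0 (the last because dzbar/\dzbar = 0). *)
definition contract :: "(complex \<Rightarrow> complex) \<Rightarrow> form \<Rightarrow> form" where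
  "contract \<mu>\<^sub>0 \<alpha> = (\<lambda>z. (0, 0, \<mu>\<^sub>0 z * c10 \<alpha> z, 0))"

definition contract_op :: "(complex \<Rightarrow> complex) \<Rightarrow> form_op" where
  "contract_op \<mu>\<^sub>0 = {(\<alpha>, contract \<mu>\<^sub>0 \<alpha>) |\<alpha>. \<alpha> \<in> L2_forms}"

definition I_plus_T :: "(complex \<Rightarrow> complex) \<Rightarrow> form_op" where
  "I_plus_T \<mu>\<^sub>0 = op_add (Id_on L2_forms) (contract_op \<mu>\<^sub>0 O T_op)"

definition invertible_op :: "form_op \<Rightarrow> bool" where
  "invertible_op A \<longleftrightarrow>
     A \<subseteq> L2_forms \<times> L2_forms \<and>
     (\<forall>\<alpha>\<in>L2_forms. \<exists>\<beta>. (\<alpha>, \<beta>) \<in> A \<and> (\<forall>\<beta>'. (\<alpha>, \<beta>') \<in> A \<longrightarrow> ae_eq \<beta>' \<beta>)) \<and>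
     (\<forall>\<beta>\<in>L2_forms. \<exists>\<alpha>. (\<alpha>, \<beta>) \<in> A \<and> (\<forall>\<alpha>'. (\<alpha>', \<beta>) \<in> A \<longrightarrow> ae_eq \<alpha>' \<alpha>))"

end

theory Submission
  imports Defs "HOL-Complex_Analysis.Cauchy_Integral_Formula"
begin

text \<open>Only the coefficient \<open>b\<close> of \<open>dzbar\<close> matters for \<open>T\<close>, and on forms of degree one the Poincare norm is a
  multiple of the Euclidean one. Let \<open>u = (1 - \<bar>z\<bar>\<^sup>2) q\<close> with a polynomial \<open>q\<close> in \<open>z\<close> and \<open>zbar\<close>. The
  form \<open>\<omega>\<close> with coefficient \<open>- 2 q / (1 - \<bar>z\<bar>\<^sup>2)\<close> solves \<open>\<box> \<omega> = del (u\<^sub>z\<^sub>b\<^sub>a\<^sub>r dzbar)\<close>, and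
  \<open>delbar\<^sup>* \<omega> = - u\<^sub>z dz\<close>; hence \<open>T\<close> maps \<open>u\<^sub>z\<^sub>b\<^sub>a\<^sub>r dzbar\<close> to \<open>- u\<^sub>z dz\<close>, an isometry by integration by parts.
  Every polynomial is the sum of some \<open>u\<^sub>z\<^sub>b\<^sub>a\<^sub>r\<close> and a polynomial in \<open>zbar\<close>, so these functions are dense in the
  orthogonal complement of the antiholomorphic functions, on which \<open>T\<close> vanishes. Therefore the closure \<open>T\<close>
  is everywhere defined with norm at most one: \<open>T (b dzbar) = t dz\<close> if and only if
  \<open>delbar (t dz) = del (b dzbar)\<close> weakly and \<open>t\<close> is orthogonal to the kernel of \<open>delbar\<close>. For
  \<open>\<parallel>\<mu>\<parallel>\<^sub>\<infinity> < 1\<close> the equation \<open>h + T \<mu> h = h\<^sub>0\<close> is then solved by a contraction, and applying \<open>delbar\<close> to it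
  gives \<open>delbar h = - del (\<mu> h)\<close>.\<close>

section \<open>Square integrable functions\<close>

text \<open>The form \<open>\<omega>\<close> is read off from the adjoint: on type (1,1), delbar^*
  sends the coefficient w to half the z-derivative of (1 - |z|^2)^2 w, so delbar^*
  \<open>\<omega>\<close> = - u_z dz is met by w = - 2 u / (1 - |z|^2)^2. The factor 1 - |z|^2 in u
  leaves at most a simple pole on the circle, which the weight of type (1,1) absorbs. The same
  factor puts u into L2 and removes boundary terms, once weak derivatives may be tested against
  functions that vanish on the circle without compact support.

  The Green operator is only a relation and box is never inverted in general. It is evaluated on the
  dense family alone, and the rest of T is reached through the closure. Conversely, an arbitrary
  pair in the graph may mix types and carry unknown harmonic parts. Type (1,1) has no nonzero
  harmonic forms, but degree one has many; the condition H \<open>\<omega>\<close> = 0 removes their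
  influence on delbar^* \<open>\<omega>\<close>. Both directions meet in \<open>T_coeff\<close>,
  whose two conditions survive L2 limits and determine the image up to null sets.\<close>

definition sq_int :: "'a measure \<Rightarrow> ('a \<Rightarrow> complex) set" where
  "sq_int M = {f \<in> borel_measurable M. integrable M (\<lambda>x. (cmod (f x))\<^sup>2)}"

definition sq_inner :: "'a measure \<Rightarrow> ('a \<Rightarrow> complex) \<Rightarrow> ('a \<Rightarrow> complex) \<Rightarrow> complex" where
  "sq_inner M f g = (LINT x|M. f x * cnj (g x))"

definition sq_norm :: "'a measure \<Rightarrow> ('a \<Rightarrow> complex) \<Rightarrow> real" where
  "sq_norm M f = sqrt (LINT x|M. (cmod (f x))\<^sup>2)"

lemma sq_int_integrable: "f \<in> sq_int M \<Longrightarrow> integrable M (\<lambda>x. (cmod (f x))\<^sup>2)"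
  by (simp add: sq_int_def)

lemma sq_int_bound:
  assumes "f \<in> sq_int M" "g \<in> borel_measurable M" "AE x in M. cmod (g x) \<le> C * cmod (f x)"
  shows "g \<in> sq_int M"
proof -
  have "integrable M (\<lambda>x. C\<^sup>2 * (cmod (f x))\<^sup>2)"
    using sq_int_integrable[OF assms(1)] by simp
  moreover have "AE x in M. norm ((cmod (g x))\<^sup>2) \<le> norm (C\<^sup>2 * (cmod (f x))\<^sup>2)"
    using assms(3)
  proof eventually_elim
    case (elim x)
    then have "(cmod (g x))\<^sup>2 \<le> (C * cmod (f x))\<^sup>2"
      by (intro power_mono) auto
    then show ?case by (simp add: power_mult_distrib)
  qed
  moreover have "(\<lambda>x. (cmod (g x))\<^sup>2) \<in> borel_measurable M"
    using assms(2) by measurable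
  ultimately have "integrable M (\<lambda>x. (cmod (g x))\<^sup>2)"
    using Bochner_Integration.integrable_bound by blast
  then show ?thesis using assms(2) by (simp add: sq_int_def)
qed

lemma sq_int_scale [intro]: "f \<in> sq_int M \<Longrightarrow> (\<lambda>x. c * f x) \<in> sq_int M"
  by (rule sq_int_bound[where C = "cmod c"]) (auto simp: norm_mult sq_int_def)

lemma sq_int_cnj [intro]: "f \<in> sq_int M \<Longrightarrow> (\<lambda>x. cnj (f x)) \<in> sq_int M"
  by (auto simp: sq_int_def intro: borel_measurable_continuous_on[OF continuous_on_cnj[OF continuous_on_id]])

lemma sq_int_uminus [intro]: "f \<in> sq_int M \<Longrightarrow> (\<lambda>x. - f x) \<in> sq_int M"
  by (rule sq_int_bound[where C = 1]) (auto simp: sq_int_def)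

lemma sq_int_add [intro]:
  assumes "f \<in> sq_int M" "g \<in> sq_int M"
  shows "(\<lambda>x. f x + g x) \<in> sq_int M"
proof -
  have [measurable]: "f \<in> borel_measurable M" "g \<in> borel_measurable M"
    using assms by (auto simp: sq_int_def)
  have bd: "(cmod (a + b))\<^sup>2 \<le> 2 * (cmod a)\<^sup>2 + 2 * (cmod b)\<^sup>2" for a b :: complex
  proof -
    have "(cmod (a + b))\<^sup>2 \<le> (cmod a + cmod b)\<^sup>2"
      by (intro power_mono norm_triangle_ineq) auto
    also have "\<dots> \<le> 2 * (cmod a)\<^sup>2 + 2 * (cmod b)\<^sup>2"
      using zero_le_power2[of "cmod a - cmod b"] by (simp add: power2_eq_square algebra_simps)
    finally show ?thesis .
  qed
  have "integrable M (\<lambda>x. 2 * (cmod (f x))\<^sup>2 + 2 * (cmod (g x))\<^sup>2)"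
    using assms by (auto simp: sq_int_def)
  then have "integrable M (\<lambda>x. (cmod (f x + g x))\<^sup>2)"
    by (rule Bochner_Integration.integrable_bound) (auto intro!: AE_I2 simp: bd)
  then show ?thesis by (simp add: sq_int_def)
qed

lemma sq_int_diff [intro]:
  assumes "f \<in> sq_int M" "g \<in> sq_int M"
  shows "(\<lambda>x. f x - g x) \<in> sq_int M"
  using sq_int_add[OF assms(1) sq_int_uminus[OF assms(2)]] by simp

lemma sq_int_zero [simp, intro]: "(\<lambda>x. 0) \<in> sq_int M"
  by (simp add: sq_int_def)

lemma sq_int_mult_integrable:
  assumes "f \<in> sq_int M" "g \<in> sq_int M"
  shows "integrable M (\<lambda>x. f x * g x)"
proof -
  have [measurable]: "f \<in> borel_measurable M" "g \<in> borel_measurable M"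
    using assms by (auto simp: sq_int_def)
  have bd: "a * b \<le> a\<^sup>2 + b\<^sup>2" if "0 \<le> a" "0 \<le> b" for a b :: real
    using sum_squares_bound[of a b] mult_nonneg_nonneg[OF that] by linarith
  have "integrable M (\<lambda>x. (cmod (f x))\<^sup>2 + (cmod (g x))\<^sup>2)"
    using assms by (auto simp: sq_int_def)
  then show ?thesis
    by (rule Bochner_Integration.integrable_bound) (auto intro!: AE_I2 bd simp: norm_mult)
qed

lemma sq_int_inner_integrable:
  "f \<in> sq_int M \<Longrightarrow> g \<in> sq_int M \<Longrightarrow> integrable M (\<lambda>x. f x * cnj (g x))"
  by (intro sq_int_mult_integrable sq_int_cnj)

lemma sq_inner_diff_left:
  "f \<in> sq_int M \<Longrightarrow> g \<in> sq_int M \<Longrightarrow> h \<in> sq_int M \<Longrightarrow>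
    sq_inner M (\<lambda>x. f x - g x) h = sq_inner M f h - sq_inner M g h"
  by (simp add: sq_inner_def sq_int_inner_integrable left_diff_distrib)

lemma sq_inner_add_left:
  "f \<in> sq_int M \<Longrightarrow> g \<in> sq_int M \<Longrightarrow> h \<in> sq_int M \<Longrightarrow>
    sq_inner M (\<lambda>x. f x + g x) h = sq_inner M f h + sq_inner M g h"
  by (simp add: sq_inner_def sq_int_inner_integrable distrib_right)

lemma sq_inner_scale_left: "sq_inner M (\<lambda>x. c * f x) h = c * sq_inner M f h"
  by (simp add: sq_inner_def mult.assoc)

lemma sq_inner_commute: "sq_inner M g f = cnj (sq_inner M f g)"
  unfolding sq_inner_def by (subst Bochner_Integration.integral_cnj[symmetric]) (simp add: mult.commute)

lemma sq_inner_diff_right: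
  "f \<in> sq_int M \<Longrightarrow> g \<in> sq_int M \<Longrightarrow> h \<in> sq_int M \<Longrightarrow>
    sq_inner M h (\<lambda>x. f x - g x) = sq_inner M h f - sq_inner M h g"
  by (simp add: sq_inner_def sq_int_inner_integrable right_diff_distrib)

lemma sq_inner_add_right:
  "f \<in> sq_int M \<Longrightarrow> g \<in> sq_int M \<Longrightarrow> h \<in> sq_int M \<Longrightarrow>
    sq_inner M h (\<lambda>x. f x + g x) = sq_inner M h f + sq_inner M h g"
  by (simp add: sq_inner_def sq_int_inner_integrable distrib_left)

lemma sq_inner_scale_right: "sq_inner M h (\<lambda>x. c * f x) = cnj c * sq_inner M h f"
  by (simp add: sq_inner_def mult.left_commute)

lemma sq_norm_nonneg [simp]: "0 \<le> sq_norm M f"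
  by (simp add: sq_norm_def)

lemma sq_norm_power2: "(sq_norm M f)\<^sup>2 = (LINT x|M. (cmod (f x))\<^sup>2)"
  by (simp add: sq_norm_def)

lemma sq_inner_self: "sq_inner M f f = complex_of_real ((sq_norm M f)\<^sup>2)"
  unfolding sq_inner_def sq_norm_power2 complex_norm_square[symmetric]
  by (simp flip: of_real_power)

lemma sq_norm_scale: "sq_norm M (\<lambda>x. c * f x) = cmod c * sq_norm M f"
  by (simp add: sq_norm_def norm_mult power_mult_distrib real_sqrt_mult)

lemma sq_norm_minus_commute: "sq_norm M (\<lambda>x. f x - g x) = sq_norm M (\<lambda>x. g x - f x)"
  by (simp add: sq_norm_def norm_minus_commute)

lemma sq_norm_eq_0_iff:
  assumes "f \<in> sq_int M"
  shows "sq_norm M f = 0 \<longleftrightarrow> (AE x in M. f x = 0)"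
  using integral_nonneg_eq_0_iff_AE[OF sq_int_integrable[OF assms]]
  by (simp add: sq_norm_def)

lemma sq_norm_cong_AE:
  assumes "f \<in> borel_measurable M" "g \<in> borel_measurable M" "AE x in M. f x = g x"
  shows "sq_norm M f = sq_norm M g"
  unfolding sq_norm_def using assms by (intro arg_cong[where f = sqrt] integral_cong_AE) auto

lemma sq_norm_mono_AE:
  assumes "f \<in> borel_measurable M" "g \<in> sq_int M" "0 \<le> C" "AE x in M. cmod (f x) \<le> C * cmod (g x)"
  shows "sq_norm M f \<le> C * sq_norm M g"
proof -
  have "f \<in> sq_int M" using sq_int_bound[OF assms(2,1,4)] .
  then have "integrable M (\<lambda>x. (cmod (f x))\<^sup>2)"
    by (rule sq_int_integrable)
  then have "(sq_norm M f)\<^sup>2 \<le> (LINT x|M. C\<^sup>2 * (cmod (g x))\<^sup>2)"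
    unfolding sq_norm_power2
  proof (rule integral_mono_AE)
    show "AE x in M. (cmod (f x))\<^sup>2 \<le> C\<^sup>2 * (cmod (g x))\<^sup>2"
      using assms(4) by eventually_elim (simp add: power_mult_distrib[symmetric] power_mono)
  qed (use assms(2) in \<open>simp_all add: sq_int_integrable\<close>)
  also have "\<dots> = (C * sq_norm M g)\<^sup>2"
    by (simp add: power_mult_distrib sq_norm_power2)
  finally show ?thesis by (rule power2_le_imp_le) (simp add: assms(3))
qed

lemma sq_int_bounded_mult:
  assumes g: "g \<in> borel_measurable M" and k: "AE x in M. cmod (g x) \<le> k" "0 \<le> k" and f: "f \<in> sq_int M"
  shows "(\<lambda>x. g x * f x) \<in> sq_int M" "sq_norm M (\<lambda>x. g x * f x) \<le> k * sq_norm M f"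
proof -
  have m: "(\<lambda>x. g x * f x) \<in> borel_measurable M"
    using g f by (auto simp: sq_int_def intro: borel_measurable_times)
  have ae: "AE x in M. cmod (g x * f x) \<le> k * cmod (f x)"
    using k(1) by eventually_elim (simp add: norm_mult mult_right_mono)
  show "(\<lambda>x. g x * f x) \<in> sq_int M" "sq_norm M (\<lambda>x. g x * f x) \<le> k * sq_norm M f"
    by (rule sq_int_bound[OF f m ae], rule sq_norm_mono_AE[OF m f k(2) ae])
qed

text \<open>Cauchy-Schwarz for absolute values: the integral of (|f| - s |g|)^2 is a nonnegative
  quadratic in s, evaluated at its minimum \<open>I / G\<close>.\<close>

lemma integral_cmod_mult_le:
  assumes "f \<in> sq_int M" "g \<in> sq_int M"
  shows "(LINT x|M. cmod (f x) * cmod (g x)) \<le> sq_norm M f * sq_norm M g"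
proof -
  define F where "F = (LINT x|M. (cmod (f x))\<^sup>2)"
  define G where "G = (LINT x|M. (cmod (g x))\<^sup>2)"
  define I where "I = (LINT x|M. cmod (f x) * cmod (g x))"
  have iI: "integrable M (\<lambda>x. cmod (f x) * cmod (g x))"
    using integrable_norm[OF sq_int_mult_integrable[OF assms]] by (simp add: norm_mult)
  have q: "0 \<le> F - 2 * s * I + s\<^sup>2 * G" for s
  proof -
    have "0 \<le> (LINT x|M. (cmod (f x) - s * cmod (g x))\<^sup>2)" by simp
    also have "\<dots> = (LINT x|M. (cmod (f x))\<^sup>2 - 2 * s * (cmod (f x) * cmod (g x)) + s\<^sup>2 * (cmod (g x))\<^sup>2)"
      by (intro Bochner_Integration.integral_cong) (auto simp: power2_eq_square algebra_simps)
    also have "\<dots> = F - 2 * s * I + s\<^sup>2 * G"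
      unfolding F_def G_def I_def
      using iI sq_int_integrable[OF assms(1)] sq_int_integrable[OF assms(2)] by simp
    finally show ?thesis .
  qed
  have G: "0 \<le> G" and F: "0 \<le> F" by (auto simp: F_def G_def)
  have "I\<^sup>2 \<le> F * G"
  proof (cases "G = 0")
    case True
    have "I = 0"
    proof (rule ccontr)
      assume "I \<noteq> 0"
      \<comment> \<open>For G = 0 the quadratic is linear in s, and this s would give it the value
        -1.\<close>
      then show False using q[of "(F + 1) / (2 * I)"] True by simp
    qed
    then show ?thesis using True by simp
  next
    case False
    then show ?thesis using q[of "I / G"] G by (simp add: field_simps power2_eq_square)
  qed
  then have "I\<^sup>2 \<le> (sq_norm M f * sq_norm M g)\<^sup>2"
    by (simp add: power_mult_distrib sq_norm_power2 F_def G_def)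
  then show ?thesis unfolding I_def[symmetric] by (rule power2_le_imp_le) simp
qed

lemma sq_inner_le:
  assumes "f \<in> sq_int M" "g \<in> sq_int M"
  shows "cmod (sq_inner M f g) \<le> sq_norm M f * sq_norm M g"
proof -
  have "cmod (sq_inner M f g) \<le> (LINT x|M. cmod (f x * cnj (g x)))"
    unfolding sq_inner_def by (rule integral_norm_bound)
  also have "\<dots> \<le> sq_norm M f * sq_norm M g"
    using integral_cmod_mult_le[OF assms] by (simp add: norm_mult)
  finally show ?thesis .
qed

lemma sq_norm_add_power2:
  assumes "f \<in> sq_int M" "g \<in> sq_int M"
  shows "(sq_norm M (\<lambda>x. f x + g x))\<^sup>2 = (sq_norm M f)\<^sup>2 + 2 * Re (sq_inner M f g) + (sq_norm M g)\<^sup>2"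
proof -
  have fg: "(\<lambda>x. f x + g x) \<in> sq_int M" using assms by auto
  have "complex_of_real ((sq_norm M (\<lambda>x. f x + g x))\<^sup>2) =
      complex_of_real ((sq_norm M f)\<^sup>2) + (sq_inner M f g + cnj (sq_inner M f g)) + complex_of_real ((sq_norm M g)\<^sup>2)"
    unfolding sq_inner_self[symmetric] sq_inner_commute[of M g f, symmetric]
    using assms fg by (simp add: sq_inner_add_left sq_inner_add_right)
  then have "Re (complex_of_real ((sq_norm M (\<lambda>x. f x + g x))\<^sup>2)) =
      Re (complex_of_real ((sq_norm M f)\<^sup>2) + (sq_inner M f g + cnj (sq_inner M f g)) + complex_of_real ((sq_norm M g)\<^sup>2))"
    by (rule arg_cong)
  then show ?thesis by simp
qed

lemma sq_norm_diff_power2: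
  assumes "f \<in> sq_int M" "g \<in> sq_int M"
  shows "(sq_norm M (\<lambda>x. f x - g x))\<^sup>2 = (sq_norm M f)\<^sup>2 - 2 * Re (sq_inner M f g) + (sq_norm M g)\<^sup>2"
  using sq_norm_add_power2[OF assms(1) sq_int_scale[OF assms(2), of "-1"]]
    sq_norm_scale[of M "-1" g] sq_inner_scale_right[of M f "-1" g]
  by simp

lemma sq_norm_triangle:
  assumes "f \<in> sq_int M" "g \<in> sq_int M"
  shows "sq_norm M (\<lambda>x. f x + g x) \<le> sq_norm M f + sq_norm M g"
proof -
  have "Re (sq_inner M f g) \<le> sq_norm M f * sq_norm M g"
    using sq_inner_le[OF assms] complex_Re_le_cmod order_trans by blast
  then have "(sq_norm M (\<lambda>x. f x + g x))\<^sup>2 \<le> (sq_norm M f + sq_norm M g)\<^sup>2"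
    unfolding sq_norm_add_power2[OF assms] by (simp add: power2_sum)
  then show ?thesis by (rule power2_le_imp_le) simp
qed

lemma sq_norm_triangle_diff:
  assumes "f \<in> sq_int M" "g \<in> sq_int M" "h \<in> sq_int M"
  shows "sq_norm M (\<lambda>x. f x - h x) \<le> sq_norm M (\<lambda>x. f x - g x) + sq_norm M (\<lambda>x. g x - h x)"
  using sq_norm_triangle[OF sq_int_diff[OF assms(1,2)] sq_int_diff[OF assms(2,3)]] by simp

lemma tendsto_sq_inner:
  assumes "\<And>n. f n \<in> sq_int M" "g \<in> sq_int M" "h \<in> sq_int M"
    and "(\<lambda>n. sq_norm M (\<lambda>x. f n x - g x)) \<longlonglongrightarrow> 0"
  shows "(\<lambda>n. sq_inner M (f n) h) \<longlonglongrightarrow> sq_inner M g h"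
proof -
  have "(\<lambda>n. sq_inner M (f n) h - sq_inner M g h) \<longlonglongrightarrow> 0"
  proof (rule Lim_null_comparison)
    show "\<forall>\<^sub>F n in sequentially. norm (sq_inner M (f n) h - sq_inner M g h) \<le>
        sq_norm M (\<lambda>x. f n x - g x) * sq_norm M h"
      using sq_inner_le[OF sq_int_diff[OF assms(1,2)] assms(3)] assms(1-3)
      by (simp add: sq_inner_diff_left)
    show "(\<lambda>n. sq_norm M (\<lambda>x. f n x - g x) * sq_norm M h) \<longlonglongrightarrow> 0"
      using tendsto_mult_left_zero[OF assms(4)] .
  qed
  then show ?thesis by (rule LIM_zero_cancel)
qed

lemma tendsto_sq_norm:
  assumes "\<And>n. f n \<in> sq_int M" "g \<in> sq_int M"
    and "(\<lambda>n. sq_norm M (\<lambda>x. f n x - g x)) \<longlonglongrightarrow> 0"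
  shows "(\<lambda>n. sq_norm M (f n)) \<longlonglongrightarrow> sq_norm M g"
proof -
  have "(\<lambda>n. sq_norm M (f n) - sq_norm M g) \<longlonglongrightarrow> 0"
  proof (rule Lim_null_comparison[OF _ assms(3)])
    have "\<bar>sq_norm M (f n) - sq_norm M g\<bar> \<le> sq_norm M (\<lambda>x. f n x - g x)" for n
      using sq_norm_triangle[OF sq_int_diff[OF assms(1)[of n] assms(2)] assms(2)]
        sq_norm_triangle[OF sq_int_diff[OF assms(2) assms(1)[of n]] assms(1)[of n]]
        sq_norm_minus_commute[of M g "f n"]
      by simp
    then show "\<forall>\<^sub>F n in sequentially. norm (sq_norm M (f n) - sq_norm M g) \<le> sq_norm M (\<lambda>x. f n x - g x)"
      by simp
  qed
  then show ?thesis by (rule LIM_zero_cancel)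
qed

lemma sq_int_const: "finite_measure M \<Longrightarrow> (\<lambda>x. c) \<in> sq_int M"
  by (simp add: sq_int_def finite_measure.integrable_const)

lemma sq_int_integrable1:
  assumes "finite_measure M" "f \<in> sq_int M"
  shows "integrable M f"
  using sq_int_mult_integrable[OF assms(2) sq_int_const[OF assms(1), of 1]] by simp

lemma nn_integral_sq_norm:
  assumes "f \<in> sq_int M"
  shows "(\<integral>\<^sup>+x. ennreal ((cmod (f x))\<^sup>2) \<partial>M) = ennreal ((sq_norm M f)\<^sup>2)"
  using nn_integral_eq_integral[OF sq_int_integrable[OF assms]] by (simp add: sq_norm_power2)

text \<open>Fatou's lemma in L2. Membership of the limit is part of the conclusion, and the norm
  bound is asked only from some index on, as it holds on the tail of a Cauchy sequence.\<close>

lemma sq_int_fatou: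
  assumes "\<And>k. f k \<in> sq_int M" "g \<in> borel_measurable M"
    and "AE x in M. (\<lambda>k. f k x) \<longlonglongrightarrow> g x"
    and "\<forall>\<^sub>F k in sequentially. sq_norm M (f k) \<le> B" "0 \<le> B"
  shows "g \<in> sq_int M" "sq_norm M g \<le> B"
proof -
  have [measurable]: "f k \<in> borel_measurable M" for k
    using assms(1)[of k] by (simp add: sq_int_def)
  note [measurable] = assms(2)
  have "(\<integral>\<^sup>+x. ennreal ((cmod (g x))\<^sup>2) \<partial>M) = (\<integral>\<^sup>+x. liminf (\<lambda>k. ennreal ((cmod (f k x))\<^sup>2)) \<partial>M)"
  proof (rule nn_integral_cong_AE)
    show "AE x in M. ennreal ((cmod (g x))\<^sup>2) = liminf (\<lambda>k. ennreal ((cmod (f k x))\<^sup>2))"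
      using assms(3)
    proof eventually_elim
      case (elim x)
      then have "(\<lambda>k. ennreal ((cmod (f k x))\<^sup>2)) \<longlonglongrightarrow> ennreal ((cmod (g x))\<^sup>2)"
        by (intro tendsto_intros)
      then show ?case
        using lim_imp_Liminf[OF trivial_limit_sequentially] by metis
    qed
  qed
  also have "\<dots> \<le> liminf (\<lambda>k. \<integral>\<^sup>+x. ennreal ((cmod (f k x))\<^sup>2) \<partial>M)"
    by (rule nn_integral_liminf) simp
  also have "\<dots> \<le> limsup (\<lambda>k. \<integral>\<^sup>+x. ennreal ((cmod (f k x))\<^sup>2) \<partial>M)"
    by (intro Liminf_le_Limsup) simp
  also have "\<dots> \<le> ennreal (B\<^sup>2)"
  proof (rule Limsup_bounded)
    show "\<forall>\<^sub>F k in sequentially. (\<integral>\<^sup>+x. ennreal ((cmod (f k x))\<^sup>2) \<partial>M) \<le> ennreal (B\<^sup>2)"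
      using assms(4)
      by eventually_elim (auto simp: nn_integral_sq_norm[OF assms(1)] intro!: ennreal_leI power_mono)
  qed
  finally have le: "(\<integral>\<^sup>+x. ennreal ((cmod (g x))\<^sup>2) \<partial>M) \<le> ennreal (B\<^sup>2)" .
  then have "integrable M (\<lambda>x. (cmod (g x))\<^sup>2)"
    by (intro integrableI_bounded) (auto simp: order_le_less_trans)
  then show g: "g \<in> sq_int M" using assms(2) by (simp add: sq_int_def)
  have "(sq_norm M g)\<^sup>2 \<le> B\<^sup>2"
    using le unfolding nn_integral_sq_norm[OF g] by (simp add: ennreal_le_iff)
  then show "sq_norm M g \<le> B" by (rule power2_le_imp_le) (rule assms(5))
qed

section \<open>Completeness and orthogonal projection\<close>

lemma Cauchy_fast_subseq:
  fixes d :: "nat \<Rightarrow> nat \<Rightarrow> real"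
  assumes "\<And>e. 0 < e \<Longrightarrow> \<exists>N. \<forall>m\<ge>N. \<forall>n\<ge>N. d m n < e"
  obtains s :: "nat \<Rightarrow> nat" where "strict_mono s" "\<And>k n. s k \<le> n \<Longrightarrow> d n (s k) < (1/2) ^ k"
proof -
  have "\<exists>N. \<forall>m\<ge>N. \<forall>n\<ge>N. d m n < (1/2)^k" for k :: nat
    using assms by simp
  then obtain N where N: "\<And>k m n. N k \<le> m \<Longrightarrow> N k \<le> n \<Longrightarrow> d m n < (1/2)^k"
    by metis
  \<comment> \<open>The maximum keeps \<open>s\<close> strictly increasing and past each threshold
    \<open>N\<close>.\<close>
  define s where "s = rec_nat (N 0) (\<lambda>k p. max (Suc p) (N (Suc k)))"
  have sN: "N k \<le> s k" for k by (cases k) (auto simp: s_def)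
  have "strict_mono s"
    by (rule strict_mono_Suc_iff[THEN iffD2]) (auto simp: s_def less_max_iff_disj)
  moreover have "d n (s k) < (1/2) ^ k" if "s k \<le> n" for k n
    using N sN that le_trans by blast
  ultimately show ?thesis using that by blast
qed

text \<open>Riesz-Fischer. On a finite measure space the L2 bounds on the steps of a fast
  subsequence bound their L1 norms, so the steps are a.e. summable and the subsequence converges
  a.e.; Fatou leads back to norm convergence.\<close>

lemma sq_norm_complete:
  assumes fin: "finite_measure M" and f: "\<And>n. f n \<in> sq_int M"
    and Cauchy: "\<And>e. 0 < e \<Longrightarrow> \<exists>N. \<forall>m\<ge>N. \<forall>n\<ge>N. sq_norm M (\<lambda>x. f m x - f n x) < e"
  obtains g where "g \<in> sq_int M" "(\<lambda>n. sq_norm M (\<lambda>x. f n x - g x)) \<longlonglongrightarrow> 0"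
proof -
  obtain s :: "nat \<Rightarrow> nat" where s: "strict_mono s"
    "\<And>k n. s k \<le> n \<Longrightarrow> sq_norm M (\<lambda>x. f n x - f (s k) x) < (1/2) ^ k"
    using Cauchy_fast_subseq[of "\<lambda>m n. sq_norm M (\<lambda>x. f m x - f n x)"] Cauchy by blast
  have [measurable]: "f k \<in> borel_measurable M" for k
    using f[of k] by (simp add: sq_int_def)
  define d where "d k x = cmod (f (s (Suc k)) x - f (s k) x)" for k x
  have [measurable]: "d k \<in> borel_measurable M" for k unfolding d_def by measurable
  define C where "C = sq_norm M (\<lambda>x. 1)"
  have dC: "(\<integral>\<^sup>+x. ennreal (d k x) \<partial>M) \<le> ennreal (C * (1/2)^k)" for k
  proof -
    have i: "(\<lambda>x. f (s (Suc k)) x - f (s k) x) \<in> sq_int M" using f by auto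
    have "(\<integral>\<^sup>+x. ennreal (d k x) \<partial>M) = ennreal (LINT x|M. d k x)"
      unfolding d_def using sq_int_integrable1[OF fin i] by (intro nn_integral_eq_integral) auto
    also have "(LINT x|M. d k x) \<le> sq_norm M (\<lambda>x. f (s (Suc k)) x - f (s k) x) * C"
      using integral_cmod_mult_le[OF i sq_int_const[OF fin, of 1]] by (simp add: d_def C_def)
    also have "\<dots> \<le> (1/2)^k * C"
      using s(2)[of k "s (Suc k)"] strict_monoD[OF s(1), of k "Suc k"]
      by (intro mult_right_mono) (auto simp: C_def)
    finally show ?thesis by (simp add: ennreal_leI mult.commute)
  qed
  have "(\<integral>\<^sup>+x. (\<Sum>k. ennreal (d k x)) \<partial>M) = (\<Sum>k. \<integral>\<^sup>+x. ennreal (d k x) \<partial>M)"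
    by (rule nn_integral_suminf) simp
  also have "\<dots> \<le> (\<Sum>k. ennreal (C * (1/2)^k))"
    by (intro suminf_le dC) auto
  also have "\<dots> = ennreal (\<Sum>k. C * (1/2)^k)"
    by (intro suminf_ennreal2 summable_mult summable_geometric) (auto simp: C_def)
  also have "\<dots> < \<infinity>" by simp
  finally have "AE x in M. (\<Sum>k. ennreal (d k x)) \<noteq> \<infinity>"
    by (intro nn_integral_PInf_AE) auto
  then have conv: "AE x in M. convergent (\<lambda>k. f (s k) x)"
  proof eventually_elim
    case (elim x)
    then have "summable (\<lambda>k. d k x)"
      by (intro summable_suminf_not_top) (auto simp: d_def)
    then have "summable (\<lambda>k. f (s (Suc k)) x - f (s k) x)"
      unfolding d_def by (rule summable_norm_cancel)
    then have "convergent (\<lambda>n. \<Sum>k<n. f (s (Suc k)) x - f (s k) x)"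
      by (simp add: summable_iff_convergent)
    then have "convergent (\<lambda>n. f (s n) x - f (s 0) x)"
      by (simp only: sum_lessThan_telescope[of "\<lambda>k. f (s k) x"])
    then have "convergent (\<lambda>n. (f (s n) x - f (s 0) x) + f (s 0) x)"
      by (intro convergent_add convergent_const)
    then show ?case by simp
  qed
  define g where "g x = lim (\<lambda>k. f (s k) x)" for x
  have [measurable]: "g \<in> borel_measurable M"
    unfolding g_def by measurable
  have lim: "AE x in M. (\<lambda>k. f (s k) x) \<longlonglongrightarrow> g x"
    using conv by eventually_elim (simp add: g_def convergent_LIMSEQ_iff)
  \<comment> \<open>Fatou is applied in k with n fixed, so the estimate concerns the whole sequence,
    not just the subsequence.\<close>
  have bd: "(\<lambda>x. f n x - g x) \<in> sq_int M \<and> sq_norm M (\<lambda>x. f n x - g x) \<le> e"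
    if "0 < e" "\<And>m. N \<le> m \<Longrightarrow> sq_norm M (\<lambda>x. f n x - f m x) \<le> e" for n N e
  proof -
    have 1: "AE x in M. (\<lambda>k. f n x - f (s k) x) \<longlonglongrightarrow> f n x - g x"
      using lim by eventually_elim (intro tendsto_intros)
    have 2: "\<forall>\<^sub>F k in sequentially. sq_norm M (\<lambda>x. f n x - f (s k) x) \<le> e"
      using eventually_ge_at_top[of N]
      by eventually_elim (use that(2) seq_suble[OF s(1)] le_trans in blast)
    show ?thesis
      using sq_int_fatou[of "\<lambda>k x. f n x - f (s k) x" M "\<lambda>x. f n x - g x" e, OF _ _ 1 2] f that(1)
      by auto
  qed
  have "g \<in> sq_int M"
  proof -
    obtain N where N: "\<forall>m\<ge>N. \<forall>n\<ge>N. sq_norm M (\<lambda>x. f m x - f n x) < 1"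
      using Cauchy[of 1] by auto
    then have "(\<lambda>x. f N x - g x) \<in> sq_int M"
      using bd[of 1 N N] by (simp add: less_imp_le)
    from sq_int_diff[OF f[of N] this] show ?thesis by simp
  qed
  moreover have "(\<lambda>n. sq_norm M (\<lambda>x. f n x - g x)) \<longlonglongrightarrow> 0"
  proof (rule LIMSEQ_I)
    fix e :: real assume "0 < e"
    then obtain N where N: "\<forall>m\<ge>N. \<forall>n\<ge>N. sq_norm M (\<lambda>x. f m x - f n x) < e/2"
      using Cauchy[of "e/2"] by auto
    have "norm (sq_norm M (\<lambda>x. f n x - g x) - 0) < e" if "N \<le> n" for n
      using bd[of "e/2" N n] N that \<open>0 < e\<close> by (fastforce simp: less_imp_le)
    then show "\<exists>no. \<forall>n\<ge>no. norm (sq_norm M (\<lambda>x. f n x - g x) - 0) < e" by blast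
  qed
  ultimately show ?thesis using that by blast
qed

text \<open>The parallelogram law for \<open>b - u\<close> and \<open>b - v\<close>. The last term
  is a distance from b to a midpoint; its lower bound over a subspace makes minimizing sequences
  Cauchy.\<close>

lemma sq_norm_parallelogram:
  assumes "b \<in> sq_int M" "u \<in> sq_int M" "v \<in> sq_int M"
  shows "(sq_norm M (\<lambda>x. u x - v x))\<^sup>2 =
    2 * (sq_norm M (\<lambda>x. b x - u x))\<^sup>2 + 2 * (sq_norm M (\<lambda>x. b x - v x))\<^sup>2
      - 4 * (sq_norm M (\<lambda>x. b x - (1/2) * (u x + v x)))\<^sup>2"
proof -
  define p where "p x = b x - u x" for x
  define q where "q x = b x - v x" for x
  have pq: "p \<in> sq_int M" "q \<in> sq_int M"
    unfolding p_def q_def using assms by auto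
  have peq: "(\<lambda>x. b x - u x) = p" "(\<lambda>x. b x - v x) = q"
    by (auto simp: p_def q_def)
  have "(\<lambda>x. b x - (1/2) * (u x + v x)) = (\<lambda>x. (1/2) * (p x + q x))"
    by (auto simp: p_def q_def field_simps)
  then have "4 * (sq_norm M (\<lambda>x. b x - (1/2) * (u x + v x)))\<^sup>2 = (sq_norm M (\<lambda>x. p x + q x))\<^sup>2"
    by (simp only: sq_norm_scale) (simp add: power2_eq_square)
  moreover have "(\<lambda>x. u x - v x) = (\<lambda>x. q x - p x)" by (auto simp: p_def q_def)
  moreover have "(sq_norm M (\<lambda>x. q x - p x))\<^sup>2 = (sq_norm M (\<lambda>x. p x - q x))\<^sup>2"
    by (simp only: sq_norm_minus_commute[of M q p])
  ultimately show ?thesis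
    using sq_norm_add_power2[OF pq] sq_norm_diff_power2[OF pq] unfolding peq by simp
qed

text \<open>A variation with c = t i, where i is the inner product: unless i = 0, the linear term
  lowers the squared norm by more than the quadratic term raises it.\<close>

lemma sq_inner_eq_0_if_minimal:
  assumes f: "f \<in> sq_int M" and v: "v \<in> sq_int M"
    and min: "\<And>c. sq_norm M f \<le> sq_norm M (\<lambda>x. f x - c * v x)"
  shows "sq_inner M f v = 0"
proof -
  define i where "i = sq_inner M f v"
  \<comment> \<open>Any t > 0 with t B < 2 serves; the summand 1 covers v of norm zero.\<close>
  define t where "t = 1 / (1 + (sq_norm M v)\<^sup>2)"
  define B where "B = (sq_norm M v)\<^sup>2"
  have B: "0 \<le> B" "t = 1 / (1 + B)" by (auto simp: B_def t_def)
  then have t: "0 < t" by simp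
  have "(sq_norm M f)\<^sup>2 \<le> (sq_norm M (\<lambda>x. f x - (of_real t * i) * v x))\<^sup>2"
    using min by (intro power_mono) auto
  also have "\<dots> = (sq_norm M f)\<^sup>2 - 2 * Re (sq_inner M f (\<lambda>x. (of_real t * i) * v x))
      + (sq_norm M (\<lambda>x. (of_real t * i) * v x))\<^sup>2"
    using f v by (intro sq_norm_diff_power2) auto
  also have "sq_inner M f (\<lambda>x. (of_real t * i) * v x) = of_real (t * (cmod i)\<^sup>2)"
    unfolding sq_inner_scale_right i_def[symmetric]
    by (simp add: complex_norm_square mult_ac del: of_real_power)
  also have "sq_norm M (\<lambda>x. (of_real t * i) * v x) = (t * cmod i) * sq_norm M v"
    unfolding sq_norm_scale using t by (simp add: norm_mult)
  finally have "0 \<le> t * (cmod i)\<^sup>2 * (t * B - 2)"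
    by (simp add: B_def power_mult_distrib power2_eq_square algebra_simps)
  moreover have "t + t * B = 1" using B by (simp add: field_simps)
  then have "t * B - 2 < 0" using t by linarith
  ultimately have "\<not> 0 < t * (cmod i)\<^sup>2"
    by (meson mult_pos_neg not_le)
  then show ?thesis using t by (simp add: i_def zero_less_mult_iff)
qed

text \<open>V is not assumed closed: p lies only in its closure. The approximating sequence is
  returned too, because T will be known explicitly on members of V.\<close>

lemma sq_int_projection:
  assumes fin: "finite_measure M" and V: "V \<subseteq> sq_int M" "V \<noteq> {}"
    and add: "\<And>u v. u \<in> V \<Longrightarrow> v \<in> V \<Longrightarrow> (\<lambda>x. u x + v x) \<in> V"
    and scale: "\<And>c v. v \<in> V \<Longrightarrow> (\<lambda>x. c * v x) \<in> V"
    and b: "b \<in> sq_int M"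
  obtains p v where "p \<in> sq_int M" "\<forall>n::nat. v n \<in> V" "(\<lambda>n. sq_norm M (\<lambda>x. v n x - p x)) \<longlonglongrightarrow> 0"
    "\<forall>w\<in>V. sq_inner M (\<lambda>x. b x - p x) w = 0"
proof -
  define D where "D = (\<lambda>v. (sq_norm M (\<lambda>x. b x - v x))\<^sup>2) ` V"
  define d where "d = Inf D"
  have bdd: "bdd_below D" unfolding D_def by (rule bdd_belowI[of _ 0]) auto
  have ge: "d \<le> (sq_norm M (\<lambda>x. b x - v x))\<^sup>2" if "v \<in> V" for v
    unfolding d_def using bdd that by (intro cInf_lower) (auto simp: D_def)
  have "\<exists>v\<in>V. (sq_norm M (\<lambda>x. b x - v x))\<^sup>2 < d + 1 / real (Suc n)" for n
  proof -
    have "\<exists>y\<in>D. y < d + 1 / real (Suc n)"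
      unfolding d_def using V(2) by (intro cInf_lessD) (auto simp: D_def)
    then show ?thesis by (auto simp: D_def)
  qed
  then obtain v where v: "\<And>n. v n \<in> V" "\<And>n. (sq_norm M (\<lambda>x. b x - v n x))\<^sup>2 < d + 1 / real (Suc n)"
    by metis
  have vs: "v n \<in> sq_int M" for n using v(1) V(1) by blast
  \<comment> \<open>The midpoint of \<open>v m\<close> and \<open>v n\<close> lies in V, so its
    squared distance to b is at least d.\<close>
  have diff: "(sq_norm M (\<lambda>x. v m x - v n x))\<^sup>2 \<le> 2 / real (Suc m) + 2 / real (Suc n)" for m n
    using sq_norm_parallelogram[OF b vs[of m] vs[of n]] ge[OF scale[OF add[OF v(1)[of m] v(1)[of n]], of "1/2"]]
      v(2)[of m] v(2)[of n] by simp
  have Cauchy: "\<exists>N. \<forall>m\<ge>N. \<forall>n\<ge>N. sq_norm M (\<lambda>x. v m x - v n x) < e" if "0 < e" for e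
  proof -
    obtain N where N: "1 / real (Suc N) < e\<^sup>2 / 4"
      using nat_approx_posE[of "e\<^sup>2 / 4"] \<open>0 < e\<close> by auto
    have "sq_norm M (\<lambda>x. v m x - v n x) < e" if "N \<le> m" "N \<le> n" for m n
    proof -
      have "1 / real (Suc m) \<le> 1 / real (Suc N)" "1 / real (Suc n) \<le> 1 / real (Suc N)"
        using that by (auto intro!: divide_left_mono)
      then have "(sq_norm M (\<lambda>x. v m x - v n x))\<^sup>2 < e\<^sup>2" using diff[of m n] N by simp
      then show ?thesis using \<open>0 < e\<close> by (simp add: power_less_imp_less_base)
    qed
    then show ?thesis by blast
  qed
  obtain p where p: "p \<in> sq_int M" "(\<lambda>n. sq_norm M (\<lambda>x. v n x - p x)) \<longlonglongrightarrow> 0"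
    by (rule sq_norm_complete[OF fin vs Cauchy])
  have lim: "(\<lambda>n. sq_norm M (\<lambda>x. b x - v n x - c * w x)) \<longlonglongrightarrow> sq_norm M (\<lambda>x. b x - p x - c * w x)"
    if "w \<in> sq_int M" for c w
  proof (rule tendsto_sq_norm)
    have "(\<lambda>x. (b x - v n x - c * w x) - (b x - p x - c * w x)) = (\<lambda>x. p x - v n x)" for n
      by auto
    then show "(\<lambda>n. sq_norm M (\<lambda>x. (b x - v n x - c * w x) - (b x - p x - c * w x))) \<longlonglongrightarrow> 0"
      using p(2) by (simp add: sq_norm_minus_commute[of M p])
  qed (intro sq_int_diff sq_int_scale b vs p(1) that)+
  have d0: "0 \<le> d" unfolding d_def using V(2) by (intro cInf_greatest) (auto simp: D_def)
  have min: "sqrt d \<le> sq_norm M (\<lambda>x. b x - p x - c * w x)" if "w \<in> V" for c w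
  proof (rule LIMSEQ_le_const[OF lim])
    show "w \<in> sq_int M" using that V(1) by blast
    have "sqrt d \<le> sq_norm M (\<lambda>x. b x - v n x - c * w x)" for n
    proof -
      have "(\<lambda>x. b x - v n x - c * w x) = (\<lambda>x. b x - (v n x + c * w x))" by auto
      then show ?thesis
        using real_sqrt_le_mono[OF ge[OF add[OF v(1)[of n] scale[OF that, of c]]]] by simp
    qed
    then show "\<exists>N. \<forall>n\<ge>N. sqrt d \<le> sq_norm M (\<lambda>x. b x - v n x - c * w x)" by blast
  qed
  have "(\<lambda>n. (sq_norm M (\<lambda>x. b x - v n x))\<^sup>2) \<longlonglongrightarrow> (sq_norm M (\<lambda>x. b x - p x))\<^sup>2"
    using lim[OF sq_int_zero, of 0] by (intro tendsto_power) simp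
  moreover have "(\<lambda>n. d + 1 / real (Suc n)) \<longlonglongrightarrow> d + 0"
    by (intro tendsto_add tendsto_const LIMSEQ_Suc[OF lim_const_over_n])
  ultimately have "(sq_norm M (\<lambda>x. b x - p x))\<^sup>2 \<le> d + 0"
    using v(2) by (intro LIMSEQ_le) (auto intro: less_imp_le)
  then have "sq_norm M (\<lambda>x. b x - p x) \<le> sqrt d"
    by (intro real_le_rsqrt) simp
  then have "sq_inner M (\<lambda>x. b x - p x) w = 0" if "w \<in> V" for w
    using that b p(1) V(1) min[OF that] by (intro sq_inner_eq_0_if_minimal) (auto intro: order_trans)
  then show ?thesis using that p v(1) by blast
qed

section \<open>Wirtinger derivatives and test functions\<close>

text \<open>Every real-linear map of the plane has the form a h + b cnj h, so one derivative carries
  both Wirtinger derivatives and inherits the usual rules for sums, products and conjugates.\<close>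

definition has_wirtinger :: "(complex \<Rightarrow> complex) \<Rightarrow> complex \<Rightarrow> complex \<Rightarrow> complex \<Rightarrow> bool" where
  "has_wirtinger f a b z \<longleftrightarrow> (f has_derivative (\<lambda>h. a * h + b * cnj h)) (at z)"

lemma
  assumes "has_wirtinger f a b z"
  shows has_wirtinger_d_z: "d_z f z = a" and has_wirtinger_d_zbar: "d_zbar f z = b"
proof -
  have "frechet_derivative f (at z) = (\<lambda>h. a * h + b * cnj h)"
    using assms frechet_derivative_at[symmetric] unfolding has_wirtinger_def by blast
  then show "d_z f z = a" "d_zbar f z = b"
    by (simp_all add: d_z_def d_zbar_def algebra_simps)
qed

lemma has_wirtinger_differentiable: "has_wirtinger f a b z \<Longrightarrow> f differentiable at z"
  by (auto simp: has_wirtinger_def differentiable_def)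

lemma differentiable_has_wirtinger:
  assumes "f differentiable at z"
  shows "has_wirtinger f (d_z f z) (d_zbar f z) z"
proof -
  let ?F = "frechet_derivative f (at z)"
  have der: "(f has_derivative ?F) (at z)"
    using assms by (simp add: frechet_derivative_works)
  then interpret bounded_linear ?F by (rule has_derivative_bounded_linear)
  have "?F h = d_z f z * h + d_zbar f z * cnj h" for h
  proof -
    have "?F h = ?F (Re h *\<^sub>R 1 + Im h *\<^sub>R \<i>)"
      by (rule arg_cong[where f = ?F]) (simp add: complex_eq_iff)
    also have "\<dots> = of_real (Re h) * ?F 1 + of_real (Im h) * ?F \<i>"
      unfolding add scaleR by (simp add: scaleR_conv_of_real)
    also have "of_real (Re h) = (h + cnj h) / 2"
      by (simp add: complex_eq_iff)
    also have "of_real (Im h) = \<i> * (cnj h - h) / 2"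
      by (simp add: complex_eq_iff)
    finally show ?thesis by (simp add: d_z_def d_zbar_def field_simps)
  qed
  then have "?F = (\<lambda>h. d_z f z * h + d_zbar f z * cnj h)" by blast
  then show ?thesis using der by (simp add: has_wirtinger_def)
qed

lemma has_wirtinger_const: "has_wirtinger (\<lambda>z. c) 0 0 z"
  by (simp add: has_wirtinger_def)

lemma has_wirtinger_add:
  "has_wirtinger f a b z \<Longrightarrow> has_wirtinger g a' b' z \<Longrightarrow>
    has_wirtinger (\<lambda>z. f z + g z) (a + a') (b + b') z"
  unfolding has_wirtinger_def
  by (drule (1) has_derivative_add) (simp add: algebra_simps)

lemma has_wirtinger_mult:
  "has_wirtinger f a b z \<Longrightarrow> has_wirtinger g a' b' z \<Longrightarrow>
    has_wirtinger (\<lambda>z. f z * g z) (a * g z + f z * a') (b * g z + f z * b') z"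
  unfolding has_wirtinger_def
  by (rule has_derivative_eq_rhs[OF has_derivative_mult]) (auto simp: algebra_simps)

lemma has_wirtinger_cnj:
  "has_wirtinger f a b z \<Longrightarrow> has_wirtinger (\<lambda>z. cnj (f z)) (cnj b) (cnj a) z"
  unfolding has_wirtinger_def
  by (rule has_derivative_eq_rhs[OF bounded_linear.has_derivative[OF bounded_linear_cnj]])
    (auto simp: algebra_simps)

lemma has_wirtinger_field_derivative:
  "(f has_field_derivative a) (at z) \<Longrightarrow> has_wirtinger f a 0 z"
  by (simp add: has_wirtinger_def has_field_derivative_def)

lemma has_wirtinger_transform:
  "has_wirtinger f a b z \<Longrightarrow> open S \<Longrightarrow> z \<in> S \<Longrightarrow> (\<And>w. w \<in> S \<Longrightarrow> f w = g w) \<Longrightarrow>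
    has_wirtinger g a b z"
  unfolding has_wirtinger_def by (rule has_derivative_transform_within_open)

definition C1_on :: "complex set \<Rightarrow> (complex \<Rightarrow> complex) \<Rightarrow> bool" where
  "C1_on S f \<longleftrightarrow> (\<forall>z\<in>S. f differentiable at z) \<and> continuous_on S (d_z f) \<and> continuous_on S (d_zbar f)"

lemma C1_onI:
  assumes "\<And>z. z \<in> S \<Longrightarrow> has_wirtinger f (a z) (b z) z" "continuous_on S a" "continuous_on S b"
  shows "C1_on S f"
proof -
  have "continuous_on S (d_z f) = continuous_on S a" "continuous_on S (d_zbar f) = continuous_on S b"
    using has_wirtinger_d_z[OF assms(1)] has_wirtinger_d_zbar[OF assms(1)]
    by (auto intro!: continuous_on_cong)
  then show ?thesis
    using assms(2,3) has_wirtinger_differentiable[OF assms(1)] by (auto simp: C1_on_def)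
qed

lemma C1_on_wirtinger: "C1_on S f \<Longrightarrow> z \<in> S \<Longrightarrow> has_wirtinger f (d_z f z) (d_zbar f z) z"
  by (simp add: C1_on_def differentiable_has_wirtinger)

lemma C1_on_continuous: "C1_on S f \<Longrightarrow> continuous_on S f"
  by (auto simp: C1_on_def intro!: continuous_at_imp_continuous_on differentiable_imp_continuous_within)

lemma C1_on_mult:
  assumes "C1_on S f" "C1_on S g"
  shows "C1_on S (\<lambda>z. f z * g z)"
proof (rule C1_onI)
  show "has_wirtinger (\<lambda>z. f z * g z) (d_z f z * g z + f z * d_z g z) (d_zbar f z * g z + f z * d_zbar g z) z"
    if "z \<in> S" for z
    using assms that by (intro has_wirtinger_mult C1_on_wirtinger)
qed (use assms in \<open>auto simp: C1_on_def intro!: continuous_intros C1_on_continuous[OF assms(1)] C1_on_continuous[OF assms(2)]\<close>)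

lemma C1_on_mono: "C1_on S f \<Longrightarrow> T \<subseteq> S \<Longrightarrow> C1_on T f"
  by (auto simp: C1_on_def intro: continuous_on_subset)

lemma d_zbar_mult:
  "f differentiable at z \<Longrightarrow> g differentiable at z \<Longrightarrow>
    d_zbar (\<lambda>z. f z * g z) z = d_zbar f z * g z + f z * d_zbar g z"
  using has_wirtinger_d_zbar[OF has_wirtinger_mult[OF differentiable_has_wirtinger differentiable_has_wirtinger]] .

lemma d_z_mult:
  "f differentiable at z \<Longrightarrow> g differentiable at z \<Longrightarrow>
    d_z (\<lambda>z. f z * g z) z = d_z f z * g z + f z * d_z g z"
  using has_wirtinger_d_z[OF has_wirtinger_mult[OF differentiable_has_wirtinger differentiable_has_wirtinger]] .

lemma d_zbar_cnj: "f differentiable at z \<Longrightarrow> d_zbar (\<lambda>z. cnj (f z)) z = cnj (d_z f z)"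
  and d_z_cnj: "f differentiable at z \<Longrightarrow> d_z (\<lambda>z. cnj (f z)) z = cnj (d_zbar f z)"
  using has_wirtinger_cnj[OF differentiable_has_wirtinger, of f z]
  by (auto dest: has_wirtinger_d_z has_wirtinger_d_zbar)

section \<open>Test functions and their integrals\<close>

lemma test_functions_iff:
  "\<phi> \<in> test_functions \<longleftrightarrow> C1_on UNIV \<phi> \<and> (\<exists>K. compact K \<and> K \<subseteq> unit_disc \<and> (\<forall>z. z \<notin> K \<longrightarrow> \<phi> z = 0))"
  by (auto simp: test_functions_def C1_on_def)

lemma d_test_outside:
  assumes "compact K" "\<And>z. z \<notin> K \<Longrightarrow> \<phi> z = 0" "z \<notin> K"
  shows "has_wirtinger \<phi> 0 0 z"
  using assms
  by (intro has_wirtinger_transform[OF has_wirtinger_const, of "- K" z 0])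
    (auto simp: compact_imp_closed open_Compl)

text \<open>Only the values of the factor \<open>g\<close> on the disc matter, although the product is a function on
  the whole plane.\<close>
lemma test_functions_mult:
  assumes g: "C1_on unit_disc g" and \<phi>: "\<phi> \<in> test_functions"
  shows "(\<lambda>z. g z * \<phi> z) \<in> test_functions"
proof -
  obtain K where K: "compact K" "K \<subseteq> unit_disc" "\<And>z. z \<notin> K \<Longrightarrow> \<phi> z = 0" and C: "C1_on UNIV \<phi>"
    using \<phi> by (auto simp: test_functions_iff)
  have 1: "C1_on unit_disc (\<lambda>z. g z * \<phi> z)"
    using g C1_on_mono[OF C] by (intro C1_on_mult) auto
  have "has_wirtinger (\<lambda>z. g z * \<phi> z) 0 0 z" if "z \<notin> K" for z
    using that K by (intro d_test_outside[of K]) auto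
  then have 2: "C1_on (- K) (\<lambda>z. g z * \<phi> z)"
    by (intro C1_onI[where a = "\<lambda>_. 0" and b = "\<lambda>_. 0"]) auto
  \<comment> \<open>The disc and the complement of K are open and cover the plane; on the latter the
    product is zero, whatever \<open>g\<close> does there.\<close>
  have U: "UNIV = unit_disc \<union> - K" using K(2) by auto
  have op: "open unit_disc" "open (- K)"
    using K(1) by (auto simp: unit_disc_def compact_imp_closed open_Compl)
  have "C1_on UNIV (\<lambda>z. g z * \<phi> z)"
    unfolding C1_on_def
  proof (intro conjI ballI)
    show "(\<lambda>z. g z * \<phi> z) differentiable at z" for z
      using 1 2 U by (auto simp: C1_on_def)
    show "continuous_on UNIV (d_z (\<lambda>z. g z * \<phi> z))" "continuous_on UNIV (d_zbar (\<lambda>z. g z * \<phi> z))"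
      unfolding U using 1 2 op by (auto simp: C1_on_def intro!: continuous_on_open_Un)
  qed
  then show ?thesis using K by (force simp: test_functions_iff)
qed

lemma continuous_compact_support_bounded:
  fixes f :: "'a::topological_space \<Rightarrow> 'b::real_normed_vector"
  assumes "continuous_on UNIV f" "compact K" "\<And>z. z \<notin> K \<Longrightarrow> f z = 0"
  obtains B where "0 < B" "\<And>z. norm (f z) \<le> B"
proof -
  have "compact (f ` K)"
    using assms by (intro compact_continuous_image) (auto intro: continuous_on_subset)
  then obtain B where B: "0 < B" "\<forall>y\<in>f ` K. norm y \<le> B"
    using compact_imp_bounded bounded_pos by blast
  then have "norm (f z) \<le> B" for z
    using assms(3)[of z] by (cases "z \<in> K") auto
  then show ?thesis using that B(1) by blast
qed

lemma integrable_continuous_compact_support: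
  fixes f :: "'a::euclidean_space \<Rightarrow> complex"
  assumes "continuous_on UNIV f" "compact K" "\<And>z. z \<notin> K \<Longrightarrow> f z = 0"
  shows "integrable lborel f"
proof -
  have "integrable lborel (\<lambda>x. indicator K x *\<^sub>R f x)"
    using assms by (intro borel_integrable_compact) (auto intro: continuous_on_subset)
  moreover have "(\<lambda>x. indicator K x *\<^sub>R f x) = f"
    using assms(3) by (auto simp: indicator_def fun_eq_iff)
  ultimately show ?thesis by simp
qed

text \<open>Passes to a translation-invariant measure on the whole plane, where difference quotients
  can be integrated.\<close>

lemma disc_integral_lborel:
  assumes "continuous_on UNIV f" "K \<subseteq> unit_disc" "\<And>z. z \<notin> K \<Longrightarrow> f z = (0::complex)"
  shows "(LINT z|disc_measure. f z) = (LINT z|lborel. f z)"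
proof -
  have D: "unit_disc \<inter> space lebesgue \<in> sets lebesgue"
    by (simp add: unit_disc_def)
  have "(LINT z|disc_measure. f z) = (LINT z|lebesgue. indicator unit_disc z *\<^sub>R f z)"
    using integral_restrict_space[OF D] .
  also have "(\<lambda>z. indicator unit_disc z *\<^sub>R f z) = f"
    using assms(2,3) by (auto simp: indicator_def fun_eq_iff)
  also have "(LINT z|lebesgue. f z) = (LINT z|lborel. f z)"
    using assms(1) by (intro integral_completion) (simp add: borel_measurable_continuous_onI)
  finally show ?thesis .
qed

lemma lborel_integral_translate:
  fixes f :: "'a::euclidean_space \<Rightarrow> complex"
  assumes "f \<in> borel_measurable borel"
  shows "(LINT z|lborel. f (c + z)) = (LINT z|lborel. f z)"
proof -
  have m: "(+) c \<in> measurable lborel borel"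
    unfolding measurable_lborel2
    by (rule borel_measurable_continuous_onI[OF continuous_on_add[OF continuous_on_const continuous_on_id, of _ c]])
  show ?thesis
    using integral_distr[OF m assms] unfolding lborel_distr_plus by (rule sym)
qed

text \<open>Translation invariance makes the integrals of the difference quotients vanish.\<close>
lemma integral_directional_derivative:
  fixes v :: complex
  assumes C: "C1_on UNIV \<phi>" and K: "compact K" "\<And>z. z \<notin> K \<Longrightarrow> \<phi> z = 0" and v: "norm v = 1"
  shows "(LINT z|lborel. d_z \<phi> z * v + d_zbar \<phi> z * cnj v) = 0"
proof -
  have cont: "continuous_on UNIV \<phi>" "continuous_on UNIV (d_z \<phi>)" "continuous_on UNIV (d_zbar \<phi>)"
    using C C1_on_continuous[OF C] by (simp_all add: C1_on_def)
  have [measurable]: "\<phi> \<in> borel_measurable borel" "d_z \<phi> \<in> borel_measurable borel" "d_zbar \<phi> \<in> borel_measurable borel"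
    using cont by (auto intro: borel_measurable_continuous_onI)
  have out: "d_z \<phi> z = 0" "d_zbar \<phi> z = 0" if "z \<notin> K" for z
    using d_test_outside[of K \<phi> z] K that has_wirtinger_d_z has_wirtinger_d_zbar by blast+
  obtain B1 where B1: "0 < B1" "\<And>z. norm (d_z \<phi> z) \<le> B1"
    using continuous_compact_support_bounded[OF cont(2) K(1) out(1)] by blast
  obtain B2 where B2: "0 < B2" "\<And>z. norm (d_zbar \<phi> z) \<le> B2"
    using continuous_compact_support_bounded[OF cont(3) K(1) out(2)] by blast
  \<comment> \<open>This Lipschitz constant bounds all difference quotients, as dominated
    convergence requires.\<close>
  have lip: "norm (\<phi> x - \<phi> y) \<le> (B1 + B2) * norm (x - y)" for x y
  proof (rule differentiable_bound[of UNIV \<phi>])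
    show "(\<phi> has_derivative (\<lambda>h. d_z \<phi> z * h + d_zbar \<phi> z * cnj h)) (at z within UNIV)" for z
      using C1_on_wirtinger[OF C, of z] by (simp add: has_wirtinger_def)
    show "onorm (\<lambda>h. d_z \<phi> z * h + d_zbar \<phi> z * cnj h) \<le> B1 + B2" for z
    proof (rule onorm_le)
      fix h
      have "norm (d_z \<phi> z * h + d_zbar \<phi> z * cnj h) \<le> norm (d_z \<phi> z) * norm h + norm (d_zbar \<phi> z) * norm h"
        by (rule norm_triangle_le) (simp add: norm_mult)
      also have "\<dots> \<le> (B1 + B2) * norm h"
        unfolding distrib_right using B1 B2 by (intro add_mono mult_right_mono) auto
      finally show "norm (d_z \<phi> z * h + d_zbar \<phi> z * cnj h) \<le> (B1 + B2) * norm h" .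
    qed
  qed auto
  define t where "t n = 1 / real (Suc n)" for n
  have t: "0 < t n" "t n \<le> 1" for n by (auto simp: t_def)
  have t0: "t \<longlonglongrightarrow> 0"
    unfolding t_def using LIMSEQ_Suc[OF lim_const_over_n[of 1]] by simp
  define s where "s n z = (\<phi> (t n *\<^sub>R v + z) - \<phi> z) / of_real (t n)" for n z
  have int\<phi>: "integrable lborel \<phi>"
    using integrable_continuous_compact_support[OF cont(1) K] .
  have int\<phi>': "integrable lborel (\<lambda>z. \<phi> (t n *\<^sub>R v + z))" for n
  proof (rule integrable_continuous_compact_support)
    show "continuous_on UNIV (\<lambda>z. \<phi> (t n *\<^sub>R v + z))"
      by (intro continuous_on_compose2[OF cont(1)] continuous_intros) auto
    show "compact ((+) (- (t n *\<^sub>R v)) ` K)"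
      using K(1) by (rule compact_translation)
    show "\<phi> (t n *\<^sub>R v + z) = 0" if "z \<notin> (+) (- (t n *\<^sub>R v)) ` K" for z
      using that by (intro K(2)) (force simp: image_iff)
  qed
  have zero: "(LINT z|lborel. s n z) = 0" for n
    unfolding s_def using int\<phi> int\<phi>'[of n] lborel_integral_translate[of \<phi> "t n *\<^sub>R v"] by simp
  obtain R where R: "\<And>z. z \<in> K \<Longrightarrow> norm z \<le> R"
    using compact_imp_bounded[OF K(1)] by (auto simp: bounded_iff)
  have "(\<lambda>n. LINT z|lborel. s n z) \<longlonglongrightarrow> (LINT z|lborel. d_z \<phi> z * v + d_zbar \<phi> z * cnj v)"
  proof (rule integral_dominated_convergence)
    \<comment> \<open>The increments have length at most 1, so all difference quotients vanish
      outside the ball of radius \<open>R + 1\<close>.\<close>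
    show "integrable lborel (\<lambda>z::complex. (B1 + B2) * indicator (cball 0 (R + 1)) z)"
      using emeasure_lborel_cball_finite[of "0::complex" "R + 1"] by auto
    show "AE z in lborel. norm (s n z) \<le> (B1 + B2) * indicator (cball 0 (R + 1)) z" for n
    proof (rule AE_I2)
      fix z
      show "norm (s n z) \<le> (B1 + B2) * indicator (cball 0 (R + 1)) z"
      proof (cases "z \<in> cball 0 (R + 1)")
        case True
        have "norm (\<phi> (t n *\<^sub>R v + z) - \<phi> z) \<le> (B1 + B2) * t n"
          using lip[of "t n *\<^sub>R v + z" z] v t[of n] by simp
        then show ?thesis using True t[of n] by (simp add: s_def norm_divide field_simps)
      next
        case False
        then have "z \<notin> K" using R[of z] by auto
        moreover have "t n *\<^sub>R v + z \<notin> K"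
        proof
          assume "t n *\<^sub>R v + z \<in> K"
          then have "norm (t n *\<^sub>R v + z) \<le> R" by (rule R)
          moreover have "norm z \<le> norm (t n *\<^sub>R v + z) + norm (t n *\<^sub>R v)"
            by (metis add_diff_cancel_left' norm_triangle_ineq4)
          ultimately show False using False v t[of n] by simp
        qed
        ultimately show ?thesis using K(2) False by (simp add: s_def)
      qed
    qed
    show "AE z in lborel. (\<lambda>n. s n z) \<longlonglongrightarrow> d_z \<phi> z * v + d_zbar \<phi> z * cnj v"
    proof (rule AE_I2)
      fix z
      obtain e where e: "\<And>h. \<phi> (z + h) = \<phi> z + (d_z \<phi> z * h + d_zbar \<phi> z * cnj h) + e h"
        "((\<lambda>h. norm (e h) / norm h) \<longlongrightarrow> 0) (at 0)"
        using C1_on_wirtinger[OF C, of z] unfolding has_wirtinger_def has_derivative_iff_Ex by auto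
      have "filterlim (\<lambda>n. t n *\<^sub>R v) (at 0) sequentially"
        unfolding filterlim_at using v t tendsto_scaleR[OF t0 tendsto_const[of v]]
        by (auto simp: less_imp_neq[symmetric])
      then have "(\<lambda>n. norm (e (t n *\<^sub>R v)) / norm (t n *\<^sub>R v)) \<longlonglongrightarrow> 0"
        by (rule filterlim_compose[OF e(2)])
      moreover have "norm (e (t n *\<^sub>R v)) / norm (t n *\<^sub>R v) = norm (s n z - (d_z \<phi> z * v + d_zbar \<phi> z * cnj v))" for n
      proof -
        have "s n z - (d_z \<phi> z * v + d_zbar \<phi> z * cnj v) = e (t n *\<^sub>R v) / of_real (t n)"
          using t[of n] e(1)[of "t n *\<^sub>R v"] unfolding s_def
          by (simp add: add.commute[of "t n *\<^sub>R v"] scaleR_conv_of_real field_simps)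
        then show ?thesis using v t[of n] by (simp add: norm_divide)
      qed
      ultimately have "(\<lambda>n. s n z - (d_z \<phi> z * v + d_zbar \<phi> z * cnj v)) \<longlonglongrightarrow> 0"
        by (simp add: tendsto_norm_zero_iff)
      then show "(\<lambda>n. s n z) \<longlonglongrightarrow> d_z \<phi> z * v + d_zbar \<phi> z * cnj v"
        by (rule LIM_zero_cancel)
    qed
  qed (auto simp: s_def)
  then show ?thesis unfolding zero by (simp add: LIMSEQ_const_iff)
qed

lemma test_integral_zero:
  assumes "\<phi> \<in> test_functions"
  shows "(LINT z|disc_measure. d_z \<phi> z) = 0" "(LINT z|disc_measure. d_zbar \<phi> z) = 0"
proof -
  obtain K where K: "compact K" "K \<subseteq> unit_disc" "\<And>z. z \<notin> K \<Longrightarrow> \<phi> z = 0" and C: "C1_on UNIV \<phi>"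
    using assms by (auto simp: test_functions_iff)
  have out: "d_z \<phi> z = 0" "d_zbar \<phi> z = 0" if "z \<notin> K" for z
    using d_test_outside[of K \<phi> z] K that has_wirtinger_d_z has_wirtinger_d_zbar by blast+
  have cont: "continuous_on UNIV (d_z \<phi>)" "continuous_on UNIV (d_zbar \<phi>)"
    using C by (auto simp: C1_on_def)
  note int = integrable_continuous_compact_support[OF cont(1) K(1) out(1)]
    integrable_continuous_compact_support[OF cont(2) K(1) out(2)]
  have "(LINT z|lborel. d_z \<phi> z) + (LINT z|lborel. d_zbar \<phi> z) = 0"
    using integral_directional_derivative[OF C K(1,3), of 1] int by simp
  \<comment> \<open>The directions 1 and \<open>\<i>\<close> give the sum and, up to a factor
    \<open>\<i>\<close>, the difference of the two integrals.\<close>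
  moreover have "(LINT z|lborel. d_z \<phi> z) - (LINT z|lborel. d_zbar \<phi> z) = 0"
    using integral_directional_derivative[OF C K(1,3), of \<i>] int
    by (simp add: left_diff_distrib[symmetric] del: mult_minus_right)
  ultimately have "(LINT z|lborel. d_z \<phi> z) = 0" "(LINT z|lborel. d_zbar \<phi> z) = 0"
    by simp_all
  then show "(LINT z|disc_measure. d_z \<phi> z) = 0" "(LINT z|disc_measure. d_zbar \<phi> z) = 0"
    using disc_integral_lborel[OF cont(1) K(2) out(1)] disc_integral_lborel[OF cont(2) K(2) out(2)]
    by simp_all
qed

section \<open>Polynomials in \<open>z\<close> and its conjugate\<close>

text \<open>Adding one monomial at a time gives an induction in which derivatives, antiderivatives
  and the later decomposition are settled on monomials.\<close>

inductive zpoly :: "(complex \<Rightarrow> complex) \<Rightarrow> bool" where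
  zpoly_zero: "zpoly (\<lambda>z. 0)"
| zpoly_step: "zpoly p \<Longrightarrow> zpoly (\<lambda>z. c * (z ^ m * cnj z ^ n) + p z)"

lemma zpoly_monom: "zpoly (\<lambda>z. c * (z ^ m * cnj z ^ n))"
  using zpoly_step[OF zpoly_zero, of c m n] by simp

lemma zpoly_const: "zpoly (\<lambda>z. c)"
  using zpoly_monom[of c 0 0] by simp

lemma zpoly_add: "zpoly p \<Longrightarrow> zpoly q \<Longrightarrow> zpoly (\<lambda>z. p z + q z)"
proof (induction rule: zpoly.induct)
  case (zpoly_step p c m n)
  then show ?case using zpoly.zpoly_step[of "\<lambda>z. p z + q z" c m n] by (simp add: add.assoc)
qed simp

lemma zpoly_monom_mult: "zpoly p \<Longrightarrow> zpoly (\<lambda>z. c * (z ^ m * cnj z ^ n) * p z)"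
proof (induction rule: zpoly.induct)
  case zpoly_zero
  then show ?case using zpoly.zpoly_zero by simp
next
  case (zpoly_step p c' m' n')
  then show ?case
    using zpoly.zpoly_step[of "\<lambda>z. c * (z ^ m * cnj z ^ n) * p z" "c * c'" "m + m'" "n + n'"]
    by (simp add: power_add algebra_simps)
qed

lemma zpoly_mult: "zpoly p \<Longrightarrow> zpoly q \<Longrightarrow> zpoly (\<lambda>z. p z * q z)"
proof (induction rule: zpoly.induct)
  case zpoly_zero
  then show ?case using zpoly.zpoly_zero by simp
next
  case (zpoly_step p c m n)
  then show ?case
    using zpoly_add[OF zpoly_monom_mult[of q c m n], of "\<lambda>z. p z * q z"] by (simp add: distrib_right)
qed

lemma zpoly_scale: "zpoly p \<Longrightarrow> zpoly (\<lambda>z. c * p z)"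
  by (intro zpoly_mult zpoly_const)

lemma zpoly_minus: "zpoly p \<Longrightarrow> zpoly (\<lambda>z. - p z)"
  using zpoly_scale[of p "-1"] by simp

lemma zpoly_cnj: "zpoly p \<Longrightarrow> zpoly (\<lambda>z. cnj (p z))"
proof (induction rule: zpoly.induct)
  case zpoly_zero
  then show ?case using zpoly.zpoly_zero by simp
next
  case (zpoly_step p c m n)
  then show ?case
    using zpoly.zpoly_step[of "\<lambda>z. cnj (p z)" "cnj c" n m] by (simp add: mult.commute)
qed

text \<open>The truncated subtraction is harmless: for m = 0 or n = 0 the factor
  \<open>of_nat m\<close> or \<open>of_nat n\<close> vanishes.\<close>

lemma has_wirtinger_monom:
  "has_wirtinger (\<lambda>z. c * (z ^ m * cnj z ^ n))
    ((c * of_nat m) * (z ^ (m - 1) * cnj z ^ n)) ((c * of_nat n) * (z ^ m * cnj z ^ (n - 1))) z"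
proof -
  have h: "has_wirtinger (\<lambda>z. z ^ m) (of_nat m * z ^ (m - 1)) 0 z" for m and z :: complex
    by (intro has_wirtinger_field_derivative) (auto intro!: derivative_eq_intros)
  show ?thesis
    using has_wirtinger_mult[OF has_wirtinger_const[of c z] has_wirtinger_mult[OF h[of m z] has_wirtinger_cnj[OF h[of n z]]]]
    by (simp add: mult_ac)
qed

lemma zpoly_differentiable: "zpoly p \<Longrightarrow> p differentiable at z"
proof (induction rule: zpoly.induct)
  case (zpoly_step p c m n)
  then show ?case
    using has_wirtinger_differentiable[OF has_wirtinger_add[OF has_wirtinger_monom differentiable_has_wirtinger]]
    by blast
qed simp

lemma
  assumes "zpoly p"
  shows d_z_step: "d_z (\<lambda>z. c * (z ^ m * cnj z ^ n) + p z) =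
      (\<lambda>z. (c * of_nat m) * (z ^ (m - 1) * cnj z ^ n) + d_z p z)"
    and d_zbar_step: "d_zbar (\<lambda>z. c * (z ^ m * cnj z ^ n) + p z) =
      (\<lambda>z. (c * of_nat n) * (z ^ m * cnj z ^ (n - 1)) + d_zbar p z)"
  using has_wirtinger_add[OF has_wirtinger_monom differentiable_has_wirtinger[OF zpoly_differentiable[OF assms]]]
  by (blast intro: has_wirtinger_d_z has_wirtinger_d_zbar)+

lemma d_zero: "d_z (\<lambda>z. 0) = (\<lambda>z. 0)" "d_zbar (\<lambda>z. 0) = (\<lambda>z. 0)"
  using has_wirtinger_d_z[OF has_wirtinger_const[of 0]] has_wirtinger_d_zbar[OF has_wirtinger_const[of 0]]
  by blast+

lemma zpoly_d_z: "zpoly p \<Longrightarrow> zpoly (d_z p)"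
  and zpoly_d_zbar: "zpoly p \<Longrightarrow> zpoly (d_zbar p)"
  by (induction rule: zpoly.induct) (auto simp: d_z_step d_zbar_step d_zero intro: zpoly.intros)

lemma zpoly_continuous: "zpoly p \<Longrightarrow> continuous_on S p"
  by (induction rule: zpoly.induct) (auto intro!: continuous_intros)

lemma zpoly_C1: "zpoly p \<Longrightarrow> C1_on S p"
  by (simp add: C1_on_def zpoly_differentiable zpoly_continuous zpoly_d_z zpoly_d_zbar)

lemma zpoly_d_z_d_zbar: "zpoly p \<Longrightarrow> d_z (d_zbar p) z = d_zbar (d_z p) z"
proof (induction rule: zpoly.induct)
  case (zpoly_step p c m n)
  then show ?case
    unfolding d_z_step[OF zpoly_step(1)] d_zbar_step[OF zpoly_step(1)]
      d_z_step[OF zpoly_d_zbar[OF zpoly_step(1)]] d_zbar_step[OF zpoly_d_z[OF zpoly_step(1)]]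
    by (simp add: mult_ac)
qed (simp add: d_zero)

lemma real_polynomial_zpoly:
  fixes f :: "complex \<Rightarrow> real"
  shows "real_polynomial_function f \<Longrightarrow> zpoly (\<lambda>z. of_real (f z))"
proof (induction rule: real_polynomial_function.induct)
  case (linear f)
  then interpret bounded_linear f .
  \<comment> \<open>A real-linear f is determined by f 1 and f \<open>\<i>\<close>; the coefficients
    result from Re z = (z + cnj z) / 2 and Im z = (z - cnj z) / (2 \<open>\<i>\<close>).\<close>
  have "(\<lambda>z. complex_of_real (f z)) =
      (\<lambda>z. (of_real (f 1) / 2 + of_real (f \<i>) / (2 * \<i>)) * (z ^ 1 * cnj z ^ 0)
        + (of_real (f 1) / 2 - of_real (f \<i>) / (2 * \<i>)) * (z ^ 0 * cnj z ^ 1))"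
  proof
    fix z
    have "f z = f (Re z *\<^sub>R 1 + Im z *\<^sub>R \<i>)"
      by (rule arg_cong[where f = f]) (simp add: complex_eq_iff)
    also have "\<dots> = Re z * f 1 + Im z * f \<i>"
      unfolding add scaleR by simp
    finally show "complex_of_real (f z) =
        (of_real (f 1) / 2 + of_real (f \<i>) / (2 * \<i>)) * (z ^ 1 * cnj z ^ 0)
        + (of_real (f 1) / 2 - of_real (f \<i>) / (2 * \<i>)) * (z ^ 0 * cnj z ^ 1)"
      by (simp add: complex_eq_iff)
  qed
  then show ?case by (simp only:) (rule zpoly_add[OF zpoly_monom zpoly_monom])
qed (auto intro: zpoly_const zpoly_add zpoly_mult)

text \<open>Stone-Weierstrass on the closed disc: real polynomials on the plane are polynomials in z
  and its conjugate.\<close>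

lemma zpoly_dense:
  assumes "continuous_on (cball 0 1) f" "0 < e"
  obtains p where "zpoly p" "\<And>z. z \<in> cball 0 1 \<Longrightarrow> cmod (f z - p z) < e"
proof -
  obtain g where g: "polynomial_function g" "\<And>z. z \<in> cball 0 1 \<Longrightarrow> norm (f z - g z) < e"
    using Stone_Weierstrass_polynomial_function[OF compact_cball assms] by blast
  have "real_polynomial_function (Re \<circ> g)" "real_polynomial_function (Im \<circ> g)"
    using g(1) bounded_linear_Re bounded_linear_Im unfolding polynomial_function_def by blast+
  then have "zpoly (\<lambda>z. of_real (Re (g z)))" "zpoly (\<lambda>z. of_real (Im (g z)))"
    by (auto dest: real_polynomial_zpoly)
  then have "zpoly (\<lambda>z. of_real (Re (g z)) + \<i> * of_real (Im (g z)))"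
    by (intro zpoly_add zpoly_scale)
  then have "zpoly g" by (simp add: complex_eq[symmetric])
  then show ?thesis using g(2) that by blast
qed

section \<open>Function spaces on the disc and the factor vanishing on the circle\<close>

lemma finite_measure_disc: "finite_measure disc_measure"
  by (intro finite_measure_lebesgue_on) (simp add: unit_disc_def)

lemma disc_measurable:
  fixes f :: "complex \<Rightarrow> 'b::{second_countable_topology,metric_space}"
  assumes "continuous_on unit_disc f"
  shows "f \<in> borel_measurable disc_measure"
  using assms by (intro continuous_imp_measurable_on_sets_lebesgue) (auto simp: unit_disc_def)

lemma disc_AE_I: "(\<And>z. z \<in> unit_disc \<Longrightarrow> P z) \<Longrightarrow> AE z in disc_measure. P z"
  by (rule AE_I2) simp

lemma disc_bounded:
  assumes "continuous_on (cball 0 1) f"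
  obtains B where "0 \<le> B" "\<And>z. z \<in> unit_disc \<Longrightarrow> cmod (f z) \<le> B"
proof -
  obtain B where B: "\<forall>y\<in>f ` cball 0 1. norm y \<le> B"
    using compact_imp_bounded[OF compact_continuous_image[OF assms compact_cball]]
    unfolding bounded_iff by blast
  then have b: "cmod (f z) \<le> B" if "z \<in> unit_disc" for z
    using that by (auto simp: unit_disc_def)
  moreover have "0 \<le> B"
    using order_trans[OF norm_ge_zero b[of 0]] by (simp add: unit_disc_def)
  ultimately show ?thesis using that by blast
qed

lemma sq_int_continuous:
  assumes "continuous_on (cball 0 1) f"
  shows "f \<in> sq_int disc_measure"
proof -
  obtain B where B: "0 \<le> B" "\<And>z. z \<in> unit_disc \<Longrightarrow> cmod (f z) \<le> B"
    using disc_bounded[OF assms] by blast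
  show ?thesis
  proof (rule sq_int_bound[where C = B, OF sq_int_const[OF finite_measure_disc, of 1]])
    show "f \<in> borel_measurable disc_measure"
      using assms by (intro disc_measurable) (auto intro: continuous_on_subset simp: unit_disc_def)
    show "AE z in disc_measure. cmod (f z) \<le> B * cmod 1"
      using B by (intro disc_AE_I) simp
  qed
qed

lemma sq_int_zpoly: "zpoly p \<Longrightarrow> p \<in> sq_int disc_measure"
  by (intro sq_int_continuous zpoly_continuous)

abbreviation disc_L2 :: "(complex \<Rightarrow> complex) set" where
  "disc_L2 \<equiv> sq_int disc_measure"

abbreviation disc_borel :: "(complex \<Rightarrow> complex) set" where
  "disc_borel \<equiv> borel_measurable disc_measure"

abbreviation disc_inner :: "(complex \<Rightarrow> complex) \<Rightarrow> (complex \<Rightarrow> complex) \<Rightarrow> complex" where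
  "disc_inner \<equiv> sq_inner disc_measure"

abbreviation disc_norm :: "(complex \<Rightarrow> complex) \<Rightarrow> real" where
  "disc_norm \<equiv> sq_norm disc_measure"

text \<open>A polynomial that vanishes on the circle; in the disc, 2 / \<open>defect\<close> is the
  square root of the Poincare density.\<close>

definition defect :: "complex \<Rightarrow> complex" where
  "defect z = 1 - z * cnj z"

abbreviation bdry :: "(complex \<Rightarrow> complex) \<Rightarrow> complex \<Rightarrow> complex" where
  "bdry q \<equiv> \<lambda>z. defect z * q z"

lemma defect_eq: "defect z = of_real (1 - (cmod z)\<^sup>2)"
  by (simp add: defect_def complex_norm_square[symmetric])

lemma defect_pos: "z \<in> unit_disc \<Longrightarrow> 0 < 1 - (cmod z)\<^sup>2"
  by (simp add: unit_disc_def abs_square_less_1)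

lemma defect_nonzero: "z \<in> unit_disc \<Longrightarrow> defect z \<noteq> 0"
  using defect_pos[of z] unfolding defect_eq of_real_eq_0_iff by simp

lemma zpoly_defect: "zpoly defect"
proof -
  have "defect = (\<lambda>z. 1 + (-1) * (z ^ 1 * cnj z ^ 1))" by (auto simp: defect_def)
  then show ?thesis using zpoly_add[OF zpoly_const zpoly_monom] by metis
qed

lemma zpoly_defect_mult: "zpoly p \<Longrightarrow> zpoly (bdry p)"
  by (intro zpoly_mult zpoly_defect)

lemma d_zbar_defect: "d_zbar defect z = - z"
proof -
  have "has_wirtinger (\<lambda>z. 1 + (-1) * (z ^ 1 * cnj z ^ 1)) (0 + (-1 * of_nat 1) * (z ^ (1 - 1) * cnj z ^ 1)) (0 + (-1 * of_nat 1) * (z ^ 1 * cnj z ^ (1 - 1))) z"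
    by (intro has_wirtinger_add has_wirtinger_monom has_wirtinger_const)
  moreover have "defect = (\<lambda>z. 1 + (-1) * (z ^ 1 * cnj z ^ 1))" by (auto simp: defect_def)
  ultimately show ?thesis using has_wirtinger_d_zbar by fastforce
qed

lemma d_zbar_defect_mult:
  "zpoly p \<Longrightarrow> d_zbar (bdry p) z = - z * p z + defect z * d_zbar p z"
  by (simp add: d_zbar_mult zpoly_differentiable zpoly_defect d_zbar_defect)

text \<open>This is (t - \<open>\<delta>\<close>)^2 / t above \<open>\<delta>\<close> and 0 below.
  The double zero at \<open>\<delta>\<close> makes it continuously differentiable; for t > 0 it lies
  between 0 and t, its slope lies in [0, 1] uniformly in \<open>\<delta>\<close>, and it tends to t.
  These are the bounds for dominated convergence.\<close>

definition cutoff :: "real \<Rightarrow> real \<Rightarrow> real" where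
  "cutoff \<delta> t = (max t \<delta> - \<delta>)\<^sup>2 / max t \<delta>"

definition cutoff' :: "real \<Rightarrow> real \<Rightarrow> real" where
  "cutoff' \<delta> t = 1 - \<delta>\<^sup>2 / (max t \<delta>)\<^sup>2"

lemma cutoff_DERIV:
  assumes "0 < \<delta>"
  shows "(cutoff \<delta> has_real_derivative cutoff' \<delta> t) (at t)"
proof -
  consider "t < \<delta>" | "t = \<delta>" | "\<delta> < t" by linarith
  then show ?thesis
  proof cases
    case 1
    have "((\<lambda>_. 0) has_real_derivative cutoff' \<delta> t) (at t)"
      using 1 assms by (simp add: cutoff'_def)
    then show ?thesis
      by (rule has_field_derivative_transform_within_open[of _ _ _ "{..<\<delta>}"]) (use 1 in \<open>auto simp: cutoff_def\<close>)
  next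
    case 2
    \<comment> \<open>Only the junction needs an estimate; on either side the cutoff is given by a
      single formula.\<close>
    have "((\<lambda>y. (cutoff \<delta> y - cutoff \<delta> \<delta>) / (y - \<delta>)) \<longlongrightarrow> 0) (at \<delta>)"
    proof (rule Lim_null_comparison)
      show "\<forall>\<^sub>F y in at \<delta>. norm ((cutoff \<delta> y - cutoff \<delta> \<delta>) / (y - \<delta>)) \<le> \<bar>y - \<delta>\<bar> / \<delta>"
      proof (rule eventually_mono[OF eventually_True])
        fix y
        show "norm ((cutoff \<delta> y - cutoff \<delta> \<delta>) / (y - \<delta>)) \<le> \<bar>y - \<delta>\<bar> / \<delta>"
        proof (cases "\<delta> < y")
          case True
          then have "norm ((cutoff \<delta> y - cutoff \<delta> \<delta>) / (y - \<delta>)) = (y - \<delta>) / y"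
            using assms by (simp add: cutoff_def max_def power2_eq_square)
          also have "\<dots> \<le> \<bar>y - \<delta>\<bar> / \<delta>"
            using True assms by (simp add: frac_le)
          finally show ?thesis .
        next
          case False
          then show ?thesis using assms by (simp add: cutoff_def max_def)
        qed
      qed
      have "((\<lambda>y. \<bar>y - \<delta>\<bar> / \<delta>) \<longlongrightarrow> \<bar>\<delta> - \<delta>\<bar> / \<delta>) (at \<delta>)"
        using assms by (intro tendsto_intros) auto
      then show "((\<lambda>y. \<bar>y - \<delta>\<bar> / \<delta>) \<longlongrightarrow> 0) (at \<delta>)" by simp
    qed
    then show ?thesis using 2 assms by (simp add: has_field_derivative_iff cutoff'_def)
  next
    case 3
    have "((\<lambda>t. (t - \<delta>)\<^sup>2 / t) has_real_derivative cutoff' \<delta> t) (at t)"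
      using 3 assms by (auto intro!: derivative_eq_intros simp: cutoff'_def max_def field_simps power2_eq_square)
    then show ?thesis
      by (rule has_field_derivative_transform_within_open[of _ _ _ "{\<delta><..}"]) (use 3 in \<open>auto simp: cutoff_def max_def\<close>)
  qed
qed

lemma cutoff'_bounds: "0 < \<delta> \<Longrightarrow> 0 \<le> cutoff' \<delta> t \<and> cutoff' \<delta> t \<le> 1"
  by (auto simp: cutoff'_def divide_le_eq power_mono)

lemma cutoff_bounds:
  assumes "0 < \<delta>" "0 < t"
  shows "0 \<le> cutoff \<delta> t" "cutoff \<delta> t \<le> t"
proof -
  show "0 \<le> cutoff \<delta> t" using assms by (simp add: cutoff_def)
  show "cutoff \<delta> t \<le> t"
  proof (cases "\<delta> < t")
    case True
    then have "(t - \<delta>)\<^sup>2 \<le> t\<^sup>2" using assms by (intro power_mono) auto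
    then show ?thesis using True assms by (simp add: cutoff_def max_def divide_le_eq power2_eq_square)
  qed (use assms in \<open>simp add: cutoff_def max_def\<close>)
qed

lemma cutoff_limits:
  assumes "0 < t" "\<delta> \<longlonglongrightarrow> 0" "\<And>n::nat. 0 < \<delta> n"
  shows "(\<lambda>n. cutoff (\<delta> n) t) \<longlonglongrightarrow> t" "(\<lambda>n. cutoff' (\<delta> n) t) \<longlonglongrightarrow> 1"
proof -
  have "(\<lambda>n. (max t (\<delta> n) - \<delta> n)\<^sup>2 / max t (\<delta> n)) \<longlonglongrightarrow> (max t 0 - 0)\<^sup>2 / max t 0"
    "(\<lambda>n. 1 - (\<delta> n)\<^sup>2 / (max t (\<delta> n))\<^sup>2) \<longlonglongrightarrow> 1 - 0\<^sup>2 / (max t 0)\<^sup>2"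
    using assms by (intro tendsto_intros; simp)+
  then show "(\<lambda>n. cutoff (\<delta> n) t) \<longlonglongrightarrow> t" "(\<lambda>n. cutoff' (\<delta> n) t) \<longlonglongrightarrow> 1"
    using assms(1) by (simp_all add: cutoff_def cutoff'_def power2_eq_square)
qed

lemma has_wirtinger_cutoff:
  assumes "0 < \<delta>"
  shows "has_wirtinger (\<lambda>z. of_real (cutoff \<delta> (1 - (cmod z)\<^sup>2)))
    (of_real (cutoff' \<delta> (1 - (cmod z)\<^sup>2)) * - cnj z) (of_real (cutoff' \<delta> (1 - (cmod z)\<^sup>2)) * - z) z"
proof -
  have "((\<lambda>z. 1 - (z \<bullet> z)) has_derivative (\<lambda>h. - (2 * (z \<bullet> h)))) (at z)"
    by (auto intro!: derivative_eq_intros simp: inner_commute)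
  then have "((\<lambda>z. 1 - (cmod z)\<^sup>2) has_derivative (\<lambda>h. - (2 * (z \<bullet> h)))) (at z)"
    by (simp add: power2_norm_eq_inner)
  from DERIV_compose_FDERIV[OF cutoff_DERIV[OF assms] this]
  have "((\<lambda>z. of_real (cutoff \<delta> (1 - (cmod z)\<^sup>2))) has_derivative
      (\<lambda>h. complex_of_real (- (2 * (z \<bullet> h)) * cutoff' \<delta> (1 - (cmod z)\<^sup>2)))) (at z)"
    by (rule has_derivative_of_real)
  moreover have "complex_of_real (- (2 * (z \<bullet> h)) * cutoff' \<delta> (1 - (cmod z)\<^sup>2)) =
    of_real (cutoff' \<delta> (1 - (cmod z)\<^sup>2)) * - cnj z * h + of_real (cutoff' \<delta> (1 - (cmod z)\<^sup>2)) * - z * cnj h" for h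
    by (simp add: complex_eq_iff inner_complex_def algebra_simps)
  ultimately show ?thesis by (simp add: has_wirtinger_def)
qed

lemma cutoff_test:
  assumes "0 < \<delta>" "\<delta> < 1"
  shows "(\<lambda>z. of_real (cutoff \<delta> (1 - (cmod z)\<^sup>2))) \<in> test_functions"
proof -
  have pos: "max t \<delta> \<noteq> 0" for t using assms by (simp add: max_def)
  have "C1_on UNIV (\<lambda>z. of_real (cutoff \<delta> (1 - (cmod z)\<^sup>2)))"
    by (rule C1_onI, rule has_wirtinger_cutoff[OF assms(1)])
      (auto simp: cutoff'_def pos intro!: continuous_intros)
  moreover have "compact (cball 0 (sqrt (1 - \<delta>)) :: complex set)" by simp
  moreover have s: "sqrt (1 - \<delta>) < 1" using assms by simp
  have "cball 0 (sqrt (1 - \<delta>)) \<subseteq> unit_disc"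
    using order_le_less_trans[OF _ s] by (force simp only: unit_disc_def mem_cball mem_ball)
  moreover have "cutoff \<delta> (1 - (cmod z)\<^sup>2) = 0" if "z \<notin> cball 0 (sqrt (1 - \<delta>))" for z
  proof -
    have "(sqrt (1 - \<delta>))\<^sup>2 < (cmod z)\<^sup>2"
      using that assms by (intro power_strict_mono) auto
    then show ?thesis using assms by (simp add: cutoff_def max_def)
  qed
  ultimately show ?thesis unfolding test_functions_iff by (metis of_real_0)
qed

section \<open>Weak derivatives on the disc\<close>

lemmas zpoly_bounded = disc_bounded[OF zpoly_continuous]

lemma zpoly_mult_sq_int:
  assumes "zpoly p" "f \<in> disc_L2"
  shows "(\<lambda>z. p z * f z) \<in> disc_L2"
proof -
  obtain B where "0 \<le> B" "\<And>z. z \<in> unit_disc \<Longrightarrow> cmod (p z) \<le> B"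
    using zpoly_bounded[OF assms(1)] by blast
  then show ?thesis
    using assms by (intro sq_int_bounded_mult(1)[of _ _ B] disc_measurable zpoly_continuous disc_AE_I)
qed

lemma test_continuous:
  assumes "\<phi> \<in> test_functions"
  shows "continuous_on S \<phi>" "continuous_on S (d_z \<phi>)" "continuous_on S (d_zbar \<phi>)"
  using assms C1_on_continuous[of UNIV \<phi>]
  by (auto simp: test_functions_iff C1_on_def intro: continuous_on_subset)

lemma test_sq_int:
  assumes "\<phi> \<in> test_functions"
  shows "\<phi> \<in> disc_L2" "d_z \<phi> \<in> disc_L2" "d_zbar \<phi> \<in> disc_L2"
  by (intro sq_int_continuous test_continuous assms)+

text \<open>The functions \<open>bdry p\<close> are limits of test functions, obtained by replacing the factor
  \<open>defect\<close> with a \<open>cutoff\<close> of it, so a weak derivative can be tested against them.\<close>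
lemma weak_d_zbar_defect_mult:
  assumes a: "a \<in> disc_L2" and wm: "w \<in> disc_borel"
    and w: "(\<lambda>z. defect z * w z) \<in> disc_L2"
    and weak: "\<And>\<phi>. \<phi> \<in> test_functions \<Longrightarrow> pairing w \<phi> = - pairing a (d_zbar \<phi>)"
    and p: "zpoly p"
  shows "(LINT z|disc_measure. w z * (defect z * p z)) = - (LINT z|disc_measure. a z * d_zbar (bdry p) z)"
proof -
  obtain B where B: "0 \<le> B" "\<And>z. z \<in> unit_disc \<Longrightarrow> cmod (p z) \<le> B"
    using zpoly_bounded[OF p] by blast
  obtain B' where B': "0 \<le> B'" "\<And>z. z \<in> unit_disc \<Longrightarrow> cmod (d_zbar p z) \<le> B'"
    using zpoly_bounded[OF zpoly_d_zbar[OF p]] by blast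
  \<comment> \<open>The shift by two keeps every cutoff parameter strictly below 1.\<close>
  define \<delta> where "\<delta> n = 1 / real (Suc (Suc n))" for n
  have \<delta>: "0 < \<delta> n" "\<delta> n < 1" for n by (auto simp: \<delta>_def)
  have \<delta>0: "\<delta> \<longlonglongrightarrow> 0"
    unfolding \<delta>_def using LIMSEQ_Suc[OF LIMSEQ_Suc[OF lim_const_over_n[of 1]]] by simp
  define r where "r z = 1 - (cmod z)\<^sup>2" for z :: complex
  have r: "0 < r z" "r z \<le> 1" if "z \<in> unit_disc" for z
    using defect_pos[OF that] by (auto simp: r_def)
  define \<phi> where "\<phi> n z = p z * of_real (cutoff (\<delta> n) (r z))" for n z
  have \<phi>: "\<phi> n \<in> test_functions" for n
    unfolding \<phi>_def r_def by (intro test_functions_mult zpoly_C1 p cutoff_test \<delta>)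
  have d\<phi>: "d_zbar (\<phi> n) z = d_zbar p z * of_real (cutoff (\<delta> n) (r z)) + p z * (of_real (cutoff' (\<delta> n) (r z)) * - z)" for n z
    unfolding \<phi>_def r_def
    by (rule has_wirtinger_d_zbar[OF has_wirtinger_mult[OF
          differentiable_has_wirtinger[OF zpoly_differentiable[OF p]] has_wirtinger_cutoff[OF \<delta>(1)]]])
  have [measurable]: "a \<in> disc_borel" "w \<in> disc_borel"
    using a wm by (auto simp: sq_int_def)
  have m1: "\<phi> n \<in> disc_borel" "d_zbar (\<phi> n) \<in> disc_borel" for n
    by (intro disc_measurable test_continuous \<phi>)+
  have m2: "(bdry p) \<in> disc_borel" "d_zbar (bdry p) \<in> disc_borel"
    by (intro disc_measurable zpoly_continuous zpoly_d_zbar zpoly_defect_mult p)+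
  note [measurable] = m1 m2
  \<comment> \<open>As the cutoff is at most \<open>r\<close>, integrability of
    \<open>defect * w\<close> suffices; \<open>w\<close> itself may grow at the circle, as
    coefficients of L2 forms of type (1,1) may.\<close>
  have lim1: "(\<lambda>n. LINT z|disc_measure. w z * \<phi> n z) \<longlonglongrightarrow> (LINT z|disc_measure. w z * (defect z * p z))"
  proof (rule integral_dominated_convergence)
    show "integrable disc_measure (\<lambda>z. B * cmod (defect z * w z))"
      using sq_int_integrable1[OF finite_measure_disc w] by simp
    show "AE z in disc_measure. (\<lambda>n. w z * \<phi> n z) \<longlonglongrightarrow> w z * (defect z * p z)"
    proof (rule disc_AE_I)
      fix z assume z: "z \<in> unit_disc"
      have "(\<lambda>n. w z * \<phi> n z) \<longlonglongrightarrow> w z * (p z * of_real (r z))"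
        unfolding \<phi>_def by (intro tendsto_intros cutoff_limits r z \<delta>0 \<delta>)
      then show "(\<lambda>n. w z * \<phi> n z) \<longlonglongrightarrow> w z * (defect z * p z)"
        by (simp only: defect_eq r_def mult.commute)
    qed
    show "AE z in disc_measure. norm (w z * \<phi> n z) \<le> B * cmod (defect z * w z)" for n
    proof (rule disc_AE_I)
      fix z assume z: "z \<in> unit_disc"
      have "cmod (p z) * cutoff (\<delta> n) (r z) \<le> B * r z"
        using B z r[OF z] cutoff_bounds[OF \<delta>(1)[of n] r(1)[OF z]] by (intro mult_mono) auto
      then have "cmod (w z) * (cmod (p z) * cutoff (\<delta> n) (r z)) \<le> cmod (w z) * (B * r z)"
        by (intro mult_left_mono) auto
      then show "norm (w z * \<phi> n z) \<le> B * cmod (defect z * w z)"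
        using cutoff_bounds[OF \<delta>(1)[of n] r(1)[OF z]] r[OF z]
        by (simp add: \<phi>_def norm_mult defect_eq r_def[symmetric] mult_ac del: of_real_diff of_real_power)
    qed
  qed measurable
  \<comment> \<open>The slope of the cutoff is at most 1 for all parameters, so a fixed multiple of
    |a| dominates.\<close>
  have lim2: "(\<lambda>n. LINT z|disc_measure. a z * d_zbar (\<phi> n) z) \<longlonglongrightarrow> (LINT z|disc_measure. a z * d_zbar (bdry p) z)"
  proof (rule integral_dominated_convergence)
    show "integrable disc_measure (\<lambda>z. (B + B') * cmod (a z))"
      using sq_int_integrable1[OF finite_measure_disc a] by simp
    show "AE z in disc_measure. (\<lambda>n. a z * d_zbar (\<phi> n) z) \<longlonglongrightarrow> a z * d_zbar (bdry p) z"
    proof (rule disc_AE_I)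
      fix z assume z: "z \<in> unit_disc"
      have "(\<lambda>n. a z * d_zbar (\<phi> n) z) \<longlonglongrightarrow> a z * (d_zbar p z * of_real (r z) + p z * (of_real 1 * - z))"
        unfolding d\<phi> by (intro tendsto_intros cutoff_limits r z \<delta>0 \<delta>)
      moreover have "d_zbar p z * of_real (r z) + p z * (of_real 1 * - z) = d_zbar (bdry p) z"
        unfolding d_zbar_defect_mult[OF p] by (simp add: defect_eq r_def)
      ultimately show "(\<lambda>n. a z * d_zbar (\<phi> n) z) \<longlonglongrightarrow> a z * d_zbar (bdry p) z"
        by (simp only:)
    qed
    show "AE z in disc_measure. norm (a z * d_zbar (\<phi> n) z) \<le> (B + B') * cmod (a z)" for n
    proof (rule disc_AE_I)
      fix z assume z: "z \<in> unit_disc"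
      note cb = cutoff_bounds[OF \<delta>(1)[of n] r(1)[OF z]] cutoff'_bounds[OF \<delta>(1)[of n], of "r z"]
      have "cmod (d_zbar (\<phi> n) z) \<le> cmod (d_zbar p z) * cutoff (\<delta> n) (r z) + cmod (p z) * (cutoff' (\<delta> n) (r z) * cmod z)"
        unfolding d\<phi> using cb by (intro norm_triangle_le) (simp add: norm_mult)
      also have "\<dots> \<le> B' * 1 + B * (1 * 1)"
        using cb r[OF z] B B' z by (intro add_mono mult_mono) (auto simp: unit_disc_def)
      finally have "cmod (a z) * cmod (d_zbar (\<phi> n) z) \<le> cmod (a z) * (B' * 1 + B * (1 * 1))"
        by (intro mult_left_mono) auto
      then show "norm (a z * d_zbar (\<phi> n) z) \<le> (B + B') * cmod (a z)"
        by (simp add: norm_mult algebra_simps)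
    qed
  qed measurable
  have "(LINT z|disc_measure. w z * \<phi> n z) = - (LINT z|disc_measure. a z * d_zbar (\<phi> n) z)" for n
    using weak[OF \<phi>] by (simp add: pairing_def)
  then show ?thesis
    using LIMSEQ_unique[OF lim1] tendsto_minus[OF lim2] by simp
qed

text \<open>The product of \<open>g\<close> with a test function is a test function, so the integral
  of its derivative vanishes.\<close>

lemma weak_d_zbar_C1:
  assumes g: "C1_on unit_disc g" and \<phi>: "\<phi> \<in> test_functions"
    and int: "integrable disc_measure (\<lambda>z. d_zbar g z * \<phi> z)" "integrable disc_measure (\<lambda>z. g z * d_zbar \<phi> z)"
  shows "pairing (d_zbar g) \<phi> = - pairing g (d_zbar \<phi>)"
proof -
  have "0 = (LINT z|disc_measure. d_zbar (\<lambda>z. g z * \<phi> z) z)"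
    using test_integral_zero(2)[OF test_functions_mult[OF g \<phi>]] by simp
  also have "\<dots> = (LINT z|disc_measure. d_zbar g z * \<phi> z + g z * d_zbar \<phi> z)"
    using g \<phi> by (intro Bochner_Integration.integral_cong refl d_zbar_mult) (auto simp: C1_on_def test_functions_iff)
  also have "\<dots> = pairing (d_zbar g) \<phi> + pairing g (d_zbar \<phi>)"
    unfolding pairing_def using int by simp
  finally show ?thesis by (simp add: eq_neg_iff_add_eq_0)
qed

lemma weak_d_z_C1:
  assumes g: "C1_on unit_disc g" and \<phi>: "\<phi> \<in> test_functions"
    and int: "integrable disc_measure (\<lambda>z. d_z g z * \<phi> z)" "integrable disc_measure (\<lambda>z. g z * d_z \<phi> z)"
  shows "pairing (d_z g) \<phi> = - pairing g (d_z \<phi>)"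
proof -
  have "0 = (LINT z|disc_measure. d_z (\<lambda>z. g z * \<phi> z) z)"
    using test_integral_zero(1)[OF test_functions_mult[OF g \<phi>]] by simp
  also have "\<dots> = (LINT z|disc_measure. d_z g z * \<phi> z + g z * d_z \<phi> z)"
    using g \<phi> by (intro Bochner_Integration.integral_cong refl d_z_mult) (auto simp: C1_on_def test_functions_iff)
  also have "\<dots> = pairing (d_z g) \<phi> + pairing g (d_z \<phi>)"
    unfolding pairing_def using int by simp
  finally show ?thesis by (simp add: eq_neg_iff_add_eq_0)
qed

lemma weak_d_zbar_zpoly: "zpoly p \<Longrightarrow> \<phi> \<in> test_functions \<Longrightarrow> pairing (d_zbar p) \<phi> = - pairing p (d_zbar \<phi>)"
  by (intro weak_d_zbar_C1 zpoly_C1 sq_int_mult_integrable sq_int_zpoly zpoly_d_zbar test_sq_int)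

lemma weak_d_z_zpoly: "zpoly p \<Longrightarrow> \<phi> \<in> test_functions \<Longrightarrow> pairing (d_z p) \<phi> = - pairing p (d_z \<phi>)"
  by (intro weak_d_z_C1 zpoly_C1 sq_int_mult_integrable sq_int_zpoly zpoly_d_z test_sq_int)

text \<open>Integration by parts leaves no boundary term, as \<open>bdry q\<close> vanishes on the
  circle.\<close>

lemma zpoly_parts:
  assumes "zpoly p" "zpoly q"
  shows "(LINT z|disc_measure. d_zbar p z * (defect z * q z)) = - (LINT z|disc_measure. p z * d_zbar (bdry q) z)"
  using assms
  by (intro weak_d_zbar_defect_mult sq_int_zpoly zpoly_defect_mult zpoly_d_zbar weak_d_zbar_zpoly borel_measurable_integrable
      sq_int_integrable1 finite_measure_disc)

lemma integral_d_zbar_defect_mult: "zpoly q \<Longrightarrow> (LINT z|disc_measure. d_zbar (bdry q) z) = 0"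
  using zpoly_parts[OF zpoly_const[of 1], of q] has_wirtinger_d_zbar[OF has_wirtinger_const[of 1]] by simp

text \<open>Uniform approximation extends the hypothesis to all continuous test functions. A bounded
  a.e. limit of these, chosen as \<open>s\<close>, yields that the integral of |h|^2 / (1 + |h|) is
  zero.\<close>

lemma moments_zero_imp_AE_zero:
  assumes h: "integrable disc_measure h"
    and mom: "\<And>p. zpoly p \<Longrightarrow> (LINT z|disc_measure. h z * p z) = 0"
  shows "AE z in disc_measure. h z = 0"
proof -
  have [measurable]: "h \<in> disc_borel" using h by simp
  have cont: "(LINT z|disc_measure. h z * f z) = 0" if f: "continuous_on UNIV f" for f
  proof -
    obtain B' where B': "\<And>z. z \<in> unit_disc \<Longrightarrow> cmod (f z) \<le> B'"
      using disc_bounded[of f] continuous_on_subset[OF f] by blast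
    have [measurable]: "f \<in> disc_borel"
      using f by (intro disc_measurable) (auto intro: continuous_on_subset)
    have int: "integrable disc_measure (\<lambda>z. h z * g z)"
      if "g \<in> disc_borel" "\<And>z. z \<in> unit_disc \<Longrightarrow> cmod (g z) \<le> C" for g C
    proof (rule Bochner_Integration.integrable_bound[of _ "\<lambda>z. C * cmod (h z)"])
      show "integrable disc_measure (\<lambda>z. C * cmod (h z))" using h by simp
      show "(\<lambda>z. h z * g z) \<in> disc_borel" using that(1) by simp
      show "AE z in disc_measure. norm (h z * g z) \<le> norm (C * cmod (h z))"
      proof (rule disc_AE_I)
        fix z assume z: "z \<in> unit_disc"
        have "0 \<le> C" using order_trans[OF norm_ge_zero that(2)[OF z]] .
        then show "norm (h z * g z) \<le> norm (C * cmod (h z))"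
          using mult_left_mono[OF that(2)[OF z], of "cmod (h z)"] by (simp add: norm_mult mult.commute)
      qed
    qed
    define I where "I = (LINT z|disc_measure. cmod (h z))"
    have I: "0 \<le> I" by (simp add: I_def)
    have le: "cmod (LINT z|disc_measure. h z * f z) \<le> e" if "0 < e" for e
    proof -
      define d where "d = e / (I + 1)"
      have d: "0 < d" using that I by (simp add: d_def)
      obtain p where p: "zpoly p" "\<And>z. z \<in> cball 0 1 \<Longrightarrow> cmod (f z - p z) < d"
        using zpoly_dense[of f d] d f continuous_on_subset by blast
      have [measurable]: "p \<in> disc_borel"
        using p(1) by (intro disc_measurable zpoly_continuous)
      have pd: "cmod (f z - p z) \<le> d" if "z \<in> unit_disc" for z
        using p(2)[of z] that by (auto simp: unit_disc_def)
      obtain B where "\<And>z. z \<in> unit_disc \<Longrightarrow> cmod (p z) \<le> B"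
        using zpoly_bounded[OF p(1)] by blast
      then have ip: "integrable disc_measure (\<lambda>z. h z * p z)" by (intro int) auto
      have if': "integrable disc_measure (\<lambda>z. h z * f z)" by (rule int[OF _ B']) measurable
      have "(LINT z|disc_measure. h z * f z) = (LINT z|disc_measure. h z * f z) - (LINT z|disc_measure. h z * p z)"
        using mom[OF p(1)] by simp
      also have "\<dots> = (LINT z|disc_measure. h z * (f z - p z))"
        using ip if' by (simp add: right_diff_distrib)
      also have "cmod \<dots> \<le> (LINT z|disc_measure. cmod (h z * (f z - p z)))"
        by (rule integral_norm_bound)
      also have "\<dots> \<le> (LINT z|disc_measure. d * cmod (h z))"
      proof (rule integral_mono_AE)
        show "integrable disc_measure (\<lambda>z. cmod (h z * (f z - p z)))"
          by (intro integrable_norm int[of _ d] pd) auto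
        show "AE z in disc_measure. cmod (h z * (f z - p z)) \<le> d * cmod (h z)"
          using pd by (intro disc_AE_I) (simp add: norm_mult mult.commute[of d] mult_left_mono)
      qed (use h in simp)
      also have "\<dots> = d * I" by (simp add: I_def)
      also have "\<dots> \<le> e" using I that by (simp add: d_def field_simps)
      finally show ?thesis .
    qed
    then show ?thesis using field_le_epsilon[of "cmod (LINT z|disc_measure. h z * f z)" 0] by simp
  qed
  \<comment> \<open>A bounded substitute for the conjugate phase of h; being a continuous function
    of h, it is measurable without treating the zeros of h apart.\<close>
  define s where "s z = cnj (h z) / of_real (1 + cmod (h z))" for z
  have [measurable]: "s \<in> disc_borel"
  proof -
    have "(\<lambda>w. cnj w / complex_of_real (1 + cmod w)) \<in> borel_measurable borel"
    proof (intro borel_measurable_continuous_onI continuous_intros)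
      show "\<forall>w\<in>UNIV. complex_of_real (1 + cmod w) \<noteq> 0"
        by (metis add_pos_nonneg less_irrefl norm_ge_zero of_real_eq_0_iff zero_less_one)
    qed
    then show ?thesis unfolding s_def by measurable
  qed
  have s1: "cmod (s z) \<le> 1" for z
  proof -
    have "cmod (complex_of_real (1 + cmod (h z))) = 1 + cmod (h z)"
      unfolding norm_of_real by simp
    moreover have "cmod (h z) / (1 + cmod (h z)) \<le> 1"
      by (rule divide_le_eq_1_pos[THEN iffD2]) (auto intro: add_pos_nonneg)
    ultimately show ?thesis by (simp only: s_def norm_divide complex_mod_cnj)
  qed
  have "s measurable_on unit_disc"
    by (rule measurable_on_iff_borel_measurable[THEN iffD2]) (simp_all, simp add: unit_disc_def)
  then obtain N g where N: "negligible N" and g: "\<And>n. continuous_on UNIV (g n)"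
    "\<And>x. x \<notin> N \<Longrightarrow> (\<lambda>n. g n x) \<longlonglongrightarrow> (if x \<in> unit_disc then s x else 0)"
    unfolding measurable_on_def by blast
  \<comment> \<open>Radial projection to the closed unit disc bounds the approximants uniformly and,
    as |s| is at most 1, keeps their limit.\<close>
  define k where "k n z = g n z / of_real (max 1 (cmod (g n z)))" for n z
  have nz: "complex_of_real (max 1 x) \<noteq> 0" for x
    by (simp add: max_def)
  have kc: "continuous_on UNIV (k n)" for n
    unfolding k_def by (intro continuous_intros g ballI nz)
  have k1: "cmod (k n z) \<le> 1" for n z
    by (auto simp: k_def norm_divide divide_le_eq)
  have klim: "(\<lambda>n. k n z) \<longlonglongrightarrow> s z" if "z \<notin> N" "z \<in> unit_disc" for z
  proof -
    have "(\<lambda>n. k n z) \<longlonglongrightarrow> s z / of_real (max 1 (cmod (s z)))"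
      unfolding k_def using g(2)[OF that(1)] that(2) by (intro tendsto_intros nz) auto
    then show ?thesis using s1[of z] by (simp add: max_def split: if_splits)
  qed
  have [measurable]: "k n \<in> disc_borel" for n
    using kc by (intro disc_measurable) (auto intro: continuous_on_subset)
  have "AE z in lebesgue. z \<notin> N"
    using N by (auto simp: negligible_iff_null_sets intro: AE_not_in)
  then have AEN: "AE z in disc_measure. z \<notin> N"
    by (subst AE_restrict_space_iff) (auto simp: unit_disc_def)
  have "(\<lambda>n. LINT z|disc_measure. h z * k n z) \<longlonglongrightarrow> (LINT z|disc_measure. h z * s z)"
  proof (rule integral_dominated_convergence)
    show "integrable disc_measure (\<lambda>z. cmod (h z))" using h by simp
    show "AE z in disc_measure. norm (h z * k n z) \<le> cmod (h z)" for n
      using k1 by (intro AE_I2) (simp add: norm_mult mult_left_le)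
    show "AE z in disc_measure. (\<lambda>n. h z * k n z) \<longlonglongrightarrow> h z * s z"
      using AEN AE_space[of disc_measure]
      by eventually_elim (auto intro!: tendsto_intros klim)
  qed measurable
  then have "(LINT z|disc_measure. h z * s z) = 0"
    unfolding cont[OF kc] by (simp add: LIMSEQ_const_iff)
  moreover have "h z * s z = of_real ((cmod (h z))\<^sup>2 / (1 + cmod (h z)))" for z
    by (simp add: s_def complex_norm_square del: of_real_power)
  ultimately have z: "(LINT z|disc_measure. (cmod (h z))\<^sup>2 / (1 + cmod (h z))) = 0"
    by (simp del: of_real_divide of_real_power of_real_add)
  have "integrable disc_measure (\<lambda>z. (cmod (h z))\<^sup>2 / (1 + cmod (h z)))"
  proof (rule Bochner_Integration.integrable_bound[OF h])
    have pos: "0 < 1 + cmod w" for w :: complex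
      using norm_ge_zero[of w] by linarith
    have "norm ((cmod (h z))\<^sup>2 / (1 + cmod (h z))) \<le> norm (h z)" for z
      using pos_divide_le_eq[OF pos[of "h z"], of "(cmod (h z))\<^sup>2" "cmod (h z)"] pos[of "h z"]
      by (simp add: power2_eq_square algebra_simps)
    then show "AE z in disc_measure. norm ((cmod (h z))\<^sup>2 / (1 + cmod (h z))) \<le> norm (h z)"
      by (intro AE_I2)
  qed simp
  then have "AE z in disc_measure. (cmod (h z))\<^sup>2 / (1 + cmod (h z)) = 0"
    using z by (subst (asm) integral_nonneg_eq_0_iff_AE) auto
  then show ?thesis
  proof eventually_elim
    case (elim z)
    moreover have "1 + cmod (h z) \<noteq> 0" using norm_ge_zero[of "h z"] by linarith
    ultimately show ?case by simp
  qed
qed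

text \<open>Modulo the functions \<open>d_zbar (bdry q)\<close>, the monomial \<open>z\<^sup>m\<^sup>+\<^sup>1 zbar\<^sup>n\<close> is the multiple \<open>n / (n + 1)\<close> of
  \<open>z\<^sup>m zbar\<^sup>n\<^sup>-\<^sup>1\<close>.\<close>
lemma monom_decomposition:
  "\<exists>q s. zpoly q \<and> zpoly s \<and> d_z s = (\<lambda>z. 0) \<and>
    (\<forall>z. c * (z ^ m * cnj z ^ n) = d_zbar (bdry q) z + s z)"
proof (induction m arbitrary: c n)
  case 0
  have "d_z (\<lambda>z. c * (z ^ 0 * cnj z ^ n)) = (\<lambda>z. 0)"
    using has_wirtinger_d_z[OF has_wirtinger_monom[of c 0 n]] by (intro ext) simp
  moreover have "d_zbar (\<lambda>z. defect z * 0) = (\<lambda>z. 0)"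
    by (simp add: d_zero)
  ultimately show ?case using zpoly_zero zpoly_monom[of c 0 n]
    by (intro exI[of _ "\<lambda>z. 0"] exI[of _ "\<lambda>z. c * (z ^ 0 * cnj z ^ n)"]) simp
next
  case (Suc m)
  \<comment> \<open>For q = z^m zbar^n, \<open>d_zbar (bdry q)\<close> is n z^m zbar^(n-1) - (n+1)
    z^(m+1) zbar^n. The constant cancels the factor -(n+1); the other term is left to the induction
    hypothesis.\<close>
  define c' where "c' = - c / (of_nat n + 1)"
  have n1: "(of_nat n + 1 :: complex) \<noteq> 0"
    by (metis of_nat_Suc of_nat_neq_0 add.commute)
  obtain q s where qs: "zpoly q" "zpoly s" "d_z s = (\<lambda>z. 0)"
    "\<And>z. (- of_nat n * c') * (z ^ m * cnj z ^ (n - 1)) = d_zbar (bdry q) z + s z"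
    using Suc.IH[of "- of_nat n * c'" "n - 1"] by blast
  define q' where "q' z = c' * (z ^ m * cnj z ^ n) + q z" for z
  have q': "zpoly q'" unfolding q'_def by (rule zpoly_step[OF qs(1)])
  have dq': "d_zbar q' z = (c' * of_nat n) * (z ^ m * cnj z ^ (n - 1)) + d_zbar q z" for z
    unfolding q'_def by (simp add: d_zbar_step[OF qs(1)])
  have "c * (z ^ Suc m * cnj z ^ n) = d_zbar (bdry q') z + s z" for z
  proof -
    have "d_zbar (bdry q') z + s z = d_zbar (bdry q) z + s z
        - z * (c' * (z ^ m * cnj z ^ n)) + defect z * ((c' * of_nat n) * (z ^ m * cnj z ^ (n - 1)))"
      unfolding d_zbar_defect_mult[OF q'] d_zbar_defect_mult[OF qs(1)] dq' by (simp add: q'_def algebra_simps)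
    also have "\<dots> = - z * (c' * (z ^ m * cnj z ^ n)) - of_nat n * c' * (z ^ Suc m * (cnj z * cnj z ^ (n - 1)))"
      unfolding qs(4)[symmetric] by (simp add: defect_def algebra_simps)
    \<comment> \<open>For n = 0 the exponents of \<open>cnj z\<close> differ, but both sides carry
      the factor \<open>of_nat n\<close>.\<close>
    also have "of_nat n * c' * (z ^ Suc m * (cnj z * cnj z ^ (n - 1))) = of_nat n * c' * (z ^ Suc m * cnj z ^ n)"
      by (cases n) auto
    also have "- z * (c' * (z ^ m * cnj z ^ n)) - of_nat n * c' * (z ^ Suc m * cnj z ^ n)
        = - (c' * (of_nat n + 1)) * (z ^ Suc m * cnj z ^ n)"
      by (simp add: algebra_simps)
    also have "- (c' * (of_nat n + 1)) = c" using n1 by (simp add: c'_def)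
    finally show ?thesis by simp
  qed
  then show ?case using q' qs(2,3) by blast
qed

lemma zpoly_decomposition:
  "zpoly p \<Longrightarrow> \<exists>q s. zpoly q \<and> zpoly s \<and> d_z s = (\<lambda>z. 0) \<and> (\<forall>z. p z = d_zbar (bdry q) z + s z)"
proof (induction rule: zpoly.induct)
  case zpoly_zero
  show ?case using monom_decomposition[of 0 0 0] by simp
next
  case (zpoly_step p c m n)
  obtain q s where 1: "zpoly q" "zpoly s" "d_z s = (\<lambda>z. 0)" "\<And>z. p z = d_zbar (bdry q) z + s z"
    using zpoly_step.IH by blast
  obtain q' s' where 2: "zpoly q'" "zpoly s'" "d_z s' = (\<lambda>z. 0)"
    "\<And>z. c * (z ^ m * cnj z ^ n) = d_zbar (bdry q') z + s' z"
    using monom_decomposition[of c m n] by blast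
  note w = differentiable_has_wirtinger[OF zpoly_differentiable]
  have "d_z (\<lambda>z. s' z + s z) = (\<lambda>z. 0)"
    using has_wirtinger_d_z[OF has_wirtinger_add[OF w[OF 2(2)] w[OF 1(2)]]] 1(3) 2(3) by (intro ext) simp
  moreover have "c * (z ^ m * cnj z ^ n) + p z = d_zbar (\<lambda>z. defect z * (q' z + q z)) z + (s' z + s z)" for z
    using has_wirtinger_d_zbar[OF has_wirtinger_add[OF w[OF zpoly_defect_mult[OF 2(1)]] w[OF zpoly_defect_mult[OF 1(1)]]], of z]
    unfolding 1(4) 2(4) by (simp add: distrib_left)
  ultimately show ?case
    using zpoly_add[OF 2(1) 1(1)] zpoly_add[OF 2(2) 1(2)] by blast
qed

lemma pairing_eq_sq_inner: "pairing u \<phi> = disc_inner u (\<lambda>z. cnj (\<phi> z))"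
  by (simp add: pairing_def sq_inner_def)

text \<open>The conjugate w of \<open>d_z \<phi>\<close> is a limit of functions
  \<open>d_zbar (bdry q)\<close>: a polynomial near w splits as v + s with s antiholomorphic, and
  since w and v are both orthogonal to s, dropping s does not increase the distance to w.\<close>

lemma orthogonal_imp_weakly_antiholomorphic:
  assumes g: "g \<in> disc_L2"
    and orth: "\<And>q. zpoly q \<Longrightarrow> disc_inner g (d_zbar (bdry q)) = 0"
    and \<phi>: "\<phi> \<in> test_functions"
  shows "pairing g (d_z \<phi>) = 0"
proof -
  define w where "w z = cnj (d_z \<phi> z)" for z
  have wc: "continuous_on S w" for S
    unfolding w_def by (intro continuous_intros test_continuous \<phi>)
  have w: "w \<in> disc_L2" by (intro sq_int_continuous wc)
  have ws: "disc_inner w s = 0" if "zpoly s" "d_z s = (\<lambda>z. 0)" for s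
  proof -
    have "0 = cnj (pairing s (d_z \<phi>))"
      using weak_d_z_zpoly[OF that(1) \<phi>] that(2) by (simp add: pairing_def)
    also have "\<dots> = (LINT z|disc_measure. cnj (s z * d_z \<phi> z))"
      by (simp add: pairing_def del: complex_cnj_mult)
    also have "\<dots> = disc_inner w s"
      by (simp add: sq_inner_def w_def mult.commute)
    finally show ?thesis by simp
  qed
  \<comment> \<open>\<open>cnj s\<close> is holomorphic and may be moved under the derivative, so
    the integrand is again \<open>d_zbar\<close> of a function \<open>bdry q\<close>, with integral
    zero.\<close>
  have es: "disc_inner (d_zbar (bdry q)) s = 0" if "zpoly q" "zpoly s" "d_z s = (\<lambda>z. 0)" for q s
  proof -
    have "d_zbar (bdry q) z * cnj (s z) = d_zbar (\<lambda>z. defect z * (q z * cnj (s z))) z" for z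
      using d_zbar_mult[OF zpoly_differentiable[OF zpoly_defect_mult[OF that(1)]] zpoly_differentiable[OF zpoly_cnj[OF that(2)]], of z]
        d_zbar_cnj[OF zpoly_differentiable[OF that(2)], of z] that(3)
      by (simp add: mult.assoc)
    then show ?thesis
      unfolding sq_inner_def using integral_d_zbar_defect_mult[OF zpoly_mult[OF that(1) zpoly_cnj[OF that(2)]]] by simp
  qed
  define C where "C = disc_norm (\<lambda>z. 1)"
  have "cmod (disc_inner g w) \<le> e" if e: "0 < e" for e
  proof -
    define d where "d = e / (disc_norm g * C + 1)"
    have gC: "0 \<le> disc_norm g * C" by (simp add: C_def)
    have d: "0 < d" using e gC by (simp add: d_def add_nonneg_pos)
    obtain p where p: "zpoly p" "\<And>z. z \<in> cball 0 1 \<Longrightarrow> cmod (w z - p z) < d"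
      using zpoly_dense[OF wc d] by blast
    obtain q s where qs: "zpoly q" "zpoly s" "d_z s = (\<lambda>z. 0)" "\<And>z. p z = d_zbar (bdry q) z + s z"
      using zpoly_decomposition[OF p(1)] by blast
    define v where "v = d_zbar (bdry q)"
    have v: "v \<in> disc_L2"
      unfolding v_def by (intro sq_int_zpoly zpoly_d_zbar zpoly_defect_mult qs(1))
    have s: "s \<in> disc_L2" by (intro sq_int_zpoly qs(2))
    have "disc_inner (\<lambda>z. w z - v z) s = 0"
      using ws[OF qs(2,3)] es[OF qs(1-3)] w v s by (simp add: sq_inner_diff_left v_def)
    then have "(disc_norm (\<lambda>z. w z - v z - s z))\<^sup>2 = (disc_norm (\<lambda>z. w z - v z))\<^sup>2 + (disc_norm s)\<^sup>2"
      using sq_norm_diff_power2[OF sq_int_diff[OF w v] s] by simp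
    moreover have "(\<lambda>z. w z - v z - s z) = (\<lambda>z. w z - p z)" by (auto simp: qs(4) v_def)
    ultimately have "(disc_norm (\<lambda>z. w z - v z))\<^sup>2 \<le> (disc_norm (\<lambda>z. w z - p z))\<^sup>2"
      by simp
    then have 1: "disc_norm (\<lambda>z. w z - v z) \<le> disc_norm (\<lambda>z. w z - p z)"
      by (rule power2_le_imp_le) simp
    have "disc_norm (\<lambda>z. w z - p z) \<le> d * C"
      unfolding C_def
    proof (rule sq_norm_mono_AE)
      show "(\<lambda>z. w z - p z) \<in> disc_borel"
        by (intro disc_measurable continuous_intros wc zpoly_continuous p(1))
      show "AE z in disc_measure. cmod (w z - p z) \<le> d * cmod 1"
        using p(2) by (intro disc_AE_I) (auto simp: unit_disc_def intro: less_imp_le)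
    qed (use d sq_int_const[OF finite_measure_disc] in auto)
    then have 2: "disc_norm (\<lambda>z. w z - v z) \<le> d * C" using 1 by simp
    have "disc_inner g w = disc_inner g (\<lambda>z. w z - v z)"
      using orth[OF qs(1)] w v g by (simp add: sq_inner_diff_right v_def)
    also have "cmod \<dots> \<le> disc_norm g * disc_norm (\<lambda>z. w z - v z)"
      using w v g by (intro sq_inner_le) auto
    also have "\<dots> \<le> disc_norm g * (d * C)"
      using 2 by (intro mult_left_mono) auto
    also have "\<dots> = e * ((disc_norm g * C) / (disc_norm g * C + 1))"
      by (simp add: d_def)
    also have "\<dots> \<le> e * 1"
      using e gC by (intro mult_left_mono) (auto simp: divide_le_eq)
    finally show ?thesis by simp
  qed
  then have "disc_inner g w = 0"
    using field_le_epsilon[of "cmod (disc_inner g w)" 0] by simp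
  then show ?thesis by (simp add: pairing_eq_sq_inner w_def[abs_def])
qed

section \<open>The operator \<open>T\<close> on coefficients\<close>

definition weakly_holomorphic :: "(complex \<Rightarrow> complex) set" where
  "weakly_holomorphic = {g \<in> disc_L2. \<forall>\<phi>\<in>test_functions. pairing g (d_zbar \<phi>) = 0}"

text \<open>The graph of the operator \<open>T\<close> on the coefficients: \<open>T (b dzbar) = t dz\<close> when \<open>t dz\<close> is the
  solution of \<open>delbar (t dz) = del (b dzbar)\<close> orthogonal to the kernel of \<open>delbar\<close>.\<close>
definition T_coeff :: "(complex \<Rightarrow> complex) \<Rightarrow> (complex \<Rightarrow> complex) \<Rightarrow> bool" where
  "T_coeff b t \<longleftrightarrow> b \<in> disc_L2 \<and> t \<in> disc_L2 \<and>
    (\<forall>\<phi>\<in>test_functions. pairing t (d_zbar \<phi>) = - pairing b (d_z \<phi>)) \<and>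
    (\<forall>g\<in>weakly_holomorphic. disc_inner g t = 0)"

lemma sq_inner_cong_AE:
  assumes "f \<in> borel_measurable M" "f' \<in> borel_measurable M" "g \<in> borel_measurable M" "g' \<in> borel_measurable M"
    and "AE x in M. f x = f' x" "AE x in M. g x = g' x"
  shows "sq_inner M f g = sq_inner M f' g'"
proof -
  have m: "(\<lambda>x. f x * cnj (g x)) \<in> borel_measurable M"
    if "f \<in> borel_measurable M" "g \<in> borel_measurable M" for f g :: "_ \<Rightarrow> complex"
    using that
    by (auto intro!: borel_measurable_times borel_measurable_continuous_on[OF continuous_on_cnj[OF continuous_on_id]])
  have "AE x in M. f x * cnj (g x) = f' x * cnj (g' x)"
    using assms(5,6) by eventually_elim simp
  then show ?thesis
    unfolding sq_inner_def by (intro integral_cong_AE m assms(1-4))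
qed

lemma pairing_sq_inner_d:
  "pairing u (d_z \<phi>) = disc_inner u (\<lambda>z. cnj (d_z \<phi> z))"
  "pairing u (d_zbar \<phi>) = disc_inner u (\<lambda>z. cnj (d_zbar \<phi> z))"
  by (simp_all add: pairing_def sq_inner_def)

lemma cnj_test_sq_int:
  assumes "\<phi> \<in> test_functions"
  shows "(\<lambda>z. cnj (d_z \<phi> z)) \<in> disc_L2" "(\<lambda>z. cnj (d_zbar \<phi> z)) \<in> disc_L2"
  by (intro sq_int_cnj test_sq_int assms)+

lemma cnj_defect: "cnj (defect z) = defect z"
  by (simp add: defect_def mult.commute)

lemma cnj_d_defect_mult:
  assumes "zpoly q"
  shows "cnj (d_z (bdry q) z) = d_zbar (\<lambda>z. defect z * cnj (q z)) z"
    "cnj (d_zbar (bdry q) z) = d_z (\<lambda>z. defect z * cnj (q z)) z"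
  using d_zbar_cnj[OF zpoly_differentiable[OF zpoly_defect_mult[OF assms]], of z]
    d_z_cnj[OF zpoly_differentiable[OF zpoly_defect_mult[OF assms]], of z]
  by (simp_all add: cnj_defect)

text \<open>The cutoff limit extends the weak equation from test functions to \<open>bdry\<close> of
  polynomials, here with weak derivative zero.\<close>

lemma weakly_holomorphic_orthogonal:
  assumes "g \<in> weakly_holomorphic" "zpoly q"
  shows "disc_inner g (d_z (bdry q)) = 0"
proof -
  have "(LINT z|disc_measure. (\<lambda>z. 0) z * (defect z * cnj (q z))) =
      - (LINT z|disc_measure. g z * d_zbar (\<lambda>z. defect z * cnj (q z)) z)"
    using assms
    by (intro weak_d_zbar_defect_mult zpoly_cnj) (auto simp: weakly_holomorphic_def pairing_def)
  then show ?thesis by (simp add: sq_inner_def cnj_d_defect_mult[OF assms(2)])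
qed

text \<open>Integration by parts turns both norms into the energy of \<open>bdry q\<close>.\<close>
lemma sq_norm_d_z_eq_d_zbar:
  assumes q: "zpoly q"
  shows "disc_norm (d_z (bdry q)) = disc_norm (d_zbar (bdry q))"
proof -
  have energy: "disc_inner (d_z (bdry q)) (d_z (bdry q)) =
      - (LINT z|disc_measure. d_zbar (d_z (bdry q)) z * cnj (defect z * q z))" if q: "zpoly q" for q
    using zpoly_parts[OF zpoly_d_z[OF zpoly_defect_mult[OF q]] zpoly_cnj[OF q]]
    by (simp add: sq_inner_def cnj_d_defect_mult[OF q] cnj_defect)
  \<comment> \<open>\<open>?v\<close> is the conjugate of \<open>?u\<close>: its energy is the
    conjugate of that of \<open>?u\<close>, while its z-derivative is the conjugate of the
    zbar-derivative of \<open>?u\<close>.\<close>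
  let ?u = "bdry q" and ?v = "\<lambda>z. defect z * cnj (q z)"
  have dz: "d_z ?v = (\<lambda>z. cnj (d_zbar ?u z))"
    using cnj_d_defect_mult(2)[OF q] by simp
  have u: "zpoly ?u" by (rule zpoly_defect_mult[OF q])
  have "d_zbar (d_z ?v) z = cnj (d_zbar (d_z ?u) z)" for z
    unfolding dz using d_zbar_cnj[OF zpoly_differentiable[OF zpoly_d_zbar[OF u]], of z] zpoly_d_z_d_zbar[OF u, of z]
    by simp
  then have "disc_inner (d_z ?v) (d_z ?v) =
      - (LINT z|disc_measure. cnj (d_zbar (d_z ?u) z * cnj (?u z)))"
    using energy[OF zpoly_cnj[OF q]] by (simp add: cnj_defect)
  also have "\<dots> = cnj (disc_inner (d_z ?u) (d_z ?u))"
    unfolding energy[OF q] Bochner_Integration.integral_cnj by simp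
  finally have "complex_of_real ((disc_norm (d_z ?v))\<^sup>2) = complex_of_real ((disc_norm (d_z ?u))\<^sup>2)"
    unfolding sq_inner_self by simp
  then have "(disc_norm (d_z ?v))\<^sup>2 = (disc_norm (d_z ?u))\<^sup>2"
    by (simp only: of_real_eq_iff)
  then have "disc_norm (d_z ?v) = disc_norm (d_z ?u)"
    by (rule power2_eq_imp_eq) simp_all
  moreover have "disc_norm (d_z ?v) = disc_norm (d_zbar ?u)"
    unfolding dz by (simp add: sq_norm_def)
  ultimately show ?thesis by simp
qed

text \<open>Mixed derivatives commute, so \<open>- d_z u\<close> solves the weak equation of
  \<open>T_coeff\<close> for the datum \<open>d_zbar u\<close>.\<close>

lemma pairing_d_z_d_zbar:
  assumes "zpoly u" "\<phi> \<in> test_functions"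
  shows "pairing (d_z u) (d_zbar \<phi>) = pairing (d_zbar u) (d_z \<phi>)"
proof -
  have "d_z (d_zbar u) = d_zbar (d_z u)"
    using zpoly_d_z_d_zbar[OF assms(1)] by blast
  then show ?thesis
    using weak_d_zbar_zpoly[OF zpoly_d_z[OF assms(1)] assms(2)] weak_d_z_zpoly[OF zpoly_d_zbar[OF assms(1)] assms(2)]
    by simp
qed

lemma T_coeff_diff:
  assumes "T_coeff b t" "T_coeff b' t'"
  shows "T_coeff (\<lambda>z. b z - b' z) (\<lambda>z. t z - t' z)"
  unfolding T_coeff_def
proof (intro conjI ballI)
  have s: "b \<in> disc_L2" "t \<in> disc_L2" "b' \<in> disc_L2" "t' \<in> disc_L2"
    using assms by (auto simp: T_coeff_def)
  show "(\<lambda>z. b z - b' z) \<in> disc_L2" "(\<lambda>z. t z - t' z) \<in> disc_L2"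
    using s by auto
  show "pairing (\<lambda>z. t z - t' z) (d_zbar \<phi>) = - pairing (\<lambda>z. b z - b' z) (d_z \<phi>)" if "\<phi> \<in> test_functions" for \<phi>
  proof -
    have "pairing t (d_zbar \<phi>) = - pairing b (d_z \<phi>)" "pairing t' (d_zbar \<phi>) = - pairing b' (d_z \<phi>)"
      using assms that by (auto simp: T_coeff_def)
    then show ?thesis
      unfolding pairing_sq_inner_d using s cnj_test_sq_int[OF that] by (simp add: sq_inner_diff_left)
  qed
  show "disc_inner g (\<lambda>z. t z - t' z) = 0" if "g \<in> weakly_holomorphic" for g
  proof -
    have "g \<in> disc_L2" using that by (simp add: weakly_holomorphic_def)
    then show ?thesis using assms s that by (simp add: sq_inner_diff_right T_coeff_def)
  qed
qed

text \<open>The difference of two images is weakly holomorphic and orthogonal to all weakly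
  holomorphic functions, hence to itself.\<close>

lemma T_coeff_unique:
  assumes "T_coeff b t" "T_coeff b t'"
  shows "AE z in disc_measure. t z = t' z"
proof -
  have "T_coeff (\<lambda>z. b z - b z) (\<lambda>z. t z - t' z)" by (rule T_coeff_diff[OF assms])
  then have i: "(\<lambda>z. t z - t' z) \<in> disc_L2" and
    w: "\<And>\<phi>. \<phi> \<in> test_functions \<Longrightarrow> pairing (\<lambda>z. t z - t' z) (d_zbar \<phi>) = 0" and
    o: "\<And>g. g \<in> weakly_holomorphic \<Longrightarrow> disc_inner g (\<lambda>z. t z - t' z) = 0"
    by (auto simp: T_coeff_def pairing_def)
  have "(\<lambda>z. t z - t' z) \<in> weakly_holomorphic"
    using i w by (simp add: weakly_holomorphic_def)
  then have "disc_norm (\<lambda>z. t z - t' z) = 0"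
    using o sq_inner_self[of disc_measure "\<lambda>z. t z - t' z"] by simp
  then show ?thesis using sq_norm_eq_0_iff[OF i] by simp
qed

text \<open>Both conditions are expressed by bounded functionals, so the graph is closed; this
  matches the closure taken in \<open>T_op\<close>.\<close>

lemma T_coeff_limit:
  assumes "\<And>n. T_coeff (b n) (t n)" and b': "b' \<in> disc_L2" and t': "t' \<in> disc_L2"
    and lim: "(\<lambda>n. disc_norm (\<lambda>z. b n z - b' z)) \<longlonglongrightarrow> 0"
      "(\<lambda>n. disc_norm (\<lambda>z. t n z - t' z)) \<longlonglongrightarrow> 0"
  shows "T_coeff b' t'"
  unfolding T_coeff_def
proof (intro conjI ballI b' t')
  have s: "b n \<in> disc_L2" "t n \<in> disc_L2" for n
    using assms(1)[of n] by (auto simp: T_coeff_def)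
  show "pairing t' (d_zbar \<phi>) = - pairing b' (d_z \<phi>)" if "\<phi> \<in> test_functions" for \<phi>
  proof -
    have 1: "(\<lambda>n. pairing (t n) (d_zbar \<phi>)) \<longlonglongrightarrow> pairing t' (d_zbar \<phi>)"
      unfolding pairing_sq_inner_d by (rule tendsto_sq_inner[OF s(2) t' cnj_test_sq_int(2)[OF that] lim(2)])
    have 2: "(\<lambda>n. - pairing (b n) (d_z \<phi>)) \<longlonglongrightarrow> - pairing b' (d_z \<phi>)"
      unfolding pairing_sq_inner_d by (intro tendsto_minus tendsto_sq_inner[OF s(1) b' cnj_test_sq_int(1)[OF that] lim(1)])
    have "pairing (t n) (d_zbar \<phi>) = - pairing (b n) (d_z \<phi>)" for n
      using assms(1)[of n] that by (simp add: T_coeff_def)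
    then show ?thesis using LIMSEQ_unique[OF 1] 2 by simp
  qed
  show "disc_inner g t' = 0" if "g \<in> weakly_holomorphic" for g
  proof -
    have g: "g \<in> disc_L2" using that by (simp add: weakly_holomorphic_def)
    have "(\<lambda>n. disc_inner (t n) g) \<longlonglongrightarrow> disc_inner t' g"
      by (rule tendsto_sq_inner[OF s(2) t' g lim(2)])
    moreover have "disc_inner (t n) g = 0" for n
      using assms(1)[of n] that sq_inner_commute[of disc_measure "t n" g] by (simp add: T_coeff_def)
    ultimately have "disc_inner t' g = 0" by (simp add: LIMSEQ_const_iff)
    then show ?thesis using sq_inner_commute[of disc_measure g t'] by simp
  qed
qed

text \<open>The functions \<open>d_zbar (bdry q)\<close> are dense in the orthogonal complement of the weakly
  antiholomorphic functions, and \<open>T\<close> maps them to \<open>- d_z (bdry q)\<close>.\<close>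
lemma T_coeff_exists:
  assumes b: "b \<in> disc_L2"
  obtains t q b0 where "T_coeff b t" "disc_norm t \<le> disc_norm b"
    "b0 \<in> disc_L2" "\<forall>\<phi>\<in>test_functions. pairing b0 (d_z \<phi>) = 0"
    "\<forall>n::nat. zpoly (q n)"
    "(\<lambda>n. disc_norm (\<lambda>z. (d_zbar (bdry (q n)) z + b0 z) - b z)) \<longlonglongrightarrow> 0"
    "(\<lambda>n. disc_norm (\<lambda>z. - d_z (bdry (q n)) z - t z)) \<longlonglongrightarrow> 0"
proof -
  let ?M = disc_measure
  define V where "V = {d_zbar (bdry q) | q. zpoly q}"
  have VI: "u \<in> V" if "zpoly q" "d_zbar (bdry q) = u" for q u
    unfolding V_def using that by blast
  have VM: "V \<subseteq> disc_L2"
    unfolding V_def by (auto intro!: sq_int_zpoly zpoly_d_zbar zpoly_defect_mult)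
  note w = differentiable_has_wirtinger[OF zpoly_differentiable[OF zpoly_defect_mult]]
  have Vadd: "(\<lambda>x. u x + v x) \<in> V" if uv: "u \<in> V" "v \<in> V" for u v
  proof -
    obtain q q' where q: "zpoly q" "u = d_zbar (bdry q)" "zpoly q'" "v = d_zbar (bdry q')"
      using uv unfolding V_def by blast
    have "d_zbar (\<lambda>z. defect z * (q z + q' z)) = (\<lambda>x. u x + v x)"
      unfolding q using has_wirtinger_d_zbar[OF has_wirtinger_add[OF w[OF q(1)] w[OF q(3)]]]
      by (simp add: distrib_left fun_eq_iff)
    then show ?thesis by (rule VI[OF zpoly_add[OF q(1,3)]])
  qed
  have Vscale: "(\<lambda>x. c * v x) \<in> V" if uv: "v \<in> V" for c v
  proof -
    obtain q where q: "zpoly q" "v = d_zbar (bdry q)"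
      using uv unfolding V_def by blast
    have "d_zbar (\<lambda>z. defect z * (c * q z)) = (\<lambda>x. c * v x)"
      unfolding q using has_wirtinger_d_zbar[OF has_wirtinger_mult[OF has_wirtinger_const[of c] w[OF q(1)]]]
      by (simp add: mult.left_commute fun_eq_iff)
    then show ?thesis by (rule VI[OF zpoly_scale[OF q(1)]])
  qed
  have Vne: "V \<noteq> {}" using VI[OF zpoly_zero refl] by blast
  obtain p v where p: "p \<in> disc_L2" "\<forall>n::nat. v n \<in> V" "(\<lambda>n. disc_norm (\<lambda>x. v n x - p x)) \<longlonglongrightarrow> 0"
    and orth: "\<forall>w\<in>V. disc_inner (\<lambda>x. b x - p x) w = 0"
    by (rule sq_int_projection[OF finite_measure_disc VM Vne Vadd Vscale b])
  have "\<exists>q. zpoly q \<and> v n = d_zbar (bdry q)" for n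
    using p(2) unfolding V_def by blast
  then obtain q where q: "\<And>n. zpoly (q n)" "\<And>n. v n = d_zbar (bdry (q n))"
    by metis
  have vs: "v n \<in> disc_L2" for n using p(2) VM by blast
  define b0 where "b0 z = b z - p z" for z
  have b0: "b0 \<in> disc_L2" unfolding b0_def using b p(1) by auto
  \<comment> \<open>The component of b orthogonal to V is weakly antiholomorphic, hence annihilated
    by T.\<close>
  have b0w: "pairing b0 (d_z \<phi>) = 0" if "\<phi> \<in> test_functions" for \<phi>
  proof (rule orthogonal_imp_weakly_antiholomorphic[OF b0 _ that])
    show "disc_inner b0 (d_zbar (bdry q)) = 0" if "zpoly q" for q
      unfolding b0_def[abs_def] by (rule orth[rule_format, OF VI[OF that refl]])
  qed
  define t' where "t' n z = - d_z (bdry (q n)) z" for n z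
  have t's: "t' n \<in> disc_L2" for n
    unfolding t'_def by (intro sq_int_uminus sq_int_zpoly zpoly_d_z zpoly_defect_mult q(1))
  have iso: "disc_norm (\<lambda>z. t' m z - t' n z) = disc_norm (\<lambda>z. v m z - v n z)" for m n
  proof -
    \<comment> \<open>The indices are exchanged because \<open>t'\<close> carries a minus
      sign.\<close>
    have qd: "zpoly (\<lambda>z. q n z + (-1) * q m z)"
      by (intro zpoly_add zpoly_scale q(1))
    have eq: "(\<lambda>z. defect z * (q n z + - 1 * q m z)) = (\<lambda>z. defect z * q n z + -1 * (defect z * q m z))"
      by (auto simp: algebra_simps)
    note hw = has_wirtinger_add[OF w[OF q(1)[of n]] has_wirtinger_mult[OF has_wirtinger_const[of "-1"] w[OF q(1)[of m]]]]
    have 1: "d_z (\<lambda>z. defect z * (q n z + (-1) * q m z)) = (\<lambda>z. t' m z - t' n z)"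
      unfolding eq t'_def using has_wirtinger_d_z[OF hw] by (auto simp: fun_eq_iff)
    have 2: "d_zbar (\<lambda>z. defect z * (q n z + (-1) * q m z)) = (\<lambda>z. v n z - v m z)"
      unfolding eq q(2) using has_wirtinger_d_zbar[OF hw] by (auto simp: fun_eq_iff)
    show ?thesis
      using sq_norm_d_z_eq_d_zbar[OF qd] unfolding 1 2 by (simp only: sq_norm_minus_commute[of ?M "v n"])
  qed
  have Cauchy: "\<exists>N. \<forall>m\<ge>N. \<forall>n\<ge>N. disc_norm (\<lambda>x. t' m x - t' n x) < e" if e: "0 < e" for e
  proof -
    obtain N where N: "\<And>n. N \<le> n \<Longrightarrow> disc_norm (\<lambda>x. v n x - p x) < e / 2"
      using LIMSEQ_D[OF p(3), of "e / 2"] e by auto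
    have "disc_norm (\<lambda>x. t' m x - t' n x) < e" if "N \<le> m" "N \<le> n" for m n
      using sq_norm_triangle_diff[OF vs[of m] p(1) vs[of n]] N[OF that(1)] N[OF that(2)]
        sq_norm_minus_commute[of ?M p "v n"] iso[of m n]
      by linarith
    then show ?thesis by blast
  qed
  obtain t where t: "t \<in> disc_L2" "(\<lambda>n. disc_norm (\<lambda>x. t' n x - t x)) \<longlonglongrightarrow> 0"
    by (rule sq_norm_complete[OF finite_measure_disc t's Cauchy])
  have "(\<lambda>z. (v n z + b0 z) - b z) = (\<lambda>z. v n z - p z)" for n
    by (auto simp: b0_def)
  then have lim: "(\<lambda>n. disc_norm (\<lambda>z. (v n z + b0 z) - b z)) \<longlonglongrightarrow> 0"
    using p(3) by simp
  \<comment> \<open>Adding b0 to every approximant leaves its image unchanged and makes the data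
    converge to b instead of its projection p.\<close>
  have Tn: "T_coeff (\<lambda>z. v n z + b0 z) (t' n)" for n
    unfolding T_coeff_def
  proof (intro conjI ballI t's sq_int_add vs b0)
    show "pairing (t' n) (d_zbar \<phi>) = - pairing (\<lambda>z. v n z + b0 z) (d_z \<phi>)" if "\<phi> \<in> test_functions" for \<phi>
    proof -
      have "pairing (\<lambda>z. v n z + b0 z) (d_z \<phi>) = pairing (v n) (d_z \<phi>) + pairing b0 (d_z \<phi>)"
        unfolding pairing_sq_inner_d by (rule sq_inner_add_left[OF vs b0 cnj_test_sq_int(1)[OF that]])
      then show ?thesis
        using pairing_d_z_d_zbar[OF zpoly_defect_mult[OF q(1)[of n]] that] b0w[OF that]
        by (simp add: q(2) pairing_def t'_def)
    qed
    show "disc_inner g (t' n) = 0" if "g \<in> weakly_holomorphic" for g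
      using weakly_holomorphic_orthogonal[OF that q(1)[of n]] unfolding sq_inner_def t'_def by simp
  qed
  have Tb: "T_coeff b t"
    by (rule T_coeff_limit[OF Tn b t(1) lim t(2)])
  have "disc_norm (t' n) = disc_norm (v n)" for n
    using sq_norm_d_z_eq_d_zbar[OF q(1)[of n]] unfolding q(2) t'_def sq_norm_def by simp
  then have "disc_norm t = disc_norm p"
    using LIMSEQ_unique[OF tendsto_sq_norm[OF t's t(1) t(2)]] tendsto_sq_norm[OF vs p(1) p(3)] by simp
  \<comment> \<open>As a limit of members of V, p is orthogonal to b0, and Pythagoras applies to b =
    p + b0.\<close>
  moreover have "disc_norm p \<le> disc_norm b"
  proof (rule power2_le_imp_le)
    have "(\<lambda>n. disc_inner (v n) b0) \<longlonglongrightarrow> disc_inner p b0"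
      by (rule tendsto_sq_inner[OF vs p(1) b0 p(3)])
    moreover have "disc_inner (v n) b0 = 0" for n
      using orth[rule_format, OF p(2)[rule_format, of n]] sq_inner_commute[of ?M "v n" b0] unfolding b0_def[abs_def] by simp
    ultimately have "disc_inner p b0 = 0" by (simp add: LIMSEQ_const_iff)
    then have "(disc_norm (\<lambda>z. p z + b0 z))\<^sup>2 = (disc_norm p)\<^sup>2 + (disc_norm b0)\<^sup>2"
      using sq_norm_add_power2[OF p(1) b0] by simp
    then show "(disc_norm p)\<^sup>2 \<le> (disc_norm b)\<^sup>2" by (simp add: b0_def)
  qed simp
  ultimately have norm_le: "disc_norm t \<le> disc_norm b" by simp
  show thesis
    by (rule that[OF Tb _ b0 _ _ lim[unfolded q(2)] t(2)[unfolded t'_def]]) (simp_all add: b0w q(1) norm_le)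
qed

lemma T_coeff_norm_le:
  assumes "T_coeff b t"
  shows "disc_norm t \<le> disc_norm b"
proof -
  have b: "b \<in> disc_L2" and t: "t \<in> disc_L2"
    using assms by (auto simp: T_coeff_def)
  obtain t' where t': "T_coeff b t'" "disc_norm t' \<le> disc_norm b"
    by (rule T_coeff_exists[OF b])
  have "disc_norm t = disc_norm t'"
    using T_coeff_unique[OF assms t'(1)] t t'(1)
    by (intro sq_norm_cong_AE) (auto simp: T_coeff_def sq_int_def)
  then show ?thesis using t'(2) by simp
qed

section \<open>The Hilbert space of forms\<close>

definition mk_form :: "(complex \<Rightarrow> complex) \<Rightarrow> (complex \<Rightarrow> complex) \<Rightarrow> (complex \<Rightarrow> complex) \<Rightarrow> (complex \<Rightarrow> complex) \<Rightarrow> form" where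
  "mk_form f a b w = (\<lambda>z. (f z, a z, b z, w z))"

abbreviation form01 :: "(complex \<Rightarrow> complex) \<Rightarrow> form" where
  "form01 b \<equiv> mk_form (\<lambda>z. 0) (\<lambda>z. 0) b (\<lambda>z. 0)"

abbreviation form00 :: "(complex \<Rightarrow> complex) \<Rightarrow> form" where
  "form00 f \<equiv> mk_form f (\<lambda>z. 0) (\<lambda>z. 0) (\<lambda>z. 0)"

abbreviation form11 :: "(complex \<Rightarrow> complex) \<Rightarrow> form" where
  "form11 w \<equiv> mk_form (\<lambda>z. 0) (\<lambda>z. 0) (\<lambda>z. 0) w"

lemma form10_eq: "form10 a = mk_form (\<lambda>z. 0) a (\<lambda>z. 0) (\<lambda>z. 0)"
  by (simp add: form10_def mk_form_def)

lemma components_mk_form [simp]: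
  "c00 (mk_form f a b w) = f" "c10 (mk_form f a b w) = a"
  "c01 (mk_form f a b w) = b" "c11 (mk_form f a b w) = w"
  by (simp_all add: mk_form_def c00_def c10_def c01_def c11_def fun_eq_iff)

lemma components_simps [simp]:
  "c00 (\<lambda>z. \<alpha> z + \<beta> z) = (\<lambda>z. c00 \<alpha> z + c00 \<beta> z)" "c10 (\<lambda>z. \<alpha> z + \<beta> z) = (\<lambda>z. c10 \<alpha> z + c10 \<beta> z)"
  "c01 (\<lambda>z. \<alpha> z + \<beta> z) = (\<lambda>z. c01 \<alpha> z + c01 \<beta> z)" "c11 (\<lambda>z. \<alpha> z + \<beta> z) = (\<lambda>z. c11 \<alpha> z + c11 \<beta> z)"
  "c00 (\<lambda>z. \<alpha> z - \<beta> z) = (\<lambda>z. c00 \<alpha> z - c00 \<beta> z)" "c10 (\<lambda>z. \<alpha> z - \<beta> z) = (\<lambda>z. c10 \<alpha> z - c10 \<beta> z)"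
  "c01 (\<lambda>z. \<alpha> z - \<beta> z) = (\<lambda>z. c01 \<alpha> z - c01 \<beta> z)" "c11 (\<lambda>z. \<alpha> z - \<beta> z) = (\<lambda>z. c11 \<alpha> z - c11 \<beta> z)"
  "c00 (\<lambda>z. 0) = (\<lambda>z. 0)" "c10 (\<lambda>z. 0) = (\<lambda>z. 0)" "c01 (\<lambda>z. 0) = (\<lambda>z. 0)" "c11 (\<lambda>z. 0) = (\<lambda>z. 0)"
  by (simp_all add: c00_def c10_def c01_def c11_def fun_eq_iff)

lemma mk_form_components: "mk_form (c00 \<alpha>) (c10 \<alpha>) (c01 \<alpha>) (c11 \<alpha>) = \<alpha>"
  by (simp add: mk_form_def c00_def c10_def c01_def c11_def fun_eq_iff)

text \<open>Scaled by the square root \<open>2 / (1 - \<bar>z\<bar>\<^sup>2)\<close> of the density, respectively its inverse, the coefficients of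
  \<open>1\<close> and \<open>dz \<and> dzbar\<close> become square integrable for the Lebesgue measure; for those of \<open>dz\<close> and \<open>dzbar\<close> no
  scaling is needed.\<close>
definition w00 :: "form \<Rightarrow> complex \<Rightarrow> complex" where
  "w00 \<alpha> z = of_real (2 / (1 - (cmod z)\<^sup>2)) * c00 \<alpha> z"

definition w11 :: "form \<Rightarrow> complex \<Rightarrow> complex" where
  "w11 \<alpha> z = of_real ((1 - (cmod z)\<^sup>2) / 2) * c11 \<alpha> z"

lemma weighted_simps [simp]:
  "w00 (\<lambda>z. \<alpha> z + \<beta> z) = (\<lambda>z. w00 \<alpha> z + w00 \<beta> z)" "w11 (\<lambda>z. \<alpha> z + \<beta> z) = (\<lambda>z. w11 \<alpha> z + w11 \<beta> z)"
  "w00 (\<lambda>z. \<alpha> z - \<beta> z) = (\<lambda>z. w00 \<alpha> z - w00 \<beta> z)" "w11 (\<lambda>z. \<alpha> z - \<beta> z) = (\<lambda>z. w11 \<alpha> z - w11 \<beta> z)"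
  "w00 (\<lambda>z. 0) = (\<lambda>z. 0)" "w11 (\<lambda>z. 0) = (\<lambda>z. 0)"
  "w00 (mk_form (\<lambda>z. 0) a b w) = (\<lambda>z. 0)" "w11 (mk_form f a b (\<lambda>z. 0)) = (\<lambda>z. 0)"
  by (simp_all add: w00_def w11_def fun_eq_iff distrib_left right_diff_distrib del: of_real_divide of_real_diff)

lemma w00_mk_form [simp]: "w00 (mk_form (c00 \<alpha>) a b w) = w00 \<alpha>"
  and w11_mk_form [simp]: "w11 (mk_form f a b (c11 \<alpha>)) = w11 \<alpha>"
  by (simp_all add: w00_def w11_def fun_eq_iff)

lemma w00_eq_0_iff: "z \<in> unit_disc \<Longrightarrow> w00 \<alpha> z = 0 \<longleftrightarrow> c00 \<alpha> z = 0"
  and w11_eq_0_iff: "z \<in> unit_disc \<Longrightarrow> w11 \<alpha> z = 0 \<longleftrightarrow> c11 \<alpha> z = 0"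
  using defect_pos[of z] by (auto simp: w00_def w11_def simp del: of_real_divide of_real_diff)

lemma sq_int_zero_mult [simp]: "sq_inner M (\<lambda>z. 0) g = 0" "sq_inner M g (\<lambda>z. 0) = 0"
  by (simp_all add: sq_inner_def)

lemma sq_norm_zero [simp]: "sq_norm M (\<lambda>z. 0) = 0"
  by (simp add: sq_norm_def)

text \<open>In degree one the density cancels against the metric and leaves 2; in type (1,1) it
  leaves (1 - |z|^2)^2, which is 4 times the squared weight of \<open>w11\<close>.\<close>

lemma density_herm:
  assumes "z \<in> unit_disc"
  shows "of_real (poincare_density z) * herm \<alpha> \<beta> z = w00 \<alpha> z * cnj (w00 \<beta> z)
    + 2 * (c10 \<alpha> z * cnj (c10 \<beta> z)) + 2 * (c01 \<alpha> z * cnj (c01 \<beta> z)) + 4 * (w11 \<alpha> z * cnj (w11 \<beta> z))"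
proof -
  define r where "r = 1 - (cmod z)\<^sup>2"
  have r: "r \<noteq> 0" using defect_pos[OF assms] by (simp add: r_def)
  have rho: "poincare_density z = 4 / r\<^sup>2" by (simp add: poincare_density_def r_def)
  have 1: "complex_of_real (4 / r\<^sup>2) * of_real (2 / (4 / r\<^sup>2)) = 2"
    using r unfolding of_real_mult[symmetric] by simp
  have 2: "complex_of_real (4 / r\<^sup>2) * of_real ((2 / (4 / r\<^sup>2))\<^sup>2) = of_real (r\<^sup>2)"
    using r unfolding of_real_mult[symmetric] of_real_eq_iff by (simp add: power2_eq_square field_simps)
  have 3: "complex_of_real (4 / r\<^sup>2) = of_real (2 / r) * of_real (2 / r)"
    unfolding of_real_mult[symmetric] by (simp add: power2_eq_square)
  have 4: "complex_of_real (r\<^sup>2) = 4 * (of_real (r / 2) * of_real (r / 2))"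
    by (simp add: power2_eq_square)
  have "of_real (poincare_density z) * herm \<alpha> \<beta> z =
      of_real (4 / r\<^sup>2) * (c00 \<alpha> z * cnj (c00 \<beta> z))
      + (of_real (4 / r\<^sup>2) * of_real (2 / (4 / r\<^sup>2))) * (c10 \<alpha> z * cnj (c10 \<beta> z) + c01 \<alpha> z * cnj (c01 \<beta> z))
      + (of_real (4 / r\<^sup>2) * of_real ((2 / (4 / r\<^sup>2))\<^sup>2)) * (c11 \<alpha> z * cnj (c11 \<beta> z))"
    unfolding herm_def rho by (simp only: distrib_left mult.assoc)
  also have "\<dots> = of_real (2 / r) * of_real (2 / r) * (c00 \<alpha> z * cnj (c00 \<beta> z))
      + 2 * (c10 \<alpha> z * cnj (c10 \<beta> z) + c01 \<alpha> z * cnj (c01 \<beta> z))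
      + 4 * (of_real (r / 2) * of_real (r / 2)) * (c11 \<alpha> z * cnj (c11 \<beta> z))"
    unfolding 1 2 unfolding 3 4 ..
  also have "\<dots> = w00 \<alpha> z * cnj (w00 \<beta> z)
    + 2 * (c10 \<alpha> z * cnj (c10 \<beta> z)) + 2 * (c01 \<alpha> z * cnj (c01 \<beta> z)) + 4 * (w11 \<alpha> z * cnj (w11 \<beta> z))"
    unfolding w00_def w11_def r_def[symmetric] complex_cnj_mult complex_cnj_complex_of_real by algebra
  finally show ?thesis .
qed

lemma form_measurable_iff:
  "\<alpha> \<in> borel_measurable disc_measure \<longleftrightarrow>
    c00 \<alpha> \<in> disc_borel \<and> c10 \<alpha> \<in> disc_borel \<and>
    c01 \<alpha> \<in> disc_borel \<and> c11 \<alpha> \<in> disc_borel"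
proof
  assume \<alpha>: "\<alpha> \<in> borel_measurable disc_measure"
  have c: "(\<lambda>z. f (\<alpha> z)) \<in> disc_borel" if "continuous_on UNIV f"
    for f :: "complex \<times> complex \<times> complex \<times> complex \<Rightarrow> complex"
    using borel_measurable_continuous_on[OF that \<alpha>] .
  show "c00 \<alpha> \<in> disc_borel \<and> c10 \<alpha> \<in> disc_borel \<and>
    c01 \<alpha> \<in> disc_borel \<and> c11 \<alpha> \<in> disc_borel"
    unfolding c00_def[abs_def] c10_def[abs_def] c01_def[abs_def] c11_def[abs_def]
    by (intro conjI c continuous_on_fst continuous_on_snd continuous_on_id)
next
  assume "c00 \<alpha> \<in> disc_borel \<and> c10 \<alpha> \<in> disc_borel \<and>
    c01 \<alpha> \<in> disc_borel \<and> c11 \<alpha> \<in> disc_borel"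
  then have "(\<lambda>z. (c00 \<alpha> z, c10 \<alpha> z, c01 \<alpha> z, c11 \<alpha> z)) \<in> borel_measurable disc_measure"
    by (intro borel_measurable_Pair) auto
  then show "\<alpha> \<in> borel_measurable disc_measure"
    using mk_form_components[of \<alpha>] by (simp add: mk_form_def)
qed

lemma weighted_measurable_iff:
  "w00 \<alpha> \<in> disc_borel \<longleftrightarrow> c00 \<alpha> \<in> disc_borel"
  "w11 \<alpha> \<in> disc_borel \<longleftrightarrow> c11 \<alpha> \<in> disc_borel"
proof -
  have nz: "1 - (cmod z)\<^sup>2 \<noteq> 0" if "z \<in> unit_disc" for z
    using defect_pos[OF that] by simp
  have 1: "(\<lambda>z. complex_of_real (2 / (1 - (cmod z)\<^sup>2))) \<in> disc_borel"
    using nz by (intro disc_measurable continuous_on_of_real continuous_on_divide continuous_on_diff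
        continuous_on_power continuous_on_norm continuous_on_id continuous_on_const) auto
  have 2: "(\<lambda>z. complex_of_real ((1 - (cmod z)\<^sup>2) / 2)) \<in> disc_borel"
    by (intro disc_measurable continuous_intros) auto
  have inv: "complex_of_real (2 / (1 - (cmod z)\<^sup>2)) * of_real ((1 - (cmod z)\<^sup>2) / 2) = 1" if "z \<in> unit_disc" for z
  proof -
    have "2 / (1 - (cmod z)\<^sup>2) * ((1 - (cmod z)\<^sup>2) / 2) = 1" using nz[OF that] by simp
    then show ?thesis by (simp only: of_real_mult[symmetric] of_real_1)
  qed
  have key: "(\<lambda>z. f z * c z) \<in> disc_borel \<longleftrightarrow> c \<in> disc_borel"
    if "f \<in> disc_borel" "g \<in> disc_borel" "\<And>z. z \<in> unit_disc \<Longrightarrow> g z * f z = 1"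
    for f g c :: "complex \<Rightarrow> complex"
  proof
    assume fc: "(\<lambda>z. f z * c z) \<in> disc_borel"
    have "(\<lambda>z. g z * (f z * c z)) \<in> disc_borel"
      by (rule borel_measurable_times[OF that(2) fc])
    moreover have "g z * (f z * c z) = c z" if "z \<in> space disc_measure" for z
    proof -
      have "g z * f z = 1" using that by (intro \<open>\<And>z. z \<in> unit_disc \<Longrightarrow> g z * f z = 1\<close>) simp
      then show ?thesis by (simp add: mult.assoc[symmetric])
    qed
    ultimately show "c \<in> disc_borel"
      using measurable_cong[of disc_measure "\<lambda>z. g z * (f z * c z)" c borel] by blast
  next
    assume "c \<in> disc_borel"
    then show "(\<lambda>z. f z * c z) \<in> disc_borel"
      by (intro borel_measurable_times that)
  qed
  show "w00 \<alpha> \<in> disc_borel \<longleftrightarrow> c00 \<alpha> \<in> disc_borel"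
    unfolding w00_def[abs_def] by (rule key[OF 1 2]) (simp only: inv mult.commute)
  show "w11 \<alpha> \<in> disc_borel \<longleftrightarrow> c11 \<alpha> \<in> disc_borel"
    unfolding w11_def[abs_def] by (rule key[OF 2 1]) (simp only: inv)
qed

text \<open>The integrand is a sum of nonnegative terms, so its integrability is that of each
  term.\<close>

lemma L2_forms_iff:
  "\<alpha> \<in> L2_forms \<longleftrightarrow> w00 \<alpha> \<in> disc_L2 \<and> c10 \<alpha> \<in> disc_L2 \<and>
    c01 \<alpha> \<in> disc_L2 \<and> w11 \<alpha> \<in> disc_L2"
proof -
  let ?M = disc_measure
  define S where "S z = (cmod (w00 \<alpha> z))\<^sup>2 + 2 * (cmod (c10 \<alpha> z))\<^sup>2 + 2 * (cmod (c01 \<alpha> z))\<^sup>2 + 4 * (cmod (w11 \<alpha> z))\<^sup>2" for z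
  have S: "of_real (poincare_density z) * herm \<alpha> \<alpha> z = of_real (S z)" if "z \<in> unit_disc" for z
    unfolding density_herm[OF that] complex_norm_square[symmetric] by (simp add: S_def)
  have eq: "integrable ?M (\<lambda>z. of_real (poincare_density z) * herm \<alpha> \<alpha> z) \<longleftrightarrow> integrable ?M S"
  proof -
    have "integrable ?M (\<lambda>z. of_real (poincare_density z) * herm \<alpha> \<alpha> z) \<longleftrightarrow> integrable ?M (\<lambda>z. complex_of_real (S z))"
      using S by (intro Bochner_Integration.integrable_cong) auto
    then show ?thesis by (simp only: complex_of_real_integrable_eq)
  qed
  show ?thesis
  proof
    assume "\<alpha> \<in> L2_forms"
    then have m: "\<alpha> \<in> borel_measurable disc_measure" and i: "integrable ?M S"
      unfolding eq[symmetric] by (simp_all add: L2_forms_def)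
    have "f \<in> disc_L2" if "f \<in> disc_borel" "\<And>z. (cmod (f z))\<^sup>2 \<le> S z" for f
    proof -
      have "integrable ?M (\<lambda>z. (cmod (f z))\<^sup>2)"
      proof (rule Bochner_Integration.integrable_bound[OF i])
        show "(\<lambda>z. (cmod (f z))\<^sup>2) \<in> borel_measurable ?M" using that(1) by measurable
        show "AE z in ?M. norm ((cmod (f z))\<^sup>2) \<le> norm (S z)"
          using order_trans[OF that(2) abs_ge_self] by (intro AE_I2) simp
      qed
      then show ?thesis using that(1) by (simp add: sq_int_def)
    qed
    then show "w00 \<alpha> \<in> disc_L2 \<and> c10 \<alpha> \<in> disc_L2 \<and> c01 \<alpha> \<in> disc_L2 \<and> w11 \<alpha> \<in> disc_L2"
      using m unfolding form_measurable_iff weighted_measurable_iff(1)[symmetric, of \<alpha>] weighted_measurable_iff(2)[symmetric, of \<alpha>]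
      by (simp add: S_def)
  next
    assume *: "w00 \<alpha> \<in> disc_L2 \<and> c10 \<alpha> \<in> disc_L2 \<and> c01 \<alpha> \<in> disc_L2 \<and> w11 \<alpha> \<in> disc_L2"
    then have "integrable ?M S"
      unfolding S_def by (intro Bochner_Integration.integrable_add integrable_mult_right sq_int_integrable) auto
    moreover have "\<alpha> \<in> borel_measurable disc_measure"
      using * unfolding form_measurable_iff weighted_measurable_iff(1)[symmetric, of \<alpha>] weighted_measurable_iff(2)[symmetric, of \<alpha>]
      by (simp add: sq_int_def)
    ultimately show "\<alpha> \<in> L2_forms" unfolding eq[symmetric] by (simp add: L2_forms_def)
  qed
qed

lemma L2_formsD:
  assumes "\<alpha> \<in> L2_forms"
  shows "w00 \<alpha> \<in> disc_L2" "c10 \<alpha> \<in> disc_L2"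
    "c01 \<alpha> \<in> disc_L2" "w11 \<alpha> \<in> disc_L2"
  using assms by (auto simp: L2_forms_iff)

lemma L2_forms_add: "\<alpha> \<in> L2_forms \<Longrightarrow> \<beta> \<in> L2_forms \<Longrightarrow> (\<lambda>z. \<alpha> z + \<beta> z) \<in> L2_forms"
  and L2_forms_diff: "\<alpha> \<in> L2_forms \<Longrightarrow> \<beta> \<in> L2_forms \<Longrightarrow> (\<lambda>z. \<alpha> z - \<beta> z) \<in> L2_forms"
  unfolding L2_forms_iff weighted_simps components_simps by (intro conjI sq_int_add sq_int_diff; simp)+

lemma L2_forms_zero [simp]: "(\<lambda>z. 0) \<in> L2_forms"
  by (simp add: L2_forms_iff)

lemma ip_eq:
  assumes "\<alpha> \<in> L2_forms" "\<beta> \<in> L2_forms"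
  shows "ip \<alpha> \<beta> = disc_inner (w00 \<alpha>) (w00 \<beta>) + 2 * disc_inner (c10 \<alpha>) (c10 \<beta>)
    + 2 * disc_inner (c01 \<alpha>) (c01 \<beta>) + 4 * disc_inner (w11 \<alpha>) (w11 \<beta>)"
proof -
  have "ip \<alpha> \<beta> = (LINT z|disc_measure. w00 \<alpha> z * cnj (w00 \<beta> z)
    + 2 * (c10 \<alpha> z * cnj (c10 \<beta> z)) + 2 * (c01 \<alpha> z * cnj (c01 \<beta> z)) + 4 * (w11 \<alpha> z * cnj (w11 \<beta> z)))"
    unfolding ip_def by (intro Bochner_Integration.integral_cong refl density_herm) simp
  also have "\<dots> = (LINT z|disc_measure. w00 \<alpha> z * cnj (w00 \<beta> z)) + (LINT z|disc_measure. 2 * (c10 \<alpha> z * cnj (c10 \<beta> z)))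
    + (LINT z|disc_measure. 2 * (c01 \<alpha> z * cnj (c01 \<beta> z))) + (LINT z|disc_measure. 4 * (w11 \<alpha> z * cnj (w11 \<beta> z)))"
    by (subst Bochner_Integration.integral_add;
        (intro Bochner_Integration.integrable_add integrable_mult_right sq_int_inner_integrable L2_formsD assms)?)+ (rule refl)
  finally show ?thesis by (simp add: sq_inner_def)
qed

lemma ip_zero [simp]: "\<alpha> \<in> L2_forms \<Longrightarrow> ip \<alpha> (\<lambda>z. 0) = 0" "\<alpha> \<in> L2_forms \<Longrightarrow> ip (\<lambda>z. 0) \<alpha> = 0"
  by (simp_all add: ip_eq)

lemma ip_commute: "\<alpha> \<in> L2_forms \<Longrightarrow> \<beta> \<in> L2_forms \<Longrightarrow> ip \<beta> \<alpha> = cnj (ip \<alpha> \<beta>)"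
  by (simp add: ip_eq sq_inner_commute[of _ "w00 \<beta>"] sq_inner_commute[of _ "c10 \<beta>"]
      sq_inner_commute[of _ "c01 \<beta>"] sq_inner_commute[of _ "w11 \<beta>"])

lemma ip_add_left:
  assumes "\<alpha> \<in> L2_forms" "\<beta> \<in> L2_forms" "\<gamma> \<in> L2_forms"
  shows "ip (\<lambda>z. \<alpha> z + \<beta> z) \<gamma> = ip \<alpha> \<gamma> + ip \<beta> \<gamma>"
  using assms L2_forms_add[OF assms(1,2)] by (simp add: ip_eq L2_formsD sq_inner_add_left algebra_simps)

lemma L2_norm_power2:
  assumes "\<alpha> \<in> L2_forms"
  shows "Re (ip \<alpha> \<alpha>) = (disc_norm (w00 \<alpha>))\<^sup>2 + 2 * (disc_norm (c10 \<alpha>))\<^sup>2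
    + 2 * (disc_norm (c01 \<alpha>))\<^sup>2 + 4 * (disc_norm (w11 \<alpha>))\<^sup>2"
  by (simp add: ip_eq[OF assms assms] sq_inner_self del: of_real_power)

lemma sq_norm_le_L2_norm:
  assumes "\<alpha> \<in> L2_forms"
  shows "disc_norm (w00 \<alpha>) \<le> L2_norm \<alpha>" "disc_norm (c10 \<alpha>) \<le> L2_norm \<alpha>"
    "disc_norm (c01 \<alpha>) \<le> L2_norm \<alpha>" "disc_norm (w11 \<alpha>) \<le> L2_norm \<alpha>"
  unfolding L2_norm_def L2_norm_power2[OF assms] by (intro real_le_rsqrt; simp)+

lemma ip_self_nonneg: "\<alpha> \<in> L2_forms \<Longrightarrow> 0 \<le> Re (ip \<alpha> \<alpha>)"
  by (simp add: L2_norm_power2)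

lemma components_AE_zero:
  assumes "\<alpha> \<in> L2_forms" "Re (ip \<alpha> \<alpha>) = 0"
  shows "AE z in disc_measure. w00 \<alpha> z = 0" "AE z in disc_measure. c10 \<alpha> z = 0"
    "AE z in disc_measure. c01 \<alpha> z = 0" "AE z in disc_measure. w11 \<alpha> z = 0"
proof -
  have "L2_norm \<alpha> = 0" by (simp add: L2_norm_def assms(2))
  then have "disc_norm (w00 \<alpha>) = 0" "disc_norm (c10 \<alpha>) = 0"
    "disc_norm (c01 \<alpha>) = 0" "disc_norm (w11 \<alpha>) = 0"
    using sq_norm_le_L2_norm[OF assms(1)] by (auto intro: order_antisym)
  then show "AE z in disc_measure. w00 \<alpha> z = 0" "AE z in disc_measure. c10 \<alpha> z = 0"
    "AE z in disc_measure. c01 \<alpha> z = 0" "AE z in disc_measure. w11 \<alpha> z = 0"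
    using sq_norm_eq_0_iff[OF L2_formsD(1)[OF assms(1)]] sq_norm_eq_0_iff[OF L2_formsD(2)[OF assms(1)]]
      sq_norm_eq_0_iff[OF L2_formsD(3)[OF assms(1)]] sq_norm_eq_0_iff[OF L2_formsD(4)[OF assms(1)]] by simp_all
qed

lemma orthogonal_zpoly_AE_zero:
  assumes "f \<in> disc_L2" "\<And>p. zpoly p \<Longrightarrow> disc_inner p f = 0"
  shows "AE z in disc_measure. f z = 0"
proof -
  have "AE z in disc_measure. cnj (f z) = 0"
  proof (rule moments_zero_imp_AE_zero)
    show "integrable disc_measure (\<lambda>z. cnj (f z))"
      by (intro sq_int_integrable1 finite_measure_disc sq_int_cnj assms(1))
    show "(LINT z|disc_measure. cnj (f z) * p z) = 0" if "zpoly p" for p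
      using assms(2)[OF that] by (simp add: sq_inner_def mult.commute)
  qed
  then show ?thesis by simp
qed

text \<open>With f viewed as weak derivative of zero, the test extends to \<open>bdry\<close> of
  polynomials; all moments of \<open>defect * f\<close> vanish, and \<open>defect\<close> has no
  zero in the disc.\<close>

lemma weakly_zero_AE_zero:
  assumes "f \<in> disc_L2" "\<And>\<phi>. \<phi> \<in> test_functions \<Longrightarrow> pairing f \<phi> = 0"
  shows "AE z in disc_measure. f z = 0"
proof -
  have rf: "(\<lambda>z. defect z * f z) \<in> disc_L2"
    by (rule zpoly_mult_sq_int[OF zpoly_defect assms(1)])
  have "AE z in disc_measure. defect z * f z = 0"
  proof (rule moments_zero_imp_AE_zero)
    show "integrable disc_measure (\<lambda>z. defect z * f z)"
      by (rule sq_int_integrable1[OF finite_measure_disc rf])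
    show "(LINT z|disc_measure. defect z * f z * p z) = 0" if "zpoly p" for p
    proof -
      have "(LINT z|disc_measure. f z * (defect z * p z)) = - (LINT z|disc_measure. (\<lambda>z. 0) z * d_zbar (bdry p) z)"
      proof (rule weak_d_zbar_defect_mult[OF sq_int_zero _ rf _ that])
        show "f \<in> disc_borel" using assms(1) by (simp add: sq_int_def)
        show "pairing f \<phi> = - pairing (\<lambda>z. 0) (d_zbar \<phi>)" if "\<phi> \<in> test_functions" for \<phi>
          using assms(2)[OF that] by (simp add: pairing_def)
      qed
      then show ?thesis by (simp add: mult_ac)
    qed
  qed
  moreover have "AE z in disc_measure. defect z \<noteq> 0"
    by (intro disc_AE_I defect_nonzero)
  ultimately show ?thesis by eventually_elim simp
qed

section \<open>Harmonic forms\<close>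

lemma pairing_zero [simp]: "pairing (\<lambda>z. 0) \<phi> = 0"
  by (simp add: pairing_def)

lemma delbar_op_iff:
  "(\<alpha>, \<beta>) \<in> delbar_op \<longleftrightarrow> \<alpha> \<in> L2_forms \<and> \<beta> \<in> L2_forms \<and>
    (\<forall>\<phi>\<in>test_functions. pairing (c00 \<beta>) \<phi> = 0 \<and> pairing (c10 \<beta>) \<phi> = 0 \<and>
      pairing (c01 \<beta>) \<phi> = - pairing (c00 \<alpha>) (d_zbar \<phi>) \<and> pairing (c11 \<beta>) \<phi> = pairing (c10 \<alpha>) (d_zbar \<phi>))"
  by (simp add: delbar_op_def dist_of_def delbar_dist_def)

lemma del_op_iff:
  "(\<alpha>, \<beta>) \<in> del_op \<longleftrightarrow> \<alpha> \<in> L2_forms \<and> \<beta> \<in> L2_forms \<and>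
    (\<forall>\<phi>\<in>test_functions. pairing (c00 \<beta>) \<phi> = 0 \<and> pairing (c10 \<beta>) \<phi> = - pairing (c00 \<alpha>) (d_z \<phi>) \<and>
      pairing (c01 \<beta>) \<phi> = 0 \<and> pairing (c11 \<beta>) \<phi> = - pairing (c01 \<alpha>) (d_z \<phi>))"
  by (simp add: del_op_def dist_of_def del_dist_def)

lemma adj_iff:
  "(\<omega>, v) \<in> adj A \<longleftrightarrow> \<omega> \<in> L2_forms \<and> v \<in> L2_forms \<and> (\<forall>\<xi> \<eta>. (\<xi>, \<eta>) \<in> A \<longrightarrow> ip \<eta> \<omega> = ip \<xi> v)"
  by (auto simp: adj_def)

text \<open>\<open>delbar\<close> maps type (1,0) to (1,1) and type (0,0) to (0,1), so each part can
  be tested alone in the adjoint relation.\<close>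

lemma delbar_components:
  assumes "(\<alpha>, \<beta>) \<in> delbar_op"
  shows "(form10 (c10 \<alpha>), form11 (c11 \<beta>)) \<in> delbar_op" "(form00 (c00 \<alpha>), form01 (c01 \<beta>)) \<in> delbar_op"
  using assms by (simp_all add: delbar_op_iff L2_forms_iff form10_eq)

lemma L2_form10: "form10 a \<in> L2_forms \<longleftrightarrow> a \<in> disc_L2"
  and L2_form01: "form01 b \<in> L2_forms \<longleftrightarrow> b \<in> disc_L2"
  and L2_form00: "form00 f \<in> L2_forms \<longleftrightarrow> w00 (form00 f) \<in> disc_L2"
  and L2_form11: "form11 w \<in> L2_forms \<longleftrightarrow> w11 (form11 w) \<in> disc_L2"
  by (simp_all add: L2_forms_iff form10_eq)

lemma w11_continuous: "continuous_on (cball 0 1) w \<Longrightarrow> w11 (form11 w) \<in> disc_L2"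
  unfolding w11_def[abs_def] components_mk_form by (intro sq_int_continuous continuous_intros) auto

text \<open>The weight cancels the boundary factor: weighted coefficients are plain polynomials, to
  which density arguments apply.\<close>

lemma w00_defect:
  assumes "z \<in> unit_disc"
  shows "w00 (form00 (bdry p)) z = 2 * p z"
proof -
  have "2 / t * t = 2" if "0 < t" for t :: real using that by simp
  from this[OF defect_pos[OF assms]] have "complex_of_real (2 / (1 - (cmod z)\<^sup>2)) * defect z = 2"
    unfolding defect_eq of_real_mult[symmetric] by (simp only: of_real_numeral)
  then show ?thesis by (simp add: w00_def mult.assoc[symmetric] del: of_real_divide of_real_diff)
qed

lemma w11_defect:
  assumes "z \<in> unit_disc"
  shows "w11 (form11 (\<lambda>z. - 2 * p z / defect z)) z = - p z"
proof -
  have "defect z \<noteq> 0" by (rule defect_nonzero[OF assms])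
  then have "defect z / 2 * (- 2 * p z / defect z) = - p z" by simp
  moreover have "complex_of_real ((1 - (cmod z)\<^sup>2) / 2) = defect z / 2"
    by (simp add: defect_eq)
  ultimately show ?thesis by (simp only: w11_def components_mk_form)
qed

lemma sq_int_cong:
  assumes "g \<in> disc_L2" "\<And>z. z \<in> unit_disc \<Longrightarrow> f z = g z"
  shows "f \<in> disc_L2"
proof -
  have "f \<in> disc_borel"
    using assms measurable_cong[of disc_measure f g borel] by (simp add: sq_int_def)
  then show ?thesis
    using assms(2) by (intro sq_int_bound[OF assms(1), of _ 1]) auto
qed

lemma sq_inner_cong:
  assumes "\<And>z. z \<in> unit_disc \<Longrightarrow> f z = f' z" "\<And>z. z \<in> unit_disc \<Longrightarrow> g z = g' z"
  shows "disc_inner f g = disc_inner f' g'"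
  unfolding sq_inner_def using assms by (intro Bochner_Integration.integral_cong) auto

lemma sq_inner_AE_zero:
  assumes "f \<in> sq_int M" "g \<in> sq_int M" "AE x in M. g x = 0"
  shows "sq_inner M f g = 0"
proof -
  have "sq_norm M g = 0" using assms sq_norm_eq_0_iff by blast
  then show ?thesis using sq_inner_le[OF assms(1,2)] by simp
qed

text \<open>The minus sign comes from exchanging dzbar and dz in the wedge product.\<close>

lemma delbar_zpoly:
  assumes p: "zpoly p"
  shows "(form10 p, form11 (\<lambda>z. - d_zbar p z)) \<in> delbar_op"
  unfolding delbar_op_iff L2_form10 L2_form11
proof (intro conjI ballI)
  show "p \<in> disc_L2" by (rule sq_int_zpoly[OF p])
  show "w11 (form11 (\<lambda>z. - d_zbar p z)) \<in> disc_L2"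
    by (intro w11_continuous continuous_intros zpoly_continuous zpoly_d_zbar p)
  fix \<phi> assume "\<phi> \<in> test_functions"
  then show "pairing (c11 (form11 (\<lambda>z. - d_zbar p z))) \<phi> = pairing (c10 (form10 p)) (d_zbar \<phi>)"
    using weak_d_zbar_zpoly[OF p] by (simp add: form10_eq pairing_def)
qed (simp_all add: form10_eq)

lemma delbar_defect_zpoly:
  assumes p: "zpoly p"
  shows "(form00 (bdry p), form01 (d_zbar (bdry p))) \<in> delbar_op"
  unfolding delbar_op_iff L2_form01 L2_form00
proof (intro conjI ballI)
  show "w00 (form00 (bdry p)) \<in> disc_L2"
    by (rule sq_int_cong[OF sq_int_scale[OF sq_int_zpoly[OF p], of 2] w00_defect[of _ p]])
  show "d_zbar (bdry p) \<in> disc_L2"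
    by (intro sq_int_zpoly zpoly_d_zbar zpoly_defect_mult p)
  fix \<phi> assume "\<phi> \<in> test_functions"
  then show "pairing (c01 (form01 (d_zbar (bdry p)))) \<phi> = - pairing (c00 (form00 (bdry p))) (d_zbar \<phi>)"
    using weak_d_zbar_zpoly[OF zpoly_defect_mult[OF p]] by simp
qed simp_all

lemma delbar_kernel:
  "g \<in> disc_L2 \<Longrightarrow> (form01 g, \<lambda>z. 0) \<in> delbar_op"
  "form11 w \<in> L2_forms \<Longrightarrow> (form11 w, \<lambda>z. 0) \<in> delbar_op"
  "g \<in> weakly_holomorphic \<Longrightarrow> (form10 g, \<lambda>z. 0) \<in> delbar_op"
  "((\<lambda>z. 0), \<lambda>z. 0) \<in> delbar_op"
  by (simp_all add: delbar_op_iff L2_form01 L2_form10 weakly_holomorphic_def form10_eq L2_forms_iff)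

section \<open>The adjoint of \<open>delbar\<close>\<close>

lemma zero_adj: "((\<lambda>z. 0), \<lambda>z. 0) \<in> adj delbar_op"
  by (simp add: adj_iff delbar_op_iff)

lemma ip_form10: "a \<in> disc_L2 \<Longrightarrow> \<beta> \<in> L2_forms \<Longrightarrow> ip (form10 a) \<beta> = 2 * disc_inner a (c10 \<beta>)"
  and ip_form01: "b \<in> disc_L2 \<Longrightarrow> \<beta> \<in> L2_forms \<Longrightarrow> ip (form01 b) \<beta> = 2 * disc_inner b (c01 \<beta>)"
  and ip_form00: "form00 f \<in> L2_forms \<Longrightarrow> \<beta> \<in> L2_forms \<Longrightarrow> ip (form00 f) \<beta> = disc_inner (w00 (form00 f)) (w00 \<beta>)"
  and ip_form11: "form11 w \<in> L2_forms \<Longrightarrow> \<beta> \<in> L2_forms \<Longrightarrow> ip (form11 w) \<beta> = 4 * disc_inner (w11 (form11 w)) (w11 \<beta>)"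
  using L2_form10[of a] L2_form01[of b] by (simp_all add: ip_eq, simp_all add: form10_eq)

lemma AE_zero_if_sq_inner_self: "f \<in> sq_int M \<Longrightarrow> sq_inner M f f = 0 \<Longrightarrow> AE x in M. f x = 0"
  by (simp add: sq_inner_self sq_norm_eq_0_iff del: of_real_power)

text \<open>Images under the adjoint are orthogonal to the kernel of \<open>delbar\<close>, which
  contains all L2 forms of types (0,1) and (1,1) and the weakly holomorphic ones of type
  (1,0).\<close>

lemma adj_delbar_components:
  assumes "(\<omega>, v) \<in> adj delbar_op"
  shows "AE z in disc_measure. c01 v z = 0" "AE z in disc_measure. w11 v z = 0"
    "\<And>g. g \<in> weakly_holomorphic \<Longrightarrow> disc_inner g (c10 v) = 0"
proof -
  have L: "\<omega> \<in> L2_forms" "v \<in> L2_forms" and a: "\<And>\<xi> \<eta>. (\<xi>, \<eta>) \<in> delbar_op \<Longrightarrow> ip \<eta> \<omega> = ip \<xi> v"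
    using assms by (auto simp: adj_iff)
  note s = L2_formsD[OF L(2)]
  have "ip (form01 (c01 v)) v = 0"
    using a[OF delbar_kernel(1)[OF s(3)]] L(1) by simp
  then show "AE z in disc_measure. c01 v z = 0"
    using ip_form01[OF s(3) L(2)] s(3) by (intro AE_zero_if_sq_inner_self) auto
  have w: "form11 (c11 v) \<in> L2_forms" using s(4) by (simp add: L2_form11)
  have "ip (form11 (c11 v)) v = 0"
    using a[OF delbar_kernel(2)[OF w]] L(1) by simp
  then show "AE z in disc_measure. w11 v z = 0"
    using ip_form11[OF w L(2)] s(4) by (intro AE_zero_if_sq_inner_self) auto
  show "disc_inner g (c10 v) = 0" if "g \<in> weakly_holomorphic" for g
  proof -
    have "g \<in> disc_L2" using that by (simp add: weakly_holomorphic_def)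
    then show ?thesis
      using a[OF delbar_kernel(3)[OF that]] L(1) ip_form10[OF _ L(2)] by simp
  qed
qed

text \<open>The adjoint is single-valued up to null sets because \<open>delbar\<close> is densely
  defined: polynomials in type (1,0) and \<open>bdry\<close> of polynomials in type (0,0)
  suffice.\<close>

lemma adj_delbar_unique:
  assumes "(\<omega>, v) \<in> adj delbar_op" "(\<omega>, y) \<in> adj delbar_op"
  shows "AE z in disc_measure. c10 v z = c10 y z" "AE z in disc_measure. w00 v z = w00 y z"
proof -
  have L: "v \<in> L2_forms" "y \<in> L2_forms"
    and a: "\<And>\<xi> \<eta>. (\<xi>, \<eta>) \<in> delbar_op \<Longrightarrow> ip \<xi> v = ip \<xi> y"
    using assms unfolding adj_iff by metis+
  note s = L2_formsD[OF L(1)] and s' = L2_formsD[OF L(2)]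
  have "AE z in disc_measure. c10 v z - c10 y z = 0"
  proof (rule orthogonal_zpoly_AE_zero)
    show "disc_inner p (\<lambda>z. c10 v z - c10 y z) = 0" if "zpoly p" for p
      using a[OF delbar_zpoly[OF that]] sq_int_zpoly[OF that] s(2) s'(2) L
      by (simp add: ip_form10 sq_inner_diff_right)
  qed (use s s' in auto)
  then show "AE z in disc_measure. c10 v z = c10 y z" by simp
  have "AE z in disc_measure. w00 v z - w00 y z = 0"
  proof (rule orthogonal_zpoly_AE_zero)
    show "disc_inner p (\<lambda>z. w00 v z - w00 y z) = 0" if "zpoly p" for p
    proof -
      have f: "form00 (bdry p) \<in> L2_forms"
        using delbar_defect_zpoly[OF that] by (simp add: delbar_op_iff)
      have w: "disc_inner (w00 (form00 (bdry p))) g = 2 * disc_inner p g" for g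
        using sq_inner_cong[OF w00_defect[of _ p] refl[of "g _"]] sq_inner_scale_left[of disc_measure 2 p g] by simp
      show ?thesis
        using a[OF delbar_defect_zpoly[OF that]] sq_int_zpoly[OF that] s(1) s'(1) L
        by (simp add: ip_form00[OF f] w sq_inner_diff_right)
    qed
  qed (use s s' in auto)
  then show "AE z in disc_measure. w00 v z = w00 y z" by simp
qed

lemma adj_delbar_defect:
  assumes q: "zpoly q"
  shows "(form11 (\<lambda>z. - 2 * q z / defect z), form10 (\<lambda>z. - d_z (bdry q) z)) \<in> adj delbar_op"
  unfolding adj_iff
proof (intro conjI allI impI)
  have t: "(\<lambda>z. - d_z (bdry q) z) \<in> disc_L2"
    by (intro sq_int_uminus sq_int_zpoly zpoly_d_z zpoly_defect_mult q)
  show w: "form11 (\<lambda>z. - 2 * q z / defect z) \<in> L2_forms"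
    unfolding L2_form11 by (rule sq_int_cong[OF sq_int_uminus[OF sq_int_zpoly[OF q]] w11_defect[of _ q]])
  show t': "form10 (\<lambda>z. - d_z (bdry q) z) \<in> L2_forms"
    using t by (simp add: L2_form10)
  fix \<xi> \<zeta> assume d: "(\<xi>, \<zeta>) \<in> delbar_op"
  then have L: "\<xi> \<in> L2_forms" "\<zeta> \<in> L2_forms" by (auto simp: delbar_op_iff)
  have w11eq: "w11 \<zeta> z = defect z / 2 * c11 \<zeta> z" for z
    by (simp add: w11_def defect_eq)
  \<comment> \<open>The weak form of delbar \<open>\<xi>\<close> = \<open>\<zeta>\<close>, tested
    against \<open>bdry\<close> of the conjugate of q. L2 membership of \<open>\<zeta>\<close>
    controls only \<open>defect * c11 \<zeta>\<close>, which is what the cutoff lemma asks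
    for.\<close>
  have "(LINT z|disc_measure. - c11 \<zeta> z * (defect z * cnj (q z))) =
      - (LINT z|disc_measure. c10 \<xi> z * d_zbar (\<lambda>z. defect z * cnj (q z)) z)"
  proof (rule weak_d_zbar_defect_mult[OF _ _ _ _ zpoly_cnj[OF q]])
    show "c10 \<xi> \<in> disc_L2" using L2_formsD[OF L(1)] by simp
    show "(\<lambda>z. defect z * - c11 \<zeta> z) \<in> disc_L2"
      using sq_int_scale[OF L2_formsD(4)[OF L(2)], of "-2"] by (simp add: w11eq)
    have "w11 \<zeta> \<in> disc_borel"
      using L2_formsD(4)[OF L(2)] by (simp add: sq_int_def)
    then show "(\<lambda>z. - c11 \<zeta> z) \<in> disc_borel"
      unfolding weighted_measurable_iff by (rule borel_measurable_uminus)
    show "pairing (\<lambda>z. - c11 \<zeta> z) \<phi> = - pairing (c10 \<xi>) (d_zbar \<phi>)" if "\<phi> \<in> test_functions" for \<phi>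
      using d that by (simp add: delbar_op_iff pairing_def)
  qed
  then have key: "(LINT z|disc_measure. c11 \<zeta> z * (defect z * cnj (q z))) = disc_inner (c10 \<xi>) (d_z (bdry q))"
    by (simp add: sq_inner_def cnj_d_defect_mult[OF q])
  have "ip \<zeta> (form11 (\<lambda>z. - 2 * q z / defect z)) = 4 * disc_inner (w11 \<zeta>) (w11 (form11 (\<lambda>z. - 2 * q z / defect z)))"
    using ip_eq[OF L(2) w] by simp
  also have "disc_inner (w11 \<zeta>) (w11 (form11 (\<lambda>z. - 2 * q z / defect z))) = disc_inner (w11 \<zeta>) (\<lambda>z. - q z)"
    by (rule sq_inner_cong[OF refl w11_defect[of _ q]])
  also have "\<dots> = (LINT z|disc_measure. - (1/2) * (c11 \<zeta> z * (defect z * cnj (q z))))"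
    unfolding sq_inner_def w11eq by (intro Bochner_Integration.integral_cong) auto
  also have "\<dots> = - (1/2) * disc_inner (c10 \<xi>) (d_z (bdry q))"
    by (simp only: integral_mult_right_zero key)
  finally have "ip \<zeta> (form11 (\<lambda>z. - 2 * q z / defect z)) = - 2 * disc_inner (c10 \<xi>) (d_z (bdry q))"
    by simp
  moreover have "ip \<xi> (form10 (\<lambda>z. - d_z (bdry q) z)) = 2 * disc_inner (c10 \<xi>) (\<lambda>z. - d_z (bdry q) z)"
    using ip_eq[OF L(1) t'] by (simp add: form10_eq)
  ultimately show "ip \<zeta> (form11 (\<lambda>z. - 2 * q z / defect z)) = ip \<xi> (form10 (\<lambda>z. - d_z (bdry q) z))"
    by (simp add: sq_inner_def)
qed

section \<open>The box operator and harmonic forms\<close>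

lemma box_opD:
  assumes "(\<omega>, \<psi>) \<in> box_op"
  obtains v \<kappa> \<tau> \<sigma> where "(\<omega>, v) \<in> adj delbar_op" "(v, \<kappa>) \<in> delbar_op"
    "(\<omega>, \<tau>) \<in> delbar_op" "(\<tau>, \<sigma>) \<in> adj delbar_op" "\<psi> = (\<lambda>z. \<kappa> z + \<sigma> z)"
  using assms unfolding box_op_def op_add_def by blast

lemma box_opI:
  assumes "(\<omega>, v) \<in> adj delbar_op" "(v, \<kappa>) \<in> delbar_op" "(\<omega>, \<tau>) \<in> delbar_op" "(\<tau>, \<sigma>) \<in> adj delbar_op"
  shows "(\<omega>, \<lambda>z. \<kappa> z + \<sigma> z) \<in> box_op"
  using assms unfolding box_op_def op_add_def by blast

text \<open>Pairing box \<open>\<eta>\<close> = 0 with \<open>\<eta>\<close> gives a sum of the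
  squared norms of delbar^* \<open>\<eta>\<close> and delbar \<open>\<eta>\<close>, so each of them
  vanishes.\<close>

lemma harmonicD:
  assumes "\<eta> \<in> harmonic"
  obtains v where "(\<eta>, v) \<in> adj delbar_op"
    "AE z in disc_measure. w00 v z = 0" "AE z in disc_measure. c10 v z = 0"
proof -
  obtain v \<kappa> \<tau> \<sigma> where b: "(\<eta>, v) \<in> adj delbar_op" "(v, \<kappa>) \<in> delbar_op"
    "(\<eta>, \<tau>) \<in> delbar_op" "(\<tau>, \<sigma>) \<in> adj delbar_op" "(\<lambda>z. 0) = (\<lambda>z. \<kappa> z + \<sigma> z)"
    using assms unfolding harmonic_def by (auto elim: box_opD)
  have L: "\<eta> \<in> L2_forms" "v \<in> L2_forms" "\<kappa> \<in> L2_forms" "\<tau> \<in> L2_forms" "\<sigma> \<in> L2_forms"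
    using b by (auto simp: adj_iff delbar_op_iff)
  have "ip \<kappa> \<eta> = ip v v" using b(1,2) by (auto simp: adj_iff)
  moreover have "ip \<tau> \<tau> = ip \<eta> \<sigma>" using b(3,4) by (auto simp: adj_iff)
  moreover have "ip \<kappa> \<eta> + ip \<sigma> \<eta> = 0"
    using ip_add_left[OF L(3,5,1)] L(1) unfolding b(5)[symmetric] by simp
  ultimately have "ip v v + cnj (ip \<tau> \<tau>) = 0"
    using ip_commute[OF L(1,5)] by simp
  then have "Re (ip v v) + Re (ip \<tau> \<tau>) = 0"
    by (metis cnj.simps(1) plus_complex.simps(1) zero_complex.simps(1))
  then have "Re (ip v v) = 0"
    using ip_self_nonneg[OF L(2)] ip_self_nonneg[OF L(4)] by linarith
  then show ?thesis
    using that b(1) components_AE_zero[OF L(2)] by blast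
qed

lemma zpoly_antiderivative: "zpoly p \<Longrightarrow> \<exists>q. zpoly q \<and> d_zbar q = p"
proof (induction rule: zpoly.induct)
  case zpoly_zero
  show ?case using zpoly.zpoly_zero d_zero(2) by blast
next
  case (zpoly_step p c m n)
  then obtain q where q: "zpoly q" "d_zbar q = p" by blast
  let ?c = "c / of_nat (Suc n)"
  have "d_zbar (\<lambda>z. ?c * (z ^ m * cnj z ^ Suc n) + q z) = (\<lambda>z. c * (z ^ m * cnj z ^ n) + p z)"
    unfolding d_zbar_step[OF q(1)] q(2) by (simp del: of_nat_Suc power_Suc)
  then show ?case using zpoly.zpoly_step[OF q(1)] by blast
qed

lemma harmonic_L2: "\<eta> \<in> harmonic \<Longrightarrow> \<eta> \<in> L2_forms"
  by (erule harmonicD) (simp add: adj_iff)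

text \<open>A harmonic form of type (1,1) is orthogonal to the range of \<open>delbar\<close>, which contains all polynomials.\<close>
lemma harmonic_c11:
  assumes "\<eta> \<in> harmonic"
  shows "AE z in disc_measure. w11 \<eta> z = 0"
proof -
  obtain v where v: "(\<eta>, v) \<in> adj delbar_op" "AE z in disc_measure. c10 v z = 0"
    using assms by (rule harmonicD)
  then have L: "\<eta> \<in> L2_forms" "v \<in> L2_forms" by (auto simp: adj_iff)
  note s = L2_formsD[OF L(1)] L2_formsD[OF L(2)]
  have "(\<lambda>z. (1 / 2 * defect z) * w11 \<eta> z) \<in> disc_L2"
    by (intro zpoly_mult_sq_int zpoly_scale zpoly_defect s(4))
  then have ri: "(\<lambda>z. defect z / 2 * w11 \<eta> z) \<in> disc_L2" by simp
  \<comment> \<open>The test forms have unweighted polynomial coefficients, so orthogonality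
    concerns \<open>w11 \<eta>\<close> times a further weight; that weight has no zero in the
    disc.\<close>
  have "AE z in disc_measure. defect z / 2 * w11 \<eta> z = 0"
  proof (rule orthogonal_zpoly_AE_zero[OF ri])
    fix p assume "zpoly p"
    then obtain q where q: "zpoly q" "d_zbar q = p" using zpoly_antiderivative by blast
    have f: "form11 (\<lambda>z. - d_zbar q z) \<in> L2_forms"
      using delbar_zpoly[OF q(1)] by (simp add: delbar_op_iff)
    have "ip (form11 (\<lambda>z. - d_zbar q z)) \<eta> = ip (form10 q) v"
      using v(1) delbar_zpoly[OF q(1)] unfolding adj_iff by blast
    also have "\<dots> = 0"
      using sq_inner_AE_zero[OF sq_int_zpoly[OF q(1)] s(6) v(2)] ip_form10[OF sq_int_zpoly[OF q(1)] L(2)] by simp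
    finally have "disc_inner (w11 (form11 (\<lambda>z. - d_zbar q z))) (w11 \<eta>) = 0"
      using ip_form11[OF f L(1)] by simp
    moreover have "w11 (form11 (\<lambda>z. - d_zbar q z)) z * cnj (w11 \<eta> z) = - (p z * cnj (defect z / 2 * w11 \<eta> z))" for z
      using cnj_defect[of z] by (simp add: w11_def[of "form11 _"] q(2) defect_eq)
    ultimately show "disc_inner p (\<lambda>z. defect z / 2 * w11 \<eta> z) = 0"
      by (simp add: sq_inner_def del: complex_cnj_mult complex_cnj_divide)
  qed
  moreover have "AE z in disc_measure. defect z \<noteq> 0"
    by (intro disc_AE_I defect_nonzero)
  ultimately show ?thesis by eventually_elim simp
qed

text \<open>Types decouple: the (0,0) part of delbar^* \<open>\<eta>\<close> depends only on the
  (0,1) part of \<open>\<eta>\<close> and vanishes, while \<open>delbar\<close> kills type (0,1).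
  This lets H \<open>\<omega>\<close> = 0 be tested in a single type.\<close>

lemma harmonic_form01:
  assumes "\<eta> \<in> harmonic"
  shows "form01 (c01 \<eta>) \<in> harmonic"
proof -
  obtain v where v: "(\<eta>, v) \<in> adj delbar_op" "AE z in disc_measure. w00 v z = 0"
    using assms by (rule harmonicD)
  then have L: "\<eta> \<in> L2_forms" "v \<in> L2_forms" by (auto simp: adj_iff)
  note s = L2_formsD[OF L(1)] L2_formsD[OF L(2)]
  have "(form01 (c01 \<eta>), \<lambda>z. 0) \<in> adj delbar_op"
    unfolding adj_iff
  proof (intro conjI allI impI)
    show f: "form01 (c01 \<eta>) \<in> L2_forms" using s(3) by (simp add: L2_form01)
    fix \<xi> \<zeta> assume d: "(\<xi>, \<zeta>) \<in> delbar_op"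
    then have L': "\<xi> \<in> L2_forms" "\<zeta> \<in> L2_forms" by (auto simp: delbar_op_iff)
    note s' = L2_formsD[OF L'(1)] L2_formsD[OF L'(2)]
    have g: "form00 (c00 \<xi>) \<in> L2_forms" using s'(1) by (simp add: L2_form00)
    have "2 * disc_inner (c01 \<zeta>) (c01 \<eta>) = ip (form01 (c01 \<zeta>)) \<eta>"
      using ip_form01[OF s'(7) L(1)] by simp
    also have "\<dots> = ip (form00 (c00 \<xi>)) v"
      using v(1) delbar_components(2)[OF d] unfolding adj_iff by blast
    also have "\<dots> = disc_inner (w00 \<xi>) (w00 v)"
      using ip_form00[OF g L(2)] by simp
    also have "\<dots> = 0" by (rule sq_inner_AE_zero[OF s'(1) s(5) v(2)])
    finally show "ip \<zeta> (form01 (c01 \<eta>)) = ip \<xi> (\<lambda>z. 0)"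
      using ip_eq[OF L'(2) f] L'(1) by simp
  qed simp
  from box_opI[OF this delbar_kernel(4) delbar_kernel(1)[OF s(3)] zero_adj]
  show ?thesis by (simp add: harmonic_def)
qed

lemma zero_harmonic: "(\<lambda>z. 0) \<in> harmonic"
  using box_opI[OF zero_adj delbar_kernel(4) delbar_kernel(4) zero_adj] by (simp add: harmonic_def)

text \<open>Harmonic forms have no (1,1) part, so on type (1,1) the conditions in
  \<open>green\<close> reduce to solving the box equation.\<close>

lemma harmonic_proj_form11:
  assumes "form11 w \<in> L2_forms"
  shows "(form11 w, \<lambda>z. 0) \<in> harmonic_proj"
proof -
  have "ip (form11 w) \<theta> = 0" if "\<theta> \<in> harmonic" for \<theta>
    using ip_form11[OF assms harmonic_L2[OF that]] harmonic_c11[OF that] L2_formsD(4)[OF assms]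
      L2_formsD(4)[OF harmonic_L2[OF that]] by (simp add: sq_inner_AE_zero)
  then show ?thesis using assms zero_harmonic by (simp add: harmonic_proj_def)
qed

section \<open>The graph of \<open>T\<close> and the fixed point equation\<close>

lemma pairing_cong_AE:
  assumes "u \<in> disc_borel" "u' \<in> disc_borel"
    and "AE z in disc_measure. u z = u' z" "\<phi> \<in> disc_borel"
  shows "pairing u \<phi> = pairing u' \<phi>"
proof -
  have "AE z in disc_measure. u z * \<phi> z = u' z * \<phi> z"
    using assms(3) by eventually_elim simp
  then show ?thesis
    unfolding pairing_def using assms(1,2,4) by (intro integral_cong_AE borel_measurable_times)
qed

text \<open>All forms in the chain may have mixed types. The (1,1) part of box
  \<open>\<omega>\<close> = \<open>\<psi>\<close> - \<open>\<eta>\<close> gives the weak equation,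
  since neither \<open>\<eta>\<close> nor the range of the adjoint has such a part; the (0,1) part
  shows that y has no function component.\<close>

lemma T_graph_imp_T_coeff:
  assumes "(x, y) \<in> del_op O green O adj delbar_op"
  shows "x \<in> L2_forms" "y \<in> L2_forms" "T_coeff (c01 x) (c10 y)" "AE z in disc_measure. w00 y z = 0"
    "AE z in disc_measure. c01 y z = 0" "AE z in disc_measure. w11 y z = 0"
proof -
  let ?M = disc_measure
  obtain \<psi> \<omega> where x\<psi>: "(x, \<psi>) \<in> del_op" and g: "(\<psi>, \<omega>) \<in> green" and \<omega>y: "(\<omega>, y) \<in> adj delbar_op"
    using assms by blast
  obtain \<eta> where \<omega>H: "(\<omega>, \<lambda>z. 0) \<in> harmonic_proj" and \<eta>: "(\<psi>, \<eta>) \<in> harmonic_proj"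
    and b: "(\<omega>, \<lambda>z. \<psi> z - \<eta> z) \<in> box_op"
    using g unfolding green_def by blast
  obtain v \<kappa> \<tau> \<sigma> where v: "(\<omega>, v) \<in> adj delbar_op" "(v, \<kappa>) \<in> delbar_op"
    "(\<omega>, \<tau>) \<in> delbar_op" "(\<tau>, \<sigma>) \<in> adj delbar_op" "(\<lambda>z. \<psi> z - \<eta> z) = (\<lambda>z. \<kappa> z + \<sigma> z)"
    using b by (rule box_opD)
  have \<eta>h: "\<eta> \<in> harmonic" using \<eta> by (simp add: harmonic_proj_def)
  have L: "x \<in> L2_forms" "\<psi> \<in> L2_forms" "\<omega> \<in> L2_forms" "y \<in> L2_forms" "v \<in> L2_forms"
    "\<kappa> \<in> L2_forms" "\<sigma> \<in> L2_forms" "\<eta> \<in> L2_forms"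
    using x\<psi> \<omega>y v harmonic_L2[OF \<eta>h] by (auto simp: adj_iff delbar_op_iff del_op_iff)
  note x = L2_formsD[OF L(1)] and \<psi> = L2_formsD[OF L(2)] and \<omega> = L2_formsD[OF L(3)] and y = L2_formsD[OF L(4)]
    and vs = L2_formsD[OF L(5)] and \<kappa> = L2_formsD[OF L(6)]
  have sum: "c01 \<psi> z - c01 \<eta> z = c01 \<kappa> z + c01 \<sigma> z" "c11 \<psi> z - c11 \<eta> z = c11 \<kappa> z + c11 \<sigma> z" for z
    using fun_cong[OF v(5), of z] by (simp_all add: c01_def c11_def flip: fst_diff snd_diff fst_add snd_add)
  show "x \<in> L2_forms" "y \<in> L2_forms" by (fact L(1), fact L(4))
  note yc = adj_delbar_components[OF \<omega>y] and \<sigma>c = adj_delbar_components[OF v(4)]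
    and yv = adj_delbar_unique[OF v(1) \<omega>y]
  show "AE z in ?M. c01 y z = 0" "AE z in ?M. w11 y z = 0" by (fact yc(1), fact yc(2))
  have D: "AE z in ?M. z \<in> unit_disc" by (rule disc_AE_I)
  have meas: "c11 \<alpha> \<in> disc_borel" "c10 \<alpha> \<in> disc_borel" "c01 \<alpha> \<in> disc_borel"
    if "\<alpha> \<in> L2_forms" for \<alpha>
    using that by (simp_all add: L2_forms_def form_measurable_iff)
  have \<kappa>11: "AE z in ?M. c11 \<kappa> z = c11 \<psi> z"
    using harmonic_c11[OF \<eta>h] \<sigma>c(2) D
  proof eventually_elim
    case (elim z)
    then show ?case using sum(2)[of z] by (simp add: w11_eq_0_iff)
  qed
  show "T_coeff (c01 x) (c10 y)"
    unfolding T_coeff_def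
  proof (intro conjI ballI x(3) y(2) yc(3))
    fix \<phi> assume \<phi>: "\<phi> \<in> test_functions"
    have m: "\<phi> \<in> disc_borel" "d_zbar \<phi> \<in> disc_borel"
      by (intro disc_measurable test_continuous \<phi>)+
    have "pairing (c10 y) (d_zbar \<phi>) = pairing (c10 v) (d_zbar \<phi>)"
      using yv(1) by (intro pairing_cong_AE meas L m) auto
    also have "\<dots> = pairing (c11 \<kappa>) \<phi>" using v(2) \<phi> by (simp add: delbar_op_iff)
    also have "\<dots> = pairing (c11 \<psi>) \<phi>"
      by (intro pairing_cong_AE meas L m \<kappa>11)
    also have "\<dots> = - pairing (c01 x) (d_z \<phi>)" using x\<psi> \<phi> by (simp add: del_op_iff)
    finally show "pairing (c10 y) (d_zbar \<phi>) = - pairing (c01 x) (d_z \<phi>)" .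
  qed
  have "AE z in ?M. c01 \<psi> z = 0"
    using x\<psi> by (intro weakly_zero_AE_zero \<psi>) (simp add: del_op_iff)
  then have \<kappa>01: "AE z in ?M. c01 \<kappa> z = - c01 \<eta> z"
    using \<sigma>c(1)
  proof eventually_elim
    case (elim z)
    then show ?case using sum(1)[of z] by simp
  qed
  have \<eta>1: "c01 \<eta> \<in> disc_L2" using L2_formsD[OF L(8)] by simp
  have f00: "form00 (c00 v) \<in> L2_forms" using vs(1) by (simp add: L2_form00)
  \<comment> \<open>The (0,1) part of del x is zero, so delbar of the function part of v is minus
    the (0,1) part of \<open>\<eta>\<close>. That part is harmonic, hence orthogonal to
    \<open>\<omega>\<close>, and the adjoint relation turns this into vanishing of the norm of
    \<open>w00 v\<close>.\<close>
  have "disc_inner (w00 v) (w00 v) = ip (form00 (c00 v)) v"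
    using ip_form00[OF f00 L(5)] by simp
  also have "\<dots> = ip (form01 (c01 \<kappa>)) \<omega>"
    using v(1) delbar_components(2)[OF v(2)] unfolding adj_iff by metis
  also have "\<dots> = 2 * disc_inner (c01 \<kappa>) (c01 \<omega>)"
    by (rule ip_form01[OF \<kappa>(3) L(3)])
  also have "disc_inner (c01 \<kappa>) (c01 \<omega>) = disc_inner (\<lambda>z. (-1) * c01 \<eta> z) (c01 \<omega>)"
    using \<kappa>01 by (intro sq_inner_cong_AE meas L borel_measurable_times) auto
  also have "\<dots> = - disc_inner (c01 \<eta>) (c01 \<omega>)"
    by (subst sq_inner_scale_left) simp
  also have "2 * - disc_inner (c01 \<eta>) (c01 \<omega>) = - ip (form01 (c01 \<eta>)) \<omega>"
    using ip_form01[OF \<eta>1 L(3)] by simp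
  also have "\<dots> = 0"
  proof -
    have h: "form01 (c01 \<eta>) \<in> harmonic" by (rule harmonic_form01[OF \<eta>h])
    then have "ip \<omega> (form01 (c01 \<eta>)) = 0"
      using \<omega>H by (auto simp: harmonic_proj_def)
    then show ?thesis using ip_commute[OF L(3) harmonic_L2[OF h]] by simp
  qed
  finally have "AE z in ?M. w00 v z = 0"
    by (rule AE_zero_if_sq_inner_self[OF vs(1)])
  then show "AE z in ?M. w00 y z = 0"
    using yv(2) by eventually_elim simp
qed

lemma sq_norm_limit_AE_zero:
  assumes "\<And>n::nat. f n \<in> sq_int M" "g \<in> sq_int M" "\<And>n. AE x in M. f n x = 0"
    and "(\<lambda>n. sq_norm M (\<lambda>x. f n x - g x)) \<longlonglongrightarrow> 0"
  shows "AE x in M. g x = 0"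
proof -
  have "sq_norm M (f n) = 0" for n using assms(1,3) sq_norm_eq_0_iff by blast
  then have "sq_norm M g = 0"
    using tendsto_sq_norm[OF assms(1,2,4)] by (simp add: LIMSEQ_const_iff)
  then show ?thesis using assms(2) sq_norm_eq_0_iff by blast
qed

text \<open>Each component norm is at most the L2 norm, so the properties of the literal graph pass
  to its closure.\<close>

lemma T_op_imp_T_coeff:
  assumes "(\<alpha>, \<gamma>) \<in> T_op"
  shows "\<alpha> \<in> L2_forms" "\<gamma> \<in> L2_forms" "T_coeff (c01 \<alpha>) (c10 \<gamma>)" "AE z in disc_measure. c00 \<gamma> z = 0"
    "AE z in disc_measure. c01 \<gamma> z = 0" "AE z in disc_measure. c11 \<gamma> z = 0"
proof -
  let ?M = disc_measure
  obtain x y where xy: "\<And>n::nat. (x n, y n) \<in> del_op O green O adj delbar_op"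
    and xl: "(\<lambda>n. L2_norm (\<lambda>z. x n z - \<alpha> z)) \<longlonglongrightarrow> 0"
    and yl: "(\<lambda>n. L2_norm (\<lambda>z. y n z - \<gamma> z)) \<longlonglongrightarrow> 0"
    and L: "\<alpha> \<in> L2_forms" "\<gamma> \<in> L2_forms"
    using assms unfolding T_op_def op_closure_def by blast
  show "\<alpha> \<in> L2_forms" "\<gamma> \<in> L2_forms" by (fact L)+
  note T = T_graph_imp_T_coeff[OF xy]
  have xd: "(\<lambda>z. x n z - \<alpha> z) \<in> L2_forms" and yd: "(\<lambda>z. y n z - \<gamma> z) \<in> L2_forms" for n
    by (intro L2_forms_diff T L)+
  have lim: "f \<longlonglongrightarrow> 0" if "g \<longlonglongrightarrow> 0" "\<And>n. f n \<le> g n" "\<And>n. 0 \<le> f n" for f g :: "nat \<Rightarrow> real"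
    using tendsto_sandwich[of "\<lambda>_. 0" f sequentially g] that by simp
  note ny = sq_norm_le_L2_norm[OF yd, unfolded weighted_simps components_simps]
  have l: "(\<lambda>n. disc_norm (\<lambda>z. c01 (x n) z - c01 \<alpha> z)) \<longlonglongrightarrow> 0"
    "(\<lambda>n. disc_norm (\<lambda>z. w00 (y n) z - w00 \<gamma> z)) \<longlonglongrightarrow> 0"
    "(\<lambda>n. disc_norm (\<lambda>z. c10 (y n) z - c10 \<gamma> z)) \<longlonglongrightarrow> 0"
    "(\<lambda>n. disc_norm (\<lambda>z. c01 (y n) z - c01 \<gamma> z)) \<longlonglongrightarrow> 0"
    "(\<lambda>n. disc_norm (\<lambda>z. w11 (y n) z - w11 \<gamma> z)) \<longlonglongrightarrow> 0"
    by (rule lim[OF xl sq_norm_le_L2_norm(3)[OF xd, unfolded components_simps] sq_norm_nonneg],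
        rule lim[OF yl ny(1) sq_norm_nonneg], rule lim[OF yl ny(2) sq_norm_nonneg],
        rule lim[OF yl ny(3) sq_norm_nonneg], rule lim[OF yl ny(4) sq_norm_nonneg])
  show "T_coeff (c01 \<alpha>) (c10 \<gamma>)"
    by (rule T_coeff_limit[OF T(3) L2_formsD(3)[OF L(1)] L2_formsD(2)[OF L(2)] l(1,3)])
  show "AE z in ?M. c01 \<gamma> z = 0"
    by (rule sq_norm_limit_AE_zero[OF L2_formsD(3)[OF T(2)] L2_formsD(3)[OF L(2)] T(5) l(4)])
  have D: "AE z in ?M. z \<in> unit_disc" by (rule disc_AE_I)
  have "AE z in ?M. w00 \<gamma> z = 0"
    by (rule sq_norm_limit_AE_zero[OF L2_formsD(1)[OF T(2)] L2_formsD(1)[OF L(2)] T(4) l(2)])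
  then show "AE z in ?M. c00 \<gamma> z = 0"
    using D by eventually_elim (simp add: w00_eq_0_iff)
  have "AE z in ?M. w11 \<gamma> z = 0"
    by (rule sq_norm_limit_AE_zero[OF L2_formsD(4)[OF T(2)] L2_formsD(4)[OF L(2)] T(6) l(5)])
  then show "AE z in ?M. c11 \<gamma> z = 0"
    using D by eventually_elim (simp add: w11_eq_0_iff)
qed

text \<open>All three operators are explicit here: del kills b0, the harmonic parts are zero,
  \<open>delbar\<close> kills \<open>\<omega>\<close> by degree, and
  \<open>adj_delbar_defect\<close> gives delbar^* \<open>\<omega>\<close>.\<close>

lemma T_graph_defect:
  assumes q: "zpoly q" and b0: "b0 \<in> disc_L2"
    and weak: "\<And>\<phi>. \<phi> \<in> test_functions \<Longrightarrow> pairing b0 (d_z \<phi>) = 0"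
  shows "(form01 (\<lambda>z. d_zbar (bdry q) z + b0 z), form10 (\<lambda>z. - d_z (bdry q) z))
    \<in> del_op O green O adj delbar_op"
proof -
  let ?M = disc_measure
  let ?u = "bdry q"
  let ?\<psi> = "form11 (d_z (d_zbar ?u))"
  let ?\<omega> = "form11 (\<lambda>z. - 2 * q z / defect z)"
  have u: "zpoly ?u" by (rule zpoly_defect_mult[OF q])
  have v: "d_zbar ?u \<in> disc_L2" by (intro sq_int_zpoly zpoly_d_zbar u)
  have \<psi>: "?\<psi> \<in> L2_forms"
    unfolding L2_form11 by (intro w11_continuous zpoly_continuous zpoly_d_z zpoly_d_zbar u)
  note \<omega>y = adj_delbar_defect[OF q]
  then have \<omega>: "?\<omega> \<in> L2_forms" by (simp add: adj_iff)
  have "(form01 (\<lambda>z. d_zbar ?u z + b0 z), ?\<psi>) \<in> del_op"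
    unfolding del_op_iff L2_form01
  proof (intro conjI ballI sq_int_add v b0 \<psi>)
    fix \<phi> assume \<phi>: "\<phi> \<in> test_functions"
    have "pairing (\<lambda>z. d_zbar ?u z + b0 z) (d_z \<phi>) = pairing (d_zbar ?u) (d_z \<phi>) + pairing b0 (d_z \<phi>)"
      unfolding pairing_sq_inner_d by (rule sq_inner_add_left[OF v b0 cnj_test_sq_int(1)[OF \<phi>]])
    then show "pairing (c11 ?\<psi>) \<phi> = - pairing (c01 (form01 (\<lambda>z. d_zbar ?u z + b0 z))) (d_z \<phi>)"
      using weak_d_z_zpoly[OF zpoly_d_zbar[OF u] \<phi>] weak[OF \<phi>] by simp
  qed simp_all
  moreover have "(?\<psi>, ?\<omega>) \<in> green"
  proof -
    have "- d_zbar (\<lambda>z. - d_z ?u z) z = d_z (d_zbar ?u) z" for z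
      using has_wirtinger_d_zbar[OF has_wirtinger_mult[OF has_wirtinger_const[of "-1"]
            differentiable_has_wirtinger[OF zpoly_differentiable[OF zpoly_d_z[OF u], of z]]]]
      by (simp add: zpoly_d_z_d_zbar[OF u])
    then have "(form10 (\<lambda>z. - d_z ?u z), ?\<psi>) \<in> delbar_op"
      using delbar_zpoly[OF zpoly_minus[OF zpoly_d_z[OF u]]] by simp
    from box_opI[OF \<omega>y this delbar_kernel(2)[OF \<omega>] zero_adj]
    have "(?\<omega>, \<lambda>z. ?\<psi> z - 0) \<in> box_op" by simp
    then show ?thesis
      unfolding green_def using harmonic_proj_form11[OF \<omega>] harmonic_proj_form11[OF \<psi>] by blast
  qed
  ultimately show ?thesis using \<omega>y by blast
qed

lemma L2_norm_form:
  "b \<in> disc_L2 \<Longrightarrow> L2_norm (form01 b) = sqrt 2 * disc_norm b"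
  "a \<in> disc_L2 \<Longrightarrow> L2_norm (form10 a) = sqrt 2 * disc_norm a"
  using L2_norm_power2[of "form01 b"] L2_norm_power2[of "form10 a"] L2_form01[of b] L2_form10[of a]
  by (simp_all add: L2_norm_def real_sqrt_mult form10_eq)

lemma T_coeff_imp_T_op:
  assumes T: "T_coeff b t"
  shows "(form01 b, form10 t) \<in> T_op"
proof -
  let ?M = disc_measure
  have b: "b \<in> disc_L2" and t: "t \<in> disc_L2" using T by (auto simp: T_coeff_def)
  obtain t' q b0 where ex: "T_coeff b t'" "b0 \<in> disc_L2"
    "\<forall>\<phi>\<in>test_functions. pairing b0 (d_z \<phi>) = 0" "\<forall>n::nat. zpoly (q n)"
    "(\<lambda>n. disc_norm (\<lambda>z. (d_zbar (bdry (q n)) z + b0 z) - b z)) \<longlonglongrightarrow> 0"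
    "(\<lambda>n. disc_norm (\<lambda>z. - d_z (bdry (q n)) z - t' z)) \<longlonglongrightarrow> 0"
    by (rule T_coeff_exists[OF b])
  have t': "t' \<in> disc_L2" using ex(1) by (simp add: T_coeff_def)
  have vn: "(\<lambda>z. d_zbar (bdry (q n)) z + b0 z) \<in> disc_L2" for n
    by (intro sq_int_add sq_int_zpoly zpoly_d_zbar zpoly_defect_mult ex(2) ex(4)[rule_format])
  have tn: "(\<lambda>z. - d_z (bdry (q n)) z) \<in> disc_L2" for n
    by (intro sq_int_uminus sq_int_zpoly zpoly_d_z zpoly_defect_mult ex(2) ex(4)[rule_format])
  define x where "x n = form01 (\<lambda>z. d_zbar (bdry (q n)) z + b0 z)" for n
  define y where "y n = form10 (\<lambda>z. - d_z (bdry (q n)) z)" for n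
  have xy: "(x n, y n) \<in> del_op O green O adj delbar_op" for n
    unfolding x_def y_def using T_graph_defect ex(2-4) by blast
  have "(\<lambda>z. x n z - form01 b z) = form01 (\<lambda>z. (d_zbar (bdry (q n)) z + b0 z) - b z)" for n
    by (simp add: x_def mk_form_def)
  then have xl: "(\<lambda>n. L2_norm (\<lambda>z. x n z - form01 b z)) \<longlonglongrightarrow> 0"
    using tendsto_mult_left[OF ex(5), of "sqrt 2"] L2_norm_form(1)[OF sq_int_diff[OF vn b]] by simp
  \<comment> \<open>The given t may differ from the constructed limit on a null set, to which L2
    distances are blind.\<close>
  have "AE z in ?M. t z = t' z" by (rule T_coeff_unique[OF T ex(1)])
  then have "AE z in ?M. - d_z (bdry (q n)) z - t z = - d_z (bdry (q n)) z - t' z" for n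
    by eventually_elim simp
  then have tt: "disc_norm (\<lambda>z. - d_z (bdry (q n)) z - t z) = disc_norm (\<lambda>z. - d_z (bdry (q n)) z - t' z)" for n
    using sq_int_diff[OF tn[of n] t] sq_int_diff[OF tn[of n] t'] by (intro sq_norm_cong_AE) (simp_all add: sq_int_def)
  have "(\<lambda>z. y n z - form10 t z) = form10 (\<lambda>z. - d_z (bdry (q n)) z - t z)" for n
    by (simp add: y_def form10_def zero_prod_def)
  then have yl: "(\<lambda>n. L2_norm (\<lambda>z. y n z - form10 t z)) \<longlonglongrightarrow> 0"
    using tendsto_mult_left[OF ex(6), of "sqrt 2"] L2_norm_form(2)[OF sq_int_diff[OF tn t]] by (simp add: tt)
  show ?thesis
    unfolding T_op_def op_closure_def using b t xy xl yl by (auto simp: L2_form01 L2_form10)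
qed

section \<open>Solving the equation for h\<close>

lemma I_plus_T_iff:
  "(\<alpha>, \<beta>) \<in> I_plus_T \<mu>\<^sub>0 \<longleftrightarrow>
    \<alpha> \<in> L2_forms \<and> (\<exists>\<gamma>. (contract \<mu>\<^sub>0 \<alpha>, \<gamma>) \<in> T_op \<and> \<beta> = (\<lambda>z. \<alpha> z + \<gamma> z))"
  by (auto simp: I_plus_T_def op_add_def contract_op_def)

lemma contract_eq: "contract \<mu>\<^sub>0 \<alpha> = form01 (\<lambda>z. \<mu>\<^sub>0 z * c10 \<alpha> z)"
  by (simp add: contract_def mk_form_def)

text \<open>For the coefficient \<open>b\<close> of \<open>dz\<close> in the right-hand side, the solution is the limit of the iteration
  \<open>h \<mapsto> b - T (\<mu> h)\<close>, a contraction by the factor \<open>k\<close>.\<close>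
lemma T_coeff_fixpoint:
  assumes \<mu>: "\<mu> \<in> disc_borel" and k: "AE z in disc_measure. cmod (\<mu> z) \<le> k" "0 \<le> k" "k < 1"
    and b: "b \<in> disc_L2"
  obtains h where "h \<in> disc_L2" "T_coeff (\<lambda>z. \<mu> z * h z) (\<lambda>z. b z - h z)"
proof -
  let ?M = disc_measure
  note mult = sq_int_bounded_mult[OF \<mu> k(1,2)]
  \<comment> \<open>Images are unique only up to null sets; a choice turns the relation into a map
    that can be iterated.\<close>
  define T where "T f = (SOME t. T_coeff f t)" for f
  have T: "T_coeff f (T f)" if "f \<in> disc_L2" for f
  proof -
    have "\<exists>t. T_coeff f t" by (rule T_coeff_exists[OF that]) blast
    then show ?thesis unfolding T_def by (rule someI_ex)
  qed
  define F where "F f z = b z - T (\<lambda>z. \<mu> z * f z) z" for f z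
  define h where "h n = (F ^^ n) b" for n
  have F: "F f \<in> disc_L2" if "f \<in> disc_L2" for f
    unfolding F_def using T[OF mult(1)[OF that]] b by (intro sq_int_diff) (auto simp: T_coeff_def)
  have hs: "h n \<in> disc_L2" for n
    by (induction n) (simp_all add: h_def b F)
  have F_le: "disc_norm (\<lambda>z. F f z - F g z) \<le> k * disc_norm (\<lambda>z. f z - g z)"
    if fg: "f \<in> disc_L2" "g \<in> disc_L2" for f g
  proof -
    have "disc_norm (\<lambda>z. F f z - F g z) = disc_norm (\<lambda>z. T (\<lambda>z. \<mu> z * f z) z - T (\<lambda>z. \<mu> z * g z) z)"
      by (simp add: F_def sq_norm_def norm_minus_commute)
    also have "\<dots> \<le> disc_norm (\<lambda>z. \<mu> z * f z - \<mu> z * g z)"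
      by (rule T_coeff_norm_le[OF T_coeff_diff[OF T[OF mult(1)[OF fg(1)]] T[OF mult(1)[OF fg(2)]]]])
    also have "\<dots> \<le> k * disc_norm (\<lambda>z. f z - g z)"
      using mult(2)[OF sq_int_diff[OF fg]] by (simp add: right_diff_distrib)
    finally show ?thesis .
  qed
  have h_Suc: "h (Suc n) = F (h n)" for n by (simp add: h_def)
  define C where "C = disc_norm (\<lambda>z. h 1 z - h 0 z)"
  have step: "disc_norm (\<lambda>z. h (Suc n) z - h n z) \<le> k ^ n * C" for n
  proof (induction n)
    case (Suc n)
    have "disc_norm (\<lambda>z. h (Suc (Suc n)) z - h (Suc n) z) \<le> k * disc_norm (\<lambda>z. h (Suc n) z - h n z)"
      unfolding h_Suc[of "Suc n"] h_Suc[of n] using F_le[OF hs[of "Suc n"] hs[of n]] by (simp only: h_Suc)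
    also have "\<dots> \<le> k * (k ^ n * C)" using Suc k(2) by (rule mult_left_mono)
    finally show ?case by (simp add: mult.assoc)
  qed (simp add: C_def)
  have dist: "disc_norm (\<lambda>z. h (n + m) z - h n z) \<le> k ^ n * C / (1 - k)" for n m
  proof -
    have "disc_norm (\<lambda>z. h (n + m) z - h n z) \<le> (\<Sum>i<m. k ^ (n + i) * C)"
    proof (induction m)
      case (Suc m)
      show ?case
        using sq_norm_triangle_diff[OF hs[of "Suc (n + m)"] hs[of "n + m"] hs[of n]] step[of "n + m"] Suc by simp
    qed simp
    also have "\<dots> = k ^ n * C * (\<Sum>i<m. k ^ i)"
      by (simp add: sum_distrib_left power_add mult_ac)
    also have "\<dots> \<le> k ^ n * C * (1 / (1 - k))"
    proof (rule mult_left_mono)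
      show "(\<Sum>i<m. k ^ i) \<le> 1 / (1 - k)"
        using sum_le_suminf[OF summable_geometric, of k "{..<m}"] suminf_geometric[of k] k(2,3) by simp
    qed (use k(2) in \<open>simp add: C_def\<close>)
    finally show ?thesis by simp
  qed
  have small: "(\<lambda>n. k ^ n * C / (1 - k)) \<longlonglongrightarrow> 0"
    using tendsto_mult_left_zero[OF LIMSEQ_realpow_zero[OF k(2,3)], of "C / (1 - k)"] by simp
  have Cauchy: "\<exists>N. \<forall>m\<ge>N. \<forall>n\<ge>N. disc_norm (\<lambda>x. h m x - h n x) < e" if e: "0 < e" for e
  proof -
    obtain N where "\<And>n. N \<le> n \<Longrightarrow> norm (k ^ n * C / (1 - k) - 0) < e"
      using LIMSEQ_D[OF small e] by blast
    then have N: "k ^ n * C / (1 - k) < e" if "N \<le> n" for n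
      using abs_ge_self order_le_less_trans that unfolding real_norm_def diff_0_right by blast
    have le: "disc_norm (\<lambda>x. h m x - h n x) < e" if "N \<le> n" "n \<le> m" for m n
      using order_le_less_trans[OF dist[of n "m - n"] N[OF that(1)]] that(2) by simp
    have "disc_norm (\<lambda>x. h m x - h n x) < e" if "N \<le> n" "N \<le> m" for m n
      using le[of n m] le[of m n] that sq_norm_minus_commute[of ?M "h m" "h n"] by (cases "n \<le> m") auto
    then show ?thesis by blast
  qed
  obtain g where g: "g \<in> disc_L2" "(\<lambda>n. disc_norm (\<lambda>x. h n x - g x)) \<longlonglongrightarrow> 0"
    by (rule sq_norm_complete[OF finite_measure_disc hs Cauchy])
  \<comment> \<open>The datum built from \<open>h n\<close> has image \<open>b - h (Suc n)\<close>.
    Both sides converge, so closedness of the graph gives the fixed point, although \<open>g\<close>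
    is no value of the chosen map.\<close>
  have "T_coeff (\<lambda>z. \<mu> z * g z) (\<lambda>z. b z - g z)"
  proof (rule T_coeff_limit)
    show "T_coeff (\<lambda>z. \<mu> z * h n z) (\<lambda>z. b z - h (Suc n) z)" for n
      using T[OF mult(1)[OF hs[of n]]] by (simp add: h_Suc F_def)
    show "(\<lambda>z. \<mu> z * g z) \<in> disc_L2" by (rule mult(1)[OF g(1)])
    show "(\<lambda>z. b z - g z) \<in> disc_L2" by (rule sq_int_diff[OF b g(1)])
    show "(\<lambda>n. disc_norm (\<lambda>z. \<mu> z * h n z - \<mu> z * g z)) \<longlonglongrightarrow> 0"
    proof (rule tendsto_sandwich[OF always_eventually always_eventually tendsto_const])
      show "\<forall>n. 0 \<le> disc_norm (\<lambda>z. \<mu> z * h n z - \<mu> z * g z)" by simp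
      show "\<forall>n. disc_norm (\<lambda>z. \<mu> z * h n z - \<mu> z * g z) \<le> k * disc_norm (\<lambda>z. h n z - g z)"
        using mult(2)[OF sq_int_diff[OF hs g(1)]] by (simp add: right_diff_distrib)
      show "(\<lambda>n. k * disc_norm (\<lambda>z. h n z - g z)) \<longlonglongrightarrow> 0"
        using tendsto_mult_right_zero[OF g(2)] .
    qed
    have "disc_norm (\<lambda>z. (b z - h (Suc n) z) - (b z - g z)) = disc_norm (\<lambda>z. h (Suc n) z - g z)" for n
      by (simp add: sq_norm_def norm_minus_commute)
    then show "(\<lambda>n. disc_norm (\<lambda>z. (b z - h (Suc n) z) - (b z - g z))) \<longlonglongrightarrow> 0"
      using LIMSEQ_Suc[OF g(2)] by simp
  qed
  then show ?thesis using that g(1) by blast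
qed

text \<open>Square integrability of \<open>form10 a\<^sub>0\<close> places it in the Hilbert space
  on which the inverse acts. The inverse appears as a converse graph, with
  \<open>invertible_op\<close> expressing that it is an everywhere defined operator modulo null
  sets; the differential equation is one of distributions.\<close>

theorem proposition8p1:
  fixes \<mu>\<^sub>0 a\<^sub>0 :: "complex \<Rightarrow> complex"
  assumes "\<mu>\<^sub>0 \<in> borel_measurable (lebesgue_on unit_disc)"
    and "esssup (lebesgue_on unit_disc) (\<lambda>z. ereal (cmod (\<mu>\<^sub>0 z))) < 1"
    and "a\<^sub>0 holomorphic_on unit_disc"
    and "form10 a\<^sub>0 \<in> L2_forms"
  shows "invertible_op (I_plus_T \<mu>\<^sub>0) \<and>
    (\<exists>a. (form10 a\<^sub>0, form10 a) \<in> (I_plus_T \<mu>\<^sub>0)\<inverse> \<and>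
         (\<forall>\<phi>\<in>test_functions.
            delbar_dist (form10 a) \<phi> = - del_dist (contract \<mu>\<^sub>0 (form10 a)) \<phi>))"
proof -
  let ?M = disc_measure
  obtain k' where k': "esssup ?M (\<lambda>z. ereal (cmod (\<mu>\<^sub>0 z))) < ereal k'" "ereal k' < 1"
    using ereal_dense2[OF assms(2)] by blast
  \<comment> \<open>\<open>k'\<close> separates the essential supremum from 1; the maximum secures
    the sign that the multiplication bound requires.\<close>
  define k where "k = max k' 0"
  have k: "0 \<le> k" "k < 1" using k'(2) by (auto simp: k_def)
  have kAE: "AE z in ?M. cmod (\<mu>\<^sub>0 z) \<le> k"
    using esssup_AE[of "\<lambda>z. ereal (cmod (\<mu>\<^sub>0 z))" ?M]
  proof eventually_elim
    case (elim z)
    then have "ereal (cmod (\<mu>\<^sub>0 z)) < ereal k'" using k'(1) by (rule order_le_less_trans)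
    then show ?case by (simp add: k_def)
  qed
  note mult_le = sq_int_bounded_mult[OF assms(1) kAE k(1)]
  have solution: "\<exists>h. h \<in> disc_L2 \<and> T_coeff (\<lambda>z. \<mu>\<^sub>0 z * h z) (\<lambda>z. b z - h z)" if "b \<in> disc_L2" for b
    using T_coeff_fixpoint[OF assms(1) kAE k that] by blast
  \<comment> \<open>Up to null sets, T after contraction reads and changes only the coefficient of
    dz, so the graph reduces to one scalar relation.\<close>
  have graph: "\<alpha> \<in> L2_forms" "\<beta> \<in> L2_forms" "T_coeff (\<lambda>z. \<mu>\<^sub>0 z * c10 \<alpha> z) (\<lambda>z. c10 \<beta> z - c10 \<alpha> z)"
    "AE z in ?M. c00 \<alpha> z = c00 \<beta> z \<and> c01 \<alpha> z = c01 \<beta> z \<and> c11 \<alpha> z = c11 \<beta> z"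
    if ab: "(\<alpha>, \<beta>) \<in> I_plus_T \<mu>\<^sub>0" for \<alpha> \<beta>
  proof -
    obtain \<gamma> where \<gamma>: "(contract \<mu>\<^sub>0 \<alpha>, \<gamma>) \<in> T_op" "\<beta> = (\<lambda>z. \<alpha> z + \<gamma> z)" and L: "\<alpha> \<in> L2_forms"
      using ab by (auto simp: I_plus_T_iff)
    note T = T_op_imp_T_coeff[OF \<gamma>(1)]
    show "\<alpha> \<in> L2_forms" "\<beta> \<in> L2_forms" unfolding \<gamma>(2) by (fact L, rule L2_forms_add[OF L T(2)])
    show "T_coeff (\<lambda>z. \<mu>\<^sub>0 z * c10 \<alpha> z) (\<lambda>z. c10 \<beta> z - c10 \<alpha> z)"
      using T(3) by (simp add: \<gamma>(2) contract_eq)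
    show "AE z in ?M. c00 \<alpha> z = c00 \<beta> z \<and> c01 \<alpha> z = c01 \<beta> z \<and> c11 \<alpha> z = c11 \<beta> z"
      using T(4-6) by eventually_elim (simp add: \<gamma>(2))
  qed
  have graphI: "(\<alpha>, \<lambda>z. \<alpha> z + form10 t z) \<in> I_plus_T \<mu>\<^sub>0"
    if "\<alpha> \<in> L2_forms" "T_coeff (\<lambda>z. \<mu>\<^sub>0 z * c10 \<alpha> z) t" for \<alpha> t
    unfolding I_plus_T_iff contract_eq using that T_coeff_imp_T_op by blast
  have form_eqI: "\<alpha> z = \<beta> z"
    if "c00 \<alpha> z = c00 \<beta> z" "c10 \<alpha> z = c10 \<beta> z" "c01 \<alpha> z = c01 \<beta> z" "c11 \<alpha> z = c11 \<beta> z" for \<alpha> \<beta> :: form and z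
    using that by (simp add: c00_def c10_def c01_def c11_def prod_eq_iff)
  have "invertible_op (I_plus_T \<mu>\<^sub>0)"
    unfolding invertible_op_def
  proof (intro conjI ballI)
    show "I_plus_T \<mu>\<^sub>0 \<subseteq> L2_forms \<times> L2_forms" using graph(1,2) by auto
  next
    fix \<alpha> assume \<alpha>: "\<alpha> \<in> L2_forms"
    have "\<exists>t. T_coeff (\<lambda>z. \<mu>\<^sub>0 z * c10 \<alpha> z) t"
      by (rule T_coeff_exists[OF mult_le(1)[OF L2_formsD(2)[OF \<alpha>]]]) blast
    then obtain t where t: "T_coeff (\<lambda>z. \<mu>\<^sub>0 z * c10 \<alpha> z) t" ..
    have "ae_eq \<beta>' \<beta>" if "(\<alpha>, \<beta>) \<in> I_plus_T \<mu>\<^sub>0" "(\<alpha>, \<beta>') \<in> I_plus_T \<mu>\<^sub>0" for \<beta> \<beta>'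
      unfolding ae_eq_def
      using T_coeff_unique[OF graph(3)[OF that(1)] graph(3)[OF that(2)]] graph(4)[OF that(1)] graph(4)[OF that(2)]
      by eventually_elim (rule form_eqI; simp)
    then show "\<exists>\<beta>. (\<alpha>, \<beta>) \<in> I_plus_T \<mu>\<^sub>0 \<and> (\<forall>\<beta>'. (\<alpha>, \<beta>') \<in> I_plus_T \<mu>\<^sub>0 \<longrightarrow> ae_eq \<beta>' \<beta>)"
      using graphI[OF \<alpha> t] by blast
  next
    fix \<beta> assume \<beta>: "\<beta> \<in> L2_forms"
    obtain h where h: "h \<in> disc_L2" "T_coeff (\<lambda>z. \<mu>\<^sub>0 z * h z) (\<lambda>z. c10 \<beta> z - h z)"
      using solution[OF L2_formsD(2)[OF \<beta>]] by blast
    \<comment> \<open>The equation is nontrivial only in the coefficient of dz; the others are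
      copied.\<close>
    define \<alpha> where "\<alpha> = mk_form (c00 \<beta>) h (c01 \<beta>) (c11 \<beta>)"
    have \<alpha>: "\<alpha> \<in> L2_forms"
      unfolding \<alpha>_def L2_forms_iff using L2_formsD[OF \<beta>] h(1) by simp
    have "(\<lambda>z. \<alpha> z + form10 (\<lambda>z. c10 \<beta> z - h z) z) = \<beta>"
      by (rule ext, rule form_eqI) (simp_all add: \<alpha>_def form10_eq)
    then have "(\<alpha>, \<beta>) \<in> I_plus_T \<mu>\<^sub>0"
      using graphI[OF \<alpha>, of "\<lambda>z. c10 \<beta> z - h z"] h(2) by (simp add: \<alpha>_def)
    moreover have "ae_eq \<alpha>2 \<alpha>1" if i: "(\<alpha>1, \<beta>) \<in> I_plus_T \<mu>\<^sub>0" "(\<alpha>2, \<beta>) \<in> I_plus_T \<mu>\<^sub>0" for \<alpha>1 \<alpha>2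
    proof -
      define d where "d z = c10 \<alpha>1 z - c10 \<alpha>2 z" for z
      have s: "c10 \<alpha>1 \<in> disc_L2" "c10 \<alpha>2 \<in> disc_L2"
        using graph(1)[OF i(1)] graph(1)[OF i(2)] L2_formsD(2) by blast+
      have ds: "d \<in> disc_L2" unfolding d_def using s by auto
      have "T_coeff (\<lambda>z. \<mu>\<^sub>0 z * c10 \<alpha>1 z - \<mu>\<^sub>0 z * c10 \<alpha>2 z) (\<lambda>z. (c10 \<beta> z - c10 \<alpha>1 z) - (c10 \<beta> z - c10 \<alpha>2 z))"
        by (rule T_coeff_diff[OF graph(3)[OF i(1)] graph(3)[OF i(2)]])
      \<comment> \<open>The difference of two solutions satisfies d = - T (\<open>\<mu>\<close> d),
        so its norm is at most k times itself.\<close>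
      then have "T_coeff (\<lambda>z. \<mu>\<^sub>0 z * d z) (\<lambda>z. - d z)"
        by (simp add: d_def right_diff_distrib)
      then have "disc_norm d \<le> disc_norm (\<lambda>z. \<mu>\<^sub>0 z * d z)"
        using T_coeff_norm_le by (fastforce simp: sq_norm_def)
      also have "\<dots> \<le> k * disc_norm d" by (rule mult_le(2)[OF ds])
      finally have "(1 - k) * disc_norm d \<le> 0" by (simp add: left_diff_distrib)
      then have "disc_norm d = 0"
        using k(2) sq_norm_nonneg[of ?M d] by (simp add: mult_le_0_iff)
      then have "AE z in ?M. d z = 0" using sq_norm_eq_0_iff[OF ds] by simp
      then show ?thesis
        unfolding ae_eq_def using graph(4)[OF i(1)] graph(4)[OF i(2)]
        by eventually_elim (rule form_eqI; simp add: d_def)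
    qed
    ultimately show "\<exists>\<alpha>. (\<alpha>, \<beta>) \<in> I_plus_T \<mu>\<^sub>0 \<and> (\<forall>\<alpha>'. (\<alpha>', \<beta>) \<in> I_plus_T \<mu>\<^sub>0 \<longrightarrow> ae_eq \<alpha>' \<alpha>)"
      by blast
  qed
  moreover have "\<exists>a. (form10 a\<^sub>0, form10 a) \<in> (I_plus_T \<mu>\<^sub>0)\<inverse> \<and>
         (\<forall>\<phi>\<in>test_functions. delbar_dist (form10 a) \<phi> = - del_dist (contract \<mu>\<^sub>0 (form10 a)) \<phi>)"
  proof -
    have a0: "a\<^sub>0 \<in> disc_L2" using assms(4) by (simp add: L2_form10)
    obtain a where a: "a \<in> disc_L2" "T_coeff (\<lambda>z. \<mu>\<^sub>0 z * a z) (\<lambda>z. a\<^sub>0 z - a z)"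
      using solution[OF a0] by blast
    have "(form10 a, \<lambda>z. form10 a z + form10 (\<lambda>z. a\<^sub>0 z - a z) z) \<in> I_plus_T \<mu>\<^sub>0"
      using a by (intro graphI) (simp_all add: L2_form10, simp add: form10_eq)
    moreover have "(\<lambda>z. form10 a z + form10 (\<lambda>z. a\<^sub>0 z - a z) z) = form10 a\<^sub>0"
      by (simp add: form10_def)
    ultimately have "(form10 a\<^sub>0, form10 a) \<in> (I_plus_T \<mu>\<^sub>0)\<inverse>" by simp
    moreover have "delbar_dist (form10 a) \<phi> = - del_dist (contract \<mu>\<^sub>0 (form10 a)) \<phi>" if \<phi>: "\<phi> \<in> test_functions" for \<phi>
    proof -
      \<comment> \<open>By holomorphy \<open>form10 a\<^sub>0\<close> is weakly annihilated by
        delbar, so the weak equation for the image \<open>a\<^sub>0 - a\<close> becomes the asserted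
        one for \<open>a\<close>.\<close>
      have hol: "has_wirtinger a\<^sub>0 (deriv a\<^sub>0 z) 0 z" if "z \<in> unit_disc" for z
        using assms(3) that by (intro has_wirtinger_field_derivative holomorphic_derivI) (auto simp: unit_disc_def)
      have C1: "C1_on unit_disc a\<^sub>0"
        using assms(3)
        by (intro C1_onI[OF hol]) (auto simp: unit_disc_def intro!: holomorphic_on_imp_continuous_on holomorphic_deriv)
      have d0: "d_zbar a\<^sub>0 z = 0" if "z \<in> unit_disc" for z
        by (rule has_wirtinger_d_zbar[OF hol[OF that]])
      have z: "d_zbar a\<^sub>0 z * \<phi> z = 0" if "z \<in> space ?M" for z
        using d0[of z] that by simp
      have "integrable ?M (\<lambda>z. d_zbar a\<^sub>0 z * \<phi> z) = integrable ?M (\<lambda>z. 0 :: complex)"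
        by (rule Bochner_Integration.integrable_cong[OF refl z])
      moreover have "integrable ?M (\<lambda>z. a\<^sub>0 z * d_zbar \<phi> z)"
        by (intro sq_int_mult_integrable a0 test_sq_int \<phi>)
      ultimately have "pairing (d_zbar a\<^sub>0) \<phi> = - pairing a\<^sub>0 (d_zbar \<phi>)"
        by (intro weak_d_zbar_C1[OF C1 \<phi>]) simp_all
      moreover have "pairing (d_zbar a\<^sub>0) \<phi> = (LINT z|?M. 0)"
        unfolding pairing_def by (rule Bochner_Integration.integral_cong[OF refl z])
      ultimately have "pairing a\<^sub>0 (d_zbar \<phi>) = 0" by simp
      moreover have "pairing (\<lambda>z. a\<^sub>0 z - a z) (d_zbar \<phi>) = pairing a\<^sub>0 (d_zbar \<phi>) - pairing a (d_zbar \<phi>)"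
        unfolding pairing_sq_inner_d by (rule sq_inner_diff_left[OF a0 a(1) cnj_test_sq_int(2)[OF \<phi>]])
      moreover have "pairing (\<lambda>z. a\<^sub>0 z - a z) (d_zbar \<phi>) = - pairing (\<lambda>z. \<mu>\<^sub>0 z * a z) (d_z \<phi>)"
        using a(2) \<phi> by (simp add: T_coeff_def)
      ultimately have "pairing a (d_zbar \<phi>) = pairing (\<lambda>z. \<mu>\<^sub>0 z * a z) (d_z \<phi>)" by simp
      then show ?thesis
        unfolding delbar_dist_def del_dist_def contract_eq form10_eq by simp
    qed
    ultimately show ?thesis by blast
  qed
  ultimately show ?thesis ..
qed

end
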